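(* Let $\omega\in\mathbb R$, $\beta\in\mathbb C$, $L\in\mathbb R$, and consider $$\partial_t u=(1+iL)\partial_x^2u+\beta u-(1+i\omega)u|u|^2$$ for complex-valued $u$, $2\pi$-periodic in $x$. This equation is well-posed in every $H^s$, $s\ge0$, and the following hold uniformly with respect to $L$ as $L\to\infty$: (i) $\|u(t)\|_{H^s}\le Q_s(\|u_0\|_{H^s})e^{-\kappa t}+C_*$, with a monotone function $Q_s$ and positive constants $\kappa,C_*$ depending on $s$ but not on $L$; (ii) $\|u(t)\|_{H^s}\le(1+t^{-N_s})\tilde Q_s(\|u_0\|_H)$ for $t>0$, with monotone $\tilde Q_s$ and constant $N_s$ independent of $L$; (iii) for any two solutions, $\|u_1(t)-u_2(t)\|_H\le e^{Kt}\|u_1(0)-u_2(0)\|_H$, with $K$ depending on the $H$-norms of $u_i(0)$ but not on $L$ or $t$.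
   Context: $H=L^2_{per}(-\pi,\pi)$ (complex-valued, $2\pi$-periodic), $H^s$ periodic Sobolev spaces with $\|v\|_{H^s}^2=\sum_n(|n|^2+1)^s|v_n|^2$ for $v=\sum_n v_ne^{inx}$. *)

theory Defs
  imports "HOL-Analysis.Analysis"
begin

text \<open>Elements of H = L^2_per(-pi,pi) are represented by complex-valued
  2pi-periodic functions on the real line, square integrable on [-pi,pi].
  Two representatives are identified via their Fourier coefficients.\<close>

definition periodic2pi :: "(real \<Rightarrow> complex) \<Rightarrow> bool" where
  "periodic2pi v \<longleftrightarrow> (\<forall>x. v (x + 2 * pi) = v x)"

definition inL2per :: "(real \<Rightarrow> complex) \<Rightarrow> bool" where
  "inL2per v \<longleftrightarrow> periodic2pi v \<and> v measurable_on {-pi..pi}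
     \<and> (\<lambda>x. (cmod (v x))\<^sup>2) integrable_on {-pi..pi}"

definition fc :: "(real \<Rightarrow> complex) \<Rightarrow> int \<Rightarrow> complex" where
  "fc v n = integral {-pi..pi} (\<lambda>x. v x * exp (- (\<i> * of_int n * of_real x))) / of_real (2 * pi)"

definition Hs :: "real \<Rightarrow> (real \<Rightarrow> complex) set" where
  "Hs s = {v. inL2per v \<and>
     (\<lambda>n::int. (real_of_int (n\<^sup>2) + 1) powr s * (cmod (fc v n))\<^sup>2) summable_on UNIV}"

definition hs_norm :: "real \<Rightarrow> (real \<Rightarrow> complex) \<Rightarrow> real" where
  "hs_norm s v = sqrt (\<Sum>\<^sub>\<infinity>n::int. (real_of_int (n\<^sup>2) + 1) powr s * (cmod (fc v n))\<^sup>2)"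

text \<open>Solutions on [0,\<infinity>) of
  u_t = (1 + iL) u_xx + beta u - (1 + i omega) u |u|^2
  with data u0 in H^s: u(t) in C([0,\<infinity>); H^s), u(t) in H^1 for t > 0
  (parabolic smoothing), u(0) = u0 in H, and every Fourier coefficient
  satisfies the Fourier-transformed equation classically for t > 0.\<close>
definition cgl_solution ::
  "real \<Rightarrow> real \<Rightarrow> complex \<Rightarrow> real \<Rightarrow> (real \<Rightarrow> complex) \<Rightarrow> (real \<Rightarrow> real \<Rightarrow> complex) \<Rightarrow> bool" where
  "cgl_solution L \<omega> \<beta> s u0 u \<longleftrightarrow>
     (\<forall>t\<ge>0. u t \<in> Hs s) \<and>
     (\<forall>t\<ge>0. ((\<lambda>\<tau>. hs_norm s (\<lambda>x. u \<tau> x - u t x)) \<longlongrightarrow> 0) (at t within {0..})) \<and>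
     (\<forall>n. fc (u 0) n = fc u0 n) \<and>
     (\<forall>t>0. u t \<in> Hs 1) \<and>
     (\<forall>n. \<forall>t>0. ((\<lambda>\<tau>. fc (u \<tau>) n) has_vector_derivative
        (- (1 + \<i> * of_real L) * of_int (n\<^sup>2) * fc (u t) n + \<beta> * fc (u t) n
         - (1 + \<i> * of_real \<omega>) * fc (\<lambda>x. u t x * of_real ((cmod (u t x))\<^sup>2)) n)) (at t))"

end

theory Submission
  imports Defs
begin

text \<open>
  Everything is read off the Fourier coefficients. Galerkin truncations satisfy energy inequalities
  in every \<open>H\<^sup>s\<close> in which \<open>L\<close> does not occur, because \<open>i L \<partial>\<^sub>x\<^sup>2\<close> is skew-adjoint. In the quartic form
  coming from \<open>u |u|\<^sup>2\<close> two factors are measured in \<open>\<ell>\<^sup>2\<close> and two in \<open>\<ell>\<^sup>1\<close>; an \<open>\<ell>\<^sup>1\<close> norm costs \<open>3/4\<close> of a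
  derivative, so one derivative of dissipation absorbs the nonlinearity at the price of a constant
  depending on the \<open>L\<^sup>2\<close> norm alone. This gives the dissipative and the smoothing estimate, and, applied
  to differences, a Lipschitz estimate in \<open>H\<^sup>s\<close> and the convergence of the truncations.

  A solution is only required to lie in \<open>H\<^sup>1\<close> at each positive time, with no local bound, so that an
  energy identity is not available at once. Baire's theorem, applied to the set of times near which
  the \<open>H\<^sup>1\<close> norm is unbounded, shows that every solution coincides with the limit of the truncations.
\<close>

section \<open>Trilinear estimates\<close>

text \<open>The sign of the cubic term helps only in L^2. There the quartic form is the mean of
  |u|^4, hence real, and \<omega> drops out because \<open>Re nu\<close> is 1. With a weight the
  form is not real in general, so for large \<omega> it has to be absorbed. The exponent 3/4 lies
  between 1/2, above which the powers of \<open>jw\<close> become summable, and 1, the order of the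
  dissipation. The remaining quarter of a derivative pays, by interpolation, for a factor of any
  size in front of the nonlinearity. The residual of a truncation is small only under an H^(2s+1)
  bound, which data in H^s do not provide. So convergence is shown for data with finitely many modes
  and carried to all data by a Lipschitz estimate whose constant depends neither on the truncation
  nor on L. For a solution that is merely given, the case s = 0 of the same comparison asks for a
  local H^1 bound, exactly what the definition of a solution does not supply.\<close>

definition jw :: "int \<Rightarrow> real" where
  "jw n = real_of_int (n\<^sup>2) + 1"

definition en :: "int set \<Rightarrow> real \<Rightarrow> (int \<Rightarrow> complex) \<Rightarrow> real" where
  "en J s a = (\<Sum>n\<in>J. jw n powr s * (cmod (a n))\<^sup>2)"

lemma jw_ge_1: "1 \<le> jw n"
  by (simp add: jw_def)

lemma jw_pos [simp]: "0 < jw n" "0 \<le> jw n" "jw n \<noteq> 0"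
  using jw_ge_1[of n] by linarith+

lemma jw_powr_ge_1: "0 \<le> s \<Longrightarrow> 1 \<le> jw n powr s"
  using jw_ge_1 by (simp add: ge_one_powr_ge_zero)

lemma jw_powr_mono: "s \<le> s' \<Longrightarrow> jw n powr s \<le> jw n powr s'"
  using jw_ge_1 by (simp add: powr_mono)

lemma en_nonneg [simp]: "0 \<le> en J s a"
  by (simp add: en_def sum_nonneg)

lemma en_mono: "s \<le> s' \<Longrightarrow> en J s a \<le> en J s' a"
  unfolding en_def by (intro sum_mono mult_right_mono jw_powr_mono) auto

lemma en_subset: "finite K \<Longrightarrow> J \<subseteq> K \<Longrightarrow> en J s a \<le> en K s a"
  unfolding en_def by (intro sum_mono2) auto

text \<open>One of j, k, l has modulus at least |m|/3, and (3p)^2 + 1 \<le> 9 (p^2 + 1). This is how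
  the weight of an output mode is moved to an input mode.\<close>

lemma jw_le_9_cases:
  assumes "j + l = k + m"
  shows "jw m \<le> 9 * jw j \<or> jw m \<le> 9 * jw k \<or> jw m \<le> 9 * jw l"
proof -
  have aux: "jw m \<le> 9 * jw p" if "\<bar>m\<bar> \<le> 3 * \<bar>p\<bar>" for p
  proof -
    have "m\<^sup>2 \<le> (3 * \<bar>p\<bar>)\<^sup>2"
      using that by (metis abs_ge_zero power2_abs power_mono)
    then have "real_of_int (m\<^sup>2) \<le> real_of_int (9 * p\<^sup>2)"
      by (subst of_int_le_iff) (simp add: power_mult_distrib)
    then show ?thesis by (simp add: jw_def)
  qed
  have "\<bar>m\<bar> \<le> 3 * \<bar>j\<bar> \<or> \<bar>m\<bar> \<le> 3 * \<bar>k\<bar> \<or> \<bar>m\<bar> \<le> 3 * \<bar>l\<bar>"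
    using assms by linarith
  then show ?thesis using aux by blast
qed

lemma jw_powr_le_sum:
  assumes "j + l = k + m" "0 \<le> s"
  shows "jw m powr s \<le> 9 powr s * (jw j powr s + jw k powr s + jw l powr s)"
proof -
  have aux: "jw m powr s \<le> 9 powr s * jw p powr s" if "jw m \<le> 9 * jw p" for p
    using powr_mono2[OF assms(2) _ that] by (simp add: powr_mult)
  have le: "9 powr s * jw p powr s \<le> 9 powr s * (jw j powr s + jw k powr s + jw l powr s)"
    if "p = j \<or> p = k \<or> p = l" for p
    using that by (intro mult_left_mono) auto
  show ?thesis
    using jw_le_9_cases[OF assms(1)] order_trans[OF aux le] by blast
qed

text \<open>The same case distinction, since every weight is at least 1. The version with a sum
  leaves two factors unweighted and so yields constants depending on the L^2 norm; this cruder one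
  suffices where all factors are bounded in H^s anyway.\<close>

lemma jw_powr_le_prod:
  assumes "j + l = k + m" "0 \<le> s"
  shows "jw m powr s \<le> 9 powr s * (jw j powr s * jw k powr s * jw l powr s)"
proof -
  have aux: "jw m powr s \<le> 9 powr s * jw p powr s" if "jw m \<le> 9 * jw p" for p
    using powr_mono2[OF assms(2) _ that] by (simp add: powr_mult)
  have g1: "1 \<le> jw p powr s" for p by (rule jw_powr_ge_1[OF assms(2)])
  have mm: "x \<le> x * y" if "1 \<le> x" "1 \<le> y" for x y :: real
    using mult_left_mono[of 1 y x] that by simp
  have g2: "1 \<le> jw p powr s * jw q powr s" for p q
    using mult_mono[OF g1[of p] g1[of q]] by simp
  have le: "jw p powr s \<le> jw j powr s * jw k powr s * jw l powr s"
    if p: "p = j \<or> p = k \<or> p = l" for p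
    using p mm[OF g1[of j] g2[of k l]] mm[OF g1[of k] g2[of j l]] mm[OF g1[of l] g2[of j k]]
    by (auto simp: mult_ac)
  have "jw m powr s \<le> 9 powr s * (jw j powr s * jw k powr s * jw l powr s)"
    if "jw m \<le> 9 * jw p" "p = j \<or> p = k \<or> p = l" for p
    using order_trans[OF aux[OF that(1)] mult_left_mono[OF le[OF that(2)], of "9 powr s"]] by simp
  then show ?thesis
    using jw_le_9_cases[OF assms(1)] by blast
qed

section \<open>Summability of the weights and convolution bounds\<close>

lemma summable_on_int_if_nat:
  fixes f :: "int \<Rightarrow> real"
  assumes "\<And>n. 0 \<le> f n" "\<And>n. f n \<le> g (nat \<bar>n\<bar>)" "summable g" "\<And>n. 0 \<le> g n"
  shows "f summable_on UNIV"
proof -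
  have g: "g summable_on UNIV"
    using assms(3,4) by (intro norm_summable_imp_summable_on) simp
  have 1: "f summable_on range int"
    by (subst summable_on_reindex)
       (auto simp: o_def intro!: summable_on_comparison_test[OF g] assms(1) order_trans[OF assms(2)])
  have 2: "f summable_on range (\<lambda>n. - int n - 1)"
  proof (subst summable_on_reindex)
    have "(\<lambda>n. g (Suc n)) summable_on UNIV"
      using summable_on_reindex[of Suc UNIV g] summable_on_subset_banach[OF g, of "range Suc"]
      by (simp add: o_def)
    then show "(f \<circ> (\<lambda>n. - int n - 1)) summable_on UNIV"
      by (rule summable_on_comparison_test) (auto simp: o_def assms(1) nat_add_distrib
            intro!: order_trans[OF assms(2)])
  qed (auto simp: inj_on_def)
  have "x \<in> range int \<union> range (\<lambda>n. - int n - 1)" for x :: int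
  proof (cases "x \<ge> 0")
    case True then show ?thesis by (metis UnI1 nonneg_int_cases rangeI)
  next
    case False
    then have "x = - int (nat (- x - 1)) - 1" by simp
    then show ?thesis by blast
  qed
  then have "range int \<union> range (\<lambda>n. - int n - 1) = UNIV" by blast
  moreover have "range int \<inter> range (\<lambda>n. - int n - 1) = {}" by auto
  ultimately show ?thesis using summable_on_Un_disjoint[OF 1 2] by simp
qed

text \<open>\<open>jw n\<close> is of order n^2, so the sum converges for exponents above 1/2; an
  exponent below 1 is dominated by the dissipation. The value 3/4 is the midpoint.\<close>

definition zc :: real where
  "zc = (\<Sum>\<^sub>\<infinity>n. jw n powr (-3/4))"

lemma jw_summable: "(\<lambda>n. jw n powr (-3/4)) summable_on UNIV"
proof (rule summable_on_int_if_nat)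
  show "summable (\<lambda>n::nat. jw (int n) powr (-3/4))"
  proof (rule summable_comparison_test)
    show "summable (\<lambda>n::nat. real n powr (-3/2))" by (simp add: summable_real_powr_iff)
    show "\<exists>N. \<forall>n\<ge>N. norm (jw (int n) powr (-3/4)) \<le> real n powr (-3/2)"
    proof (intro exI[of _ 1] allI impI)
      fix n :: nat assume n: "1 \<le> n"
      have "real n powr (-3/2) = (real n powr 2) powr (-3/4)"
        by (simp only: powr_powr) simp
      also have "real n powr 2 = (real n)\<^sup>2" using n by simp
      finally have e: "real n powr (-3/2) = ((real n)\<^sup>2) powr (-3/4)" .
      have "jw (int n) powr (-3/4) \<le> ((real n)\<^sup>2) powr (-3/4)"
        using n by (intro powr_mono2') (auto simp: jw_def)
      then show "norm (jw (int n) powr (-3/4)) \<le> real n powr (-3/2)"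
        unfolding e by simp
    qed
  qed
qed (auto simp: jw_def)

lemma sum_jw_le_zc: "finite J \<Longrightarrow> (\<Sum>n\<in>J. jw n powr (-3/4)) \<le> zc"
  unfolding zc_def by (intro finite_sum_le_infsum jw_summable) auto

lemma zc_nonneg: "0 \<le> zc"
  using sum_jw_le_zc[of "{}"] by simp

text \<open>Cauchy-Schwarz after splitting off \<open>jw n powr (-3/8)\<close>, whose squares sum to
  at most \<open>zc\<close>.\<close>

lemma l1_le_en:
  assumes "finite J"
  shows "(\<Sum>n\<in>J. jw n powr (s/2) * cmod (a n))\<^sup>2 \<le> zc * en J (s + 3/4) a"
proof -
  have "(\<Sum>n\<in>J. jw n powr (s/2) * cmod (a n))
      = (\<Sum>n\<in>J. jw n powr (-3/8) * (jw n powr (s/2 + 3/8) * cmod (a n)))"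
    by (intro sum.cong refl) (simp add: mult.assoc[symmetric] powr_add[symmetric])
  then have "(\<Sum>n\<in>J. jw n powr (s/2) * cmod (a n))\<^sup>2
      \<le> (\<Sum>n\<in>J. (jw n powr (-3/8))\<^sup>2) * (\<Sum>n\<in>J. (jw n powr (s/2 + 3/8) * cmod (a n))\<^sup>2)"
    by (simp add: Cauchy_Schwarz_ineq_sum)
  also have "(\<Sum>n\<in>J. (jw n powr (-3/8))\<^sup>2) = (\<Sum>n\<in>J. jw n powr (-3/4))"
    by (intro sum.cong refl) (simp add: power2_eq_square powr_add[symmetric])
  also have "(\<Sum>n\<in>J. (jw n powr (s/2 + 3/8) * cmod (a n))\<^sup>2) = en J (s + 3/4) a"
    unfolding en_def by (intro sum.cong refl)
      (simp add: power_mult_distrib power2_eq_square powr_add[symmetric])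
  also have "(\<Sum>n\<in>J. jw n powr (-3/4)) * en J (s + 3/4) a \<le> zc * en J (s + 3/4) a"
    by (intro mult_right_mono sum_jw_le_zc assms) auto
  finally show ?thesis .
qed

text \<open>\<open>P\<close> is the graph of a partial injection: both projections are injective on
  \<open>R\<close>, so Cauchy-Schwarz over \<open>R\<close> counts each term of the two l^2 norms at
  most once.\<close>

lemma pair_sum_le:
  fixes g h :: "'a \<Rightarrow> real"
  assumes J: "finite J"
    and P1: "\<And>k l l'. P k l \<Longrightarrow> P k l' \<Longrightarrow> l = l'"
    and P2: "\<And>k k' l. P k l \<Longrightarrow> P k' l \<Longrightarrow> k = k'"
  shows "(\<Sum>k\<in>J. \<Sum>l\<in>J. if P k l then g k * h l else 0)
    \<le> sqrt (\<Sum>k\<in>J. (g k)\<^sup>2) * sqrt (\<Sum>k\<in>J. (h k)\<^sup>2)"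
proof -
  define R where "R = {p \<in> J \<times> J. P (fst p) (snd p)}"
  have fR: "finite R" using J by (simp add: R_def)
  have "(\<Sum>k\<in>J. \<Sum>l\<in>J. if P k l then g k * h l else 0)
      = (\<Sum>p\<in>J \<times> J. if P (fst p) (snd p) then g (fst p) * h (snd p) else 0)"
    by (simp add: sum.cartesian_product case_prod_beta)
  also have "\<dots> = (\<Sum>p\<in>R. g (fst p) * h (snd p))"
    unfolding R_def using J by (intro sum.inter_filter[symmetric]) auto
  finally have e: "(\<Sum>k\<in>J. \<Sum>l\<in>J. if P k l then g k * h l else 0) = (\<Sum>p\<in>R. g (fst p) * h (snd p))" .
  have g: "(\<Sum>p\<in>R. (g (fst p))\<^sup>2) \<le> (\<Sum>k\<in>J. (g k)\<^sup>2)"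
  proof -
    have "inj_on fst R" by (auto simp: inj_on_def R_def dest: P1)
    then have "(\<Sum>p\<in>R. (g (fst p))\<^sup>2) = (\<Sum>k\<in>fst ` R. (g k)\<^sup>2)"
      by (simp add: sum.reindex)
    also have "\<dots> \<le> (\<Sum>k\<in>J. (g k)\<^sup>2)"
      using J by (intro sum_mono2) (auto simp: R_def)
    finally show ?thesis .
  qed
  have h: "(\<Sum>p\<in>R. (h (snd p))\<^sup>2) \<le> (\<Sum>k\<in>J. (h k)\<^sup>2)"
  proof -
    have "inj_on snd R" by (auto simp: inj_on_def R_def dest: P2)
    then have "(\<Sum>p\<in>R. (h (snd p))\<^sup>2) = (\<Sum>k\<in>snd ` R. (h k)\<^sup>2)"
      by (simp add: sum.reindex)
    also have "\<dots> \<le> (\<Sum>k\<in>J. (h k)\<^sup>2)"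
      using J by (intro sum_mono2) (auto simp: R_def)
    finally show ?thesis .
  qed
  have "(\<Sum>p\<in>R. g (fst p) * h (snd p))\<^sup>2 \<le> (\<Sum>p\<in>R. (g (fst p))\<^sup>2) * (\<Sum>p\<in>R. (h (snd p))\<^sup>2)"
    by (rule Cauchy_Schwarz_ineq_sum)
  also have "\<dots> \<le> (\<Sum>k\<in>J. (g k)\<^sup>2) * (\<Sum>k\<in>J. (h k)\<^sup>2)"
    by (intro mult_mono g h sum_nonneg) auto
  finally show ?thesis
    unfolding e real_sqrt_mult[symmetric] by (rule real_le_rsqrt)
qed

text \<open>The Fourier side of the mean over a period of f g* h d*, where * is complex conjugation
  and the functions have the given coefficients on \<open>J\<close>.\<close>

definition quad :: "int set \<Rightarrow> (int \<Rightarrow> real) \<Rightarrow> (int \<Rightarrow> real) \<Rightarrow> (int \<Rightarrow> real) \<Rightarrow> (int \<Rightarrow> real) \<Rightarrow> real" where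
  "quad J f g h d =
    (\<Sum>m\<in>J. \<Sum>j\<in>J. \<Sum>k\<in>J. \<Sum>l\<in>J. if j + l = k + m then f j * g k * h l * d m else 0)"

definition cub :: "int set \<Rightarrow> (int \<Rightarrow> complex) \<Rightarrow> int \<Rightarrow> complex" where
  "cub J a n = (\<Sum>j\<in>J. \<Sum>k\<in>J. \<Sum>l\<in>J. if j + l = k + n then a j * cnj (a k) * a l else 0)"

text \<open>For fixed j and m the relation pairs each k with at most one l, so these two factors
  cost l^2 norms only and the other two l^1 norms. The three variants differ in which input joins
  \<open>d\<close> in l^1; it will be the one carrying the weight, or the difference of two
  solutions.\<close>

lemma quad_le_1:
  assumes J: "finite J" and nn: "\<And>n. 0 \<le> f n" "\<And>n. 0 \<le> d n"
  shows "quad J f g h d \<le> sum f J * sum d J * (sqrt (\<Sum>k\<in>J. (g k)\<^sup>2) * sqrt (\<Sum>k\<in>J. (h k)\<^sup>2))"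
proof -
  have "quad J f g h d = (\<Sum>m\<in>J. \<Sum>j\<in>J. (f j * d m) * (\<Sum>k\<in>J. \<Sum>l\<in>J. if j + l = k + m then g k * h l else 0))"
    unfolding quad_def sum_distrib_left by (intro sum.cong refl) auto
  also have "\<dots> \<le> (\<Sum>m\<in>J. \<Sum>j\<in>J. (f j * d m) * (sqrt (\<Sum>k\<in>J. (g k)\<^sup>2) * sqrt (\<Sum>k\<in>J. (h k)\<^sup>2)))"
    using nn by (intro sum_mono mult_left_mono pair_sum_le J) auto
  also have "\<dots> = sum f J * sum d J * (sqrt (\<Sum>k\<in>J. (g k)\<^sup>2) * sqrt (\<Sum>k\<in>J. (h k)\<^sup>2))"
    unfolding sum_distrib_left sum_distrib_right ..
  finally show ?thesis .
qed

lemma quad_le_2: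
  assumes J: "finite J" and nn: "\<And>n. 0 \<le> g n" "\<And>n. 0 \<le> d n"
  shows "quad J f g h d \<le> sum g J * sum d J * (sqrt (\<Sum>k\<in>J. (f k)\<^sup>2) * sqrt (\<Sum>k\<in>J. (h k)\<^sup>2))"
proof -
  have "quad J f g h d = (\<Sum>m\<in>J. \<Sum>k\<in>J. (g k * d m) * (\<Sum>j\<in>J. \<Sum>l\<in>J. if j + l = k + m then f j * h l else 0))"
    unfolding quad_def sum_distrib_left
    by (rule sum.cong[OF refl], subst sum.swap) (intro sum.cong refl, auto)
  also have "\<dots> \<le> (\<Sum>m\<in>J. \<Sum>j\<in>J. (g j * d m) * (sqrt (\<Sum>k\<in>J. (f k)\<^sup>2) * sqrt (\<Sum>k\<in>J. (h k)\<^sup>2)))"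
    using nn by (intro sum_mono mult_left_mono pair_sum_le J) auto
  also have "\<dots> = sum g J * sum d J * (sqrt (\<Sum>k\<in>J. (f k)\<^sup>2) * sqrt (\<Sum>k\<in>J. (h k)\<^sup>2))"
    unfolding sum_distrib_left sum_distrib_right ..
  finally show ?thesis .
qed

text \<open>The relation is symmetric in j and l, so exchanging them reduces this to the first
  variant.\<close>

lemma quad_le_3:
  fixes f g h d :: "int \<Rightarrow> real"
  assumes J: "finite J" and nn: "\<And>n. 0 \<le> h n" "\<And>n. 0 \<le> d n"
  shows "quad J f g h d \<le> sum h J * sum d J * (sqrt (\<Sum>k\<in>J. (f k)\<^sup>2) * sqrt (\<Sum>k\<in>J. (g k)\<^sup>2))"
proof -
  have "(\<Sum>j\<in>J. \<Sum>k\<in>J. \<Sum>l\<in>J. if j + l = k + m then f j * g k * h l * d m else 0)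
      = (\<Sum>j\<in>J. \<Sum>k\<in>J. \<Sum>l\<in>J. if j + l = k + m then h j * g k * f l * d m else 0)" for m :: int
  proof -
    have "(\<Sum>j\<in>J. \<Sum>k\<in>J. \<Sum>l\<in>J. if j + l = k + m then f j * g k * h l * d m else 0)
        = (\<Sum>k\<in>J. \<Sum>j\<in>J. \<Sum>l\<in>J. if j + l = k + m then f j * g k * h l * d m else 0)"
      by (rule sum.swap)
    also have "\<dots> = (\<Sum>k\<in>J. \<Sum>l\<in>J. \<Sum>j\<in>J. if j + l = k + m then f j * g k * h l * d m else 0)"
      by (intro sum.cong refl sum.swap)
    also have "\<dots> = (\<Sum>l\<in>J. \<Sum>k\<in>J. \<Sum>j\<in>J. if j + l = k + m then f j * g k * h l * d m else 0)"
      by (rule sum.swap)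
    also have "\<dots> = (\<Sum>j\<in>J. \<Sum>k\<in>J. \<Sum>l\<in>J. if j + l = k + m then h j * g k * f l * d m else 0)"
      by (intro sum.cong refl) (auto simp: add.commute mult_ac)
    finally show ?thesis .
  qed
  then have "quad J f g h d = quad J h g f d"
    unfolding quad_def by simp
  then show ?thesis using quad_le_1[OF J nn, where g = g and h = f] by (simp add: mult.commute)
qed

lemma quad_mono_sum:
  assumes "\<And>j k l m. j + l = k + m \<Longrightarrow> F j k l m \<le> C * (f1 j * g1 k * h1 l * d1 m + f2 j * g2 k * h2 l * d2 m + f3 j * g3 k * h3 l * d3 m)"
  shows "(\<Sum>m\<in>J. \<Sum>j\<in>J. \<Sum>k\<in>J. \<Sum>l\<in>J. if j + l = k + m then F j k l m else 0)
    \<le> C * (quad J f1 g1 h1 d1 + quad J f2 g2 h2 d2 + quad J f3 g3 h3 d3)"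
proof -
  have "(\<Sum>m\<in>J. \<Sum>j\<in>J. \<Sum>k\<in>J. \<Sum>l\<in>J. if j + l = k + m then F j k l m else 0)
    \<le> (\<Sum>m\<in>J. \<Sum>j\<in>J. \<Sum>k\<in>J. \<Sum>l\<in>J. C * ((if j + l = k + m then f1 j * g1 k * h1 l * d1 m else 0)
        + (if j + l = k + m then f2 j * g2 k * h2 l * d2 m else 0) + (if j + l = k + m then f3 j * g3 k * h3 l * d3 m else 0)))"
    using assms by (intro sum_mono) auto
  also have "\<dots> = C * (quad J f1 g1 h1 d1 + quad J f2 g2 h2 d2 + quad J f3 g3 h3 d3)"
    unfolding quad_def sum.distrib sum_distrib_left[symmetric] ..
  finally show ?thesis .
qed

section \<open>Weighted estimates for the cubic term\<close>

lemma sum_sq_en: "(\<Sum>k\<in>J. (jw k powr (s/2) * cmod (a k))\<^sup>2) = en J s a"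
  unfolding en_def by (intro sum.cong refl) (simp add: power_mult_distrib power2_eq_square powr_add[symmetric])

lemma sum_sq_en0: "(\<Sum>k\<in>J. (cmod (a k))\<^sup>2) = en J 0 a"
  by (simp add: en_def)

lemma cub_weighted_le:
  fixes F :: "int \<Rightarrow> int \<Rightarrow> int \<Rightarrow> complex"
  shows "cmod (\<Sum>m\<in>J. of_real (jw m powr s) * cnj (w m) * (\<Sum>j\<in>J. \<Sum>k\<in>J. \<Sum>l\<in>J. if j + l = k + m then F j k l else 0))
    \<le> (\<Sum>m\<in>J. \<Sum>j\<in>J. \<Sum>k\<in>J. \<Sum>l\<in>J. if j + l = k + m then jw m powr s * cmod (w m) * cmod (F j k l) else 0)"
  unfolding sum_distrib_left
  by (intro order_trans[OF norm_sum] sum_mono) (auto simp: norm_mult)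

text \<open>Half of the weight stays with the output mode, the other half goes to one of three
  inputs, whence 3 and \<open>9 powr (s/2)\<close>. The two weighted factors are put in l^1 and the
  two bare ones in l^2, so the factor in front of the H^(s+3/4) term involves only the L^2
  norm.\<close>

theorem cub_energy_le:
  assumes J: "finite J" and s: "0 \<le> s"
  shows "cmod (\<Sum>n\<in>J. of_real (jw n powr s) * cnj (a n) * cub J a n)
    \<le> 3 * 9 powr (s/2) * zc * en J 0 a * en J (s + 3/4) a"
proof -
  define A where "A n = jw n powr (s/2) * cmod (a n)" for n
  define f where "f n = cmod (a n)" for n
  have nn: "0 \<le> A n" "0 \<le> f n" for n by (auto simp: A_def f_def)
  have l1: "sum A J * sum A J \<le> zc * en J (s + 3/4) a"
    using l1_le_en[OF J, of s a] by (simp add: A_def power2_eq_square)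
  have l2: "sqrt (\<Sum>k\<in>J. (f k)\<^sup>2) * sqrt (\<Sum>k\<in>J. (f k)\<^sup>2) = en J 0 a"
    by (simp add: f_def sum_sq_en0)
  have Q: "q \<le> (zc * en J (s + 3/4) a) * en J 0 a"
    if "q \<le> sum A J * sum A J * (sqrt (\<Sum>k\<in>J. (f k)\<^sup>2) * sqrt (\<Sum>k\<in>J. (f k)\<^sup>2))" for q
    using order_trans[OF that, unfolded l2] mult_right_mono[OF l1, of "en J 0 a"] by simp
  have "cmod (\<Sum>n\<in>J. of_real (jw n powr s) * cnj (a n) * cub J a n)
      \<le> (\<Sum>m\<in>J. \<Sum>j\<in>J. \<Sum>k\<in>J. \<Sum>l\<in>J. if j + l = k + m then jw m powr s * cmod (a m) * cmod (a j * cnj (a k) * a l) else 0)"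
    unfolding cub_def by (rule cub_weighted_le)
  also have "\<dots> \<le> 9 powr (s/2) * (quad J A f f A + quad J f A f A + quad J f f A A)"
  proof (rule quad_mono_sum)
    fix j k l m :: int assume e: "j + l = k + m"
    have "jw m powr s * cmod (a m) = jw m powr (s/2) * A m"
      by (simp add: A_def mult.assoc[symmetric] powr_add[symmetric])
    also have "\<dots> \<le> (9 powr (s/2) * (jw j powr (s/2) + jw k powr (s/2) + jw l powr (s/2))) * A m"
      using e s nn by (intro mult_right_mono jw_powr_le_sum) auto
    finally have "jw m powr s * cmod (a m) * (f j * f k * f l) \<le>
      (9 powr (s/2) * (jw j powr (s/2) + jw k powr (s/2) + jw l powr (s/2))) * A m * (f j * f k * f l)"
      using nn by (intro mult_right_mono) auto
    then show "jw m powr s * cmod (a m) * cmod (a j * cnj (a k) * a l)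
      \<le> 9 powr (s/2) * (A j * f k * f l * A m + f j * A k * f l * A m + f j * f k * A l * A m)"
      by (simp add: norm_mult f_def A_def algebra_simps)
  qed
  also have "\<dots> \<le> 9 powr (s/2) * (zc * en J (s + 3/4) a * en J 0 a + zc * en J (s + 3/4) a * en J 0 a + zc * en J (s + 3/4) a * en J 0 a)"
    by (intro mult_left_mono add_mono Q quad_le_1 quad_le_2 quad_le_3 J nn) auto
  also have "\<dots> = 3 * 9 powr (s/2) * zc * en J 0 a * en J (s + 3/4) a" by simp
  finally show ?thesis .
qed

text \<open>The difference of the products telescopes into three terms with one difference each.
  Together with the test function it gives two factors \<open>W\<close>, put in l^1; the two
  remaining factors are at most \<open>sqrt R\<close> in l^2.\<close>

theorem cub_diff_energy_le:
  assumes J: "finite J" and s: "0 \<le> s"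
    and R: "en J s a \<le> R" "en J s b \<le> R"
  shows "cmod (\<Sum>n\<in>J. of_real (jw n powr s) * cnj (a n - b n) * (cub J a n - cub J b n))
    \<le> 3 * 9 powr (s/2) * zc * R * en J (s + 3/4) (\<lambda>n. a n - b n)"
proof -
  define A where "A n = jw n powr (s/2) * cmod (a n)" for n
  define B where "B n = jw n powr (s/2) * cmod (b n)" for n
  define W where "W n = jw n powr (s/2) * cmod (a n - b n)" for n
  have nn: "0 \<le> A n" "0 \<le> B n" "0 \<le> W n" for n by (auto simp: A_def B_def W_def)
  have R0: "0 \<le> R" using en_nonneg R(1) by (rule order_trans)
  have l1: "sum W J * sum W J \<le> zc * en J (s + 3/4) (\<lambda>n. a n - b n)"
    using l1_le_en[OF J, of s "\<lambda>n. a n - b n"] by (simp add: W_def power2_eq_square)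
  have l2: "sqrt (\<Sum>k\<in>J. (A k)\<^sup>2) \<le> sqrt R" "sqrt (\<Sum>k\<in>J. (B k)\<^sup>2) \<le> sqrt R"
    using R by (auto simp: A_def B_def sum_sq_en)
  have Q: "q \<le> (zc * en J (s + 3/4) (\<lambda>n. a n - b n)) * R"
    if q: "q \<le> sum W J * sum W J * (sqrt x * sqrt y)" "sqrt x \<le> sqrt R" "sqrt y \<le> sqrt R" "0 \<le> x" "0 \<le> y" for q x y
  proof -
    have "sqrt x * sqrt y \<le> sqrt R * sqrt R"
      using q R0 by (intro mult_mono) auto
    then have "sqrt x * sqrt y \<le> R" using R0 by simp
    then have "sum W J * sum W J * (sqrt x * sqrt y) \<le> (zc * en J (s + 3/4) (\<lambda>n. a n - b n)) * R"
      using q zc_nonneg by (intro mult_mono l1) auto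
    then show ?thesis using q by simp
  qed
  have p: "0 \<le> (\<Sum>k\<in>J. (f k)\<^sup>2)" for f :: "int \<Rightarrow> real" by (simp add: sum_nonneg)
  have alg: "(c * (p * q * r)) * (t * w) * (x1 * x2 * x3 + y1 * y2 * y3 + z1 * z2 * z3)
      = c * ((p * x1) * (q * x2) * (r * x3) * (t * w) + (p * y1) * (q * y2) * (r * y3) * (t * w) + (p * z1) * (q * z2) * (r * z3) * (t * w))"
    for c p q r t w x1 x2 x3 y1 y2 y3 z1 z2 z3 :: real by (simp add: algebra_simps)
  note q1 = Q[OF quad_le_1[OF J nn(3) nn(3)] l2(1) l2(1) p p]
  note q2 = Q[OF quad_le_2[OF J nn(3) nn(3)] l2(2) l2(1) p p]
  note q3 = Q[OF quad_le_3[OF J nn(3) nn(3)] l2(2) l2(2) p p]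
  have "cmod (\<Sum>n\<in>J. of_real (jw n powr s) * cnj (a n - b n) * (cub J a n - cub J b n))
      = cmod (\<Sum>m\<in>J. of_real (jw m powr s) * cnj (a m - b m) * (\<Sum>j\<in>J. \<Sum>k\<in>J. \<Sum>l\<in>J.
          if j + l = k + m then a j * cnj (a k) * a l - b j * cnj (b k) * b l else 0))"
    unfolding cub_def sum_subtractf[symmetric]
    by (intro arg_cong[where f = cmod] arg_cong2[where f = "(*)"] sum.cong refl) auto
  also have "\<dots> \<le> (\<Sum>m\<in>J. \<Sum>j\<in>J. \<Sum>k\<in>J. \<Sum>l\<in>J. if j + l = k + m then jw m powr s * cmod (a m - b m) * cmod (a j * cnj (a k) * a l - b j * cnj (b k) * b l) else 0)"
    by (rule cub_weighted_le)
  also have "\<dots> \<le> 9 powr (s/2) * (quad J W A A W + quad J B W A W + quad J B B W W)"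
  proof (rule quad_mono_sum)
    fix j k l m :: int assume e: "j + l = k + m"
    define wt where "wt = jw j powr (s/2) * jw k powr (s/2) * jw l powr (s/2)"
    have wt: "0 \<le> wt" by (simp add: wt_def)
    have "a j * cnj (a k) * a l - b j * cnj (b k) * b l
        = (a j - b j) * cnj (a k) * a l + b j * cnj (a k - b k) * a l + b j * cnj (b k) * (a l - b l)"
      by (simp add: algebra_simps)
    also have "cmod \<dots> \<le> cmod (a j - b j) * cmod (a k) * cmod (a l) + cmod (b j) * cmod (a k - b k) * cmod (a l) + cmod (b j) * cmod (b k) * cmod (a l - b l)"
      by (intro order_trans[OF norm_triangle_ineq] add_mono)
         (auto simp: norm_mult simp del: complex_cnj_diff)
    finally have d: "cmod (a j * cnj (a k) * a l - b j * cnj (b k) * b l) \<le> \<dots>" .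
    have "jw m powr s * cmod (a m - b m) = jw m powr (s/2) * W m"
      by (simp add: W_def mult.assoc[symmetric] powr_add[symmetric])
    also have "\<dots> \<le> (9 powr (s/2) * wt) * W m"
      unfolding wt_def using e s nn by (intro mult_right_mono jw_powr_le_prod) auto
    finally have "jw m powr s * cmod (a m - b m) * cmod (a j * cnj (a k) * a l - b j * cnj (b k) * b l)
      \<le> (9 powr (s/2) * wt) * W m * (cmod (a j - b j) * cmod (a k) * cmod (a l) + cmod (b j) * cmod (a k - b k) * cmod (a l) + cmod (b j) * cmod (b k) * cmod (a l - b l))"
      using d nn wt by (intro mult_mono[where b = "9 powr (s/2) * wt * W m"]) auto
    then show "jw m powr s * cmod (a m - b m) * cmod (a j * cnj (a k) * a l - b j * cnj (b k) * b l)
      \<le> 9 powr (s/2) * (W j * A k * A l * W m + B j * W k * A l * W m + B j * B k * W l * W m)"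
      unfolding wt_def A_def B_def W_def
      using alg[of "9 powr (s/2)"] by (simp only:)
  qed
  also have "\<dots> \<le> 9 powr (s/2) * (zc * en J (s + 3/4) (\<lambda>n. a n - b n) * R + zc * en J (s + 3/4) (\<lambda>n. a n - b n) * R + zc * en J (s + 3/4) (\<lambda>n. a n - b n) * R)"
    by (intro mult_left_mono add_mono q1 q2 q3) auto
  also have "\<dots> = 3 * 9 powr (s/2) * zc * R * en J (s + 3/4) (\<lambda>n. a n - b n)" by simp
  finally show ?thesis .
qed

text \<open>Grouping the indices by the value of \<open>e\<close> turns the double sum into a sum
  over fibres, each of which contributes the squared modulus of its own sum.\<close>

lemma sum_grouped_cnj:
  fixes c :: "'a \<Rightarrow> complex"
  assumes X: "finite X"
  shows "(\<Sum>x\<in>X. \<Sum>y\<in>X. if e x = e y then c x * cnj (c y) else 0)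
    = of_real (\<Sum>p\<in>e ` X. (cmod (\<Sum>x\<in>{x\<in>X. e x = p}. c x))\<^sup>2)"
proof -
  have "(\<Sum>x\<in>X. \<Sum>y\<in>X. if e x = e y then c x * cnj (c y) else 0)
      = (\<Sum>p\<in>e ` X. \<Sum>x\<in>{x\<in>X. e x = p}. \<Sum>y\<in>X. if e x = e y then c x * cnj (c y) else 0)"
    by (rule sum.image_gen[OF X])
  also have "\<dots> = (\<Sum>p\<in>e ` X. \<Sum>x\<in>{x\<in>X. e x = p}. \<Sum>y\<in>{y\<in>X. e y = p}. c x * cnj (c y))"
    by (rule sum.cong[OF refl], rule sum.cong[OF refl], subst sum.inter_filter[OF X]) (auto intro!: sum.cong)
  also have "\<dots> = (\<Sum>p\<in>e ` X. (\<Sum>x\<in>{x\<in>X. e x = p}. c x) * cnj (\<Sum>x\<in>{x\<in>X. e x = p}. c x))"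
    by (simp add: sum_product)
  finally show ?thesis by (simp only: complex_norm_square of_real_sum)
qed

text \<open>Fibres of j - k collect the Fourier coefficients of |u|^2, so \<open>S\<close> is the
  mean of |u|^4 by Parseval. The zero frequency alone contributes the square of the L^2
  energy.\<close>

theorem cub_energy_pos:
  assumes J: "finite J"
  obtains S where "(en J 0 a)\<^sup>2 \<le> S" "(\<Sum>n\<in>J. cnj (a n) * cub J a n) = of_real S"
proof
  define e :: "int \<times> int \<Rightarrow> int" where "e x = fst x - snd x" for x
  define c where "c x = a (fst x) * cnj (a (snd x))" for x
  define S where "S = (\<Sum>p\<in>e ` (J \<times> J). (cmod (\<Sum>x\<in>{x\<in>J \<times> J. e x = p}. c x))\<^sup>2)"
  have "(\<Sum>n\<in>J. cnj (a n) * cub J a n)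
      = (\<Sum>m\<in>J. \<Sum>j\<in>J. \<Sum>k\<in>J. \<Sum>l\<in>J. if e (j,k) = e (m,l) then c (j,k) * cnj (c (m,l)) else 0)"
    unfolding cub_def sum_distrib_left
    by (intro sum.cong refl) (auto simp: e_def c_def)
  also have "\<dots> = (\<Sum>j\<in>J. \<Sum>m\<in>J. \<Sum>k\<in>J. \<Sum>l\<in>J. if e (j,k) = e (m,l) then c (j,k) * cnj (c (m,l)) else 0)"
    by (rule sum.swap)
  also have "\<dots> = (\<Sum>j\<in>J. \<Sum>k\<in>J. \<Sum>m\<in>J. \<Sum>l\<in>J. if e (j,k) = e (m,l) then c (j,k) * cnj (c (m,l)) else 0)"
    by (intro sum.cong refl sum.swap)
  also have "\<dots> = (\<Sum>x\<in>J \<times> J. \<Sum>y\<in>J \<times> J. if e x = e y then c x * cnj (c y) else 0)"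
    unfolding sum.cartesian_product' ..
  also have "\<dots> = of_real S"
    unfolding S_def using J by (intro sum_grouped_cnj) auto
  finally show "(\<Sum>n\<in>J. cnj (a n) * cub J a n) = of_real S" .
  show "(en J 0 a)\<^sup>2 \<le> S"
  proof (cases "J = {}")
    case False
    then have 0: "0 \<in> e ` (J \<times> J)" by (force simp: e_def)
    have "(\<Sum>x\<in>{x\<in>J \<times> J. e x = 0}. c x) = (\<Sum>x\<in>(\<lambda>j. (j, j)) ` J. c x)"
      by (intro sum.cong) (auto simp: e_def)
    also have "\<dots> = (\<Sum>j\<in>J. c (j, j))"
      by (subst sum.reindex) (auto simp: inj_on_def)
    also have "\<dots> = of_real (en J 0 a)"
      by (simp add: c_def en_def complex_norm_square[symmetric])
    finally have "(cmod (\<Sum>x\<in>{x\<in>J \<times> J. e x = 0}. c x))\<^sup>2 = (en J 0 a)\<^sup>2" by simp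
    then show ?thesis
      unfolding S_def using J 0
        member_le_sum[of 0 "e ` (J \<times> J)" "\<lambda>p. (cmod (\<Sum>x\<in>{x\<in>J \<times> J. e x = p}. c x))\<^sup>2"]
      by simp
  qed (auto simp: en_def S_def)
qed

text \<open>Either \<open>jw n powr (1/4)\<close> exceeds 1/\<epsilon> and the spare quarter power
  absorbs it, or the weight is bounded and s + 3/4 - \<sigma> powers of it are at most 4 (s -
  \<sigma>) + 3 powers of 1/\<epsilon>. With \<sigma> = 0 the remainder depends on the L^2 norm;
  with \<sigma> = s it suits a Gronwall argument in H^s.\<close>

lemma jw_interp:
  assumes \<epsilon>: "0 < \<epsilon>" and \<sigma>: "0 \<le> \<sigma>" "\<sigma> \<le> s"
  shows "jw n powr (s + 3/4) \<le> \<epsilon> * jw n powr (s + 1) + (1/\<epsilon>) powr (4 * (s - \<sigma>) + 3) * jw n powr \<sigma>"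
proof (cases "1/\<epsilon> \<le> jw n powr (1/4)")
  case True
  then have "1 \<le> \<epsilon> * jw n powr (1/4)" using \<epsilon> by (simp add: field_simps)
  then have "jw n powr (s + 3/4) * 1 \<le> jw n powr (s + 3/4) * (\<epsilon> * jw n powr (1/4))"
    by (intro mult_left_mono) auto
  also have "\<dots> = \<epsilon> * jw n powr (s + 1)"
    by (simp add: mult.left_commute powr_add[symmetric] add.commute)
  also have "\<dots> \<le> \<epsilon> * jw n powr (s + 1) + (1/\<epsilon>) powr (4 * (s - \<sigma>) + 3) * jw n powr \<sigma>" by simp
  finally show ?thesis by simp
next
  case False
  have "jw n powr (s + 3/4) = (jw n powr (1/4)) powr (4 * (s - \<sigma>) + 3) * jw n powr \<sigma>"
    by (simp add: powr_powr powr_add[symmetric] field_simps)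
  also have "\<dots> \<le> (1/\<epsilon>) powr (4 * (s - \<sigma>) + 3) * jw n powr \<sigma>"
    using False \<sigma> by (intro mult_right_mono powr_mono2) auto
  also have "\<dots> \<le> \<epsilon> * jw n powr (s + 1) + (1/\<epsilon>) powr (4 * (s - \<sigma>) + 3) * jw n powr \<sigma>" using \<epsilon> by simp
  finally show ?thesis .
qed

lemma en_interp:
  assumes "0 < \<epsilon>" "0 \<le> \<sigma>" "\<sigma> \<le> s"
  shows "en J (s + 3/4) a \<le> \<epsilon> * en J (s + 1) a + (1/\<epsilon>) powr (4 * (s - \<sigma>) + 3) * en J \<sigma> a"
proof -
  have "en J (s + 3/4) a \<le> (\<Sum>n\<in>J. (\<epsilon> * jw n powr (s + 1) + (1/\<epsilon>) powr (4 * (s - \<sigma>) + 3) * jw n powr \<sigma>) * (cmod (a n))\<^sup>2)"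
    unfolding en_def by (intro sum_mono mult_right_mono jw_interp assms) auto
  also have "\<dots> = \<epsilon> * en J (s + 1) a + (1/\<epsilon>) powr (4 * (s - \<sigma>) + 3) * en J \<sigma> a"
    unfolding en_def sum_distrib_left sum.distrib[symmetric] by (intro sum.cong refl) (simp add: distrib_right)
  finally show ?thesis .
qed

section \<open>Fourier series\<close>

definition eix :: "int \<Rightarrow> real \<Rightarrow> complex" where
  "eix n x = exp (\<i> * of_int n * of_real x)"

lemma eix_mult: "eix m x * eix n x = eix (m + n) x"
  by (simp add: eix_def exp_add[symmetric] algebra_simps)

lemma norm_eix [simp]: "cmod (eix n x) = 1"
  by (simp add: eix_def norm_exp_eq_Re)

lemma cnj_eix: "cnj (eix n x) = eix (- n) x"
  by (simp add: eix_def exp_cnj)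

lemma continuous_on_eix [continuous_intros]: "continuous_on A (eix n)"
  unfolding eix_def[abs_def] by (intro continuous_intros)

lemma fc_eq: "fc v n = integral {-pi..pi} (\<lambda>x. v x * eix (- n) x) / of_real (2 * pi)"
  by (simp add: fc_def eix_def)

lemma eix_periodic: "eix n (x + 2 * pi) = eix n x"
proof -
  have "eix n (x + 2 * pi) = eix n x * exp (2 * of_int n * pi * \<i>)"
    by (simp add: eix_def exp_add[symmetric] algebra_simps)
  also have "exp (2 * of_int n * pi * \<i>) = 1"
    using exp_integer_2pi[of "of_int n"] by simp
  finally show ?thesis by simp
qed

lemma integral_eix: "integral {-pi..pi} (eix n) = (if n = 0 then of_real (2 * pi) else 0)"
proof (cases "n = 0")
  case False
  have "(eix n has_integral eix n pi / (\<i> * of_int n) - eix n (- pi) / (\<i> * of_int n)) {-pi..pi}"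
  proof (rule fundamental_theorem_of_calculus)
    fix x :: real
    have "((\<lambda>z. exp (\<i> * of_int n * z) / (\<i> * of_int n)) has_field_derivative eix n x) (at (of_real x))"
      using False unfolding eix_def by (auto intro!: derivative_eq_intros)
    then show "((\<lambda>x. eix n x / (\<i> * of_int n)) has_vector_derivative eix n x) (at x within {-pi..pi})"
      unfolding eix_def by (rule has_vector_derivative_real_field)
  qed simp
  moreover have "eix n pi = eix n (- pi)"
    using eix_periodic[of n "- pi"] by simp
  ultimately show ?thesis using False by (simp add: integral_unique)
next
  case True
  then have "eix n = (\<lambda>x. 1)" by (simp add: eix_def fun_eq_iff)
  then show ?thesis using True by (simp add: scaleR_conv_of_real)
qed

lemma fc_trig_sum:
  assumes "finite X"
  shows "fc (\<lambda>x. \<Sum>p\<in>X. c p * eix (f p) x) n = (\<Sum>p\<in>X. if f p = n then c p else 0)"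
proof -
  have "integral {-pi..pi} (\<lambda>x. (\<Sum>p\<in>X. c p * eix (f p) x) * eix (- n) x)
      = integral {-pi..pi} (\<lambda>x. \<Sum>p\<in>X. c p * eix (f p - n) x)"
    unfolding sum_distrib_right mult.assoc eix_mult by simp
  also have "\<dots> = (\<Sum>p\<in>X. integral {-pi..pi} (\<lambda>x. c p * eix (f p - n) x))"
    by (intro integral_sum assms integrable_continuous_interval continuous_intros)
  also have "\<dots> = (\<Sum>p\<in>X. if f p = n then of_real (2 * pi) * c p else 0)"
  proof (intro sum.cong refl)
    fix p
    have "integral {-pi..pi} (\<lambda>x. c p * eix (f p - n) x) = c p * integral {-pi..pi} (eix (f p - n))"
      by (rule integral_mult_right)
    then show "integral {-pi..pi} (\<lambda>x. c p * eix (f p - n) x) = (if f p = n then of_real (2 * pi) * c p else 0)"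
      unfolding integral_eix by auto
  qed
  finally show ?thesis
    unfolding fc_eq by (simp add: sum_divide_distrib if_distrib[of "\<lambda>z. z / _"] cong: if_cong)
qed

lemma fc_diff_le:
  assumes f: "continuous_on {-pi..pi} f" and g: "continuous_on {-pi..pi} g"
    and B: "\<And>x. cmod (f x - g x) \<le> B"
  shows "cmod (fc f n - fc g n) \<le> B"
proof -
  have "integral {-pi..pi} (\<lambda>x. f x * eix (- n) x) - integral {-pi..pi} (\<lambda>x. g x * eix (- n) x)
      = integral {-pi..pi} (\<lambda>x. (f x - g x) * eix (- n) x)"
    unfolding left_diff_distrib
    by (intro integral_diff[symmetric] integrable_continuous_interval continuous_intros f g)
  moreover have "cmod (integral {-pi..pi} (\<lambda>x. (f x - g x) * eix (- n) x)) \<le> B * (pi - - pi)"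
    using B by (intro integral_bound continuous_intros f g) (auto simp: norm_mult)
  ultimately have "cmod (integral {-pi..pi} (\<lambda>x. f x * eix (- n) x) - integral {-pi..pi} (\<lambda>x. g x * eix (- n) x)) \<le> B * (2 * pi)"
    by simp
  moreover have "fc f n - fc g n = (integral {-pi..pi} (\<lambda>x. f x * eix (- n) x) - integral {-pi..pi} (\<lambda>x. g x * eix (- n) x)) / of_real (2 * pi)"
    unfolding fc_eq by (simp only: diff_divide_distrib)
  ultimately show ?thesis by (simp only: norm_divide) (simp add: field_simps)
qed

section \<open>Absolutely convergent series and the cubic nonlinearity\<close>

definition lb :: "(int \<Rightarrow> complex) \<Rightarrow> real \<Rightarrow> bool" where
  "lb a B \<longleftrightarrow> (\<forall>J. finite J \<longrightarrow> (\<Sum>n\<in>J. cmod (a n)) \<le> B)"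

definition ser :: "(int \<Rightarrow> complex) \<Rightarrow> real \<Rightarrow> complex" where
  "ser a x = (\<Sum>\<^sub>\<infinity>n. a n * eix n x)"

definition cube :: "complex \<Rightarrow> complex" where
  "cube z = z * of_real ((cmod z)\<^sup>2)"

text \<open>The nonlinearity as a map of coefficients, computed from the continuous function that
  absolutely summable coefficients define. This frees the analysis of the choice of
  representatives.\<close>

definition Nl :: "(int \<Rightarrow> complex) \<Rightarrow> int \<Rightarrow> complex" where
  "Nl a n = fc (\<lambda>x. cube (ser a x)) n"

lemma lb_summable: "lb a B \<Longrightarrow> (\<lambda>n. cmod (a n)) summable_on UNIV"
  unfolding lb_def
  by (intro nonneg_bdd_above_summable_on) (auto intro!: bdd_aboveI)

lemma lb_summable_ser: "lb a B \<Longrightarrow> (\<lambda>n. a n * eix n x) summable_on UNIV"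
  by (rule abs_summable_summable) (simp add: norm_mult lb_summable)

lemma norm_ser_le: "lb a B \<Longrightarrow> cmod (ser a x) \<le> B"
proof -
  assume a: "lb a B"
  have "cmod (ser a x) \<le> (\<Sum>\<^sub>\<infinity>n. cmod (a n * eix n x))"
    unfolding ser_def by (rule norm_infsum_bound) (simp add: norm_mult lb_summable[OF a])
  also have "\<dots> \<le> B"
    using a lb_summable[OF a] unfolding lb_def
    by (intro infsum_le_finite_sums) (auto simp: norm_mult)
  finally show ?thesis .
qed

lemma ser_diff: "lb a A \<Longrightarrow> lb b B \<Longrightarrow> ser (\<lambda>n. a n - b n) x = ser a x - ser b x"
  unfolding ser_def left_diff_distrib
  using infsum_add[OF lb_summable_ser summable_on_uminus[THEN iffD2, OF lb_summable_ser], of a A b B x x]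
  by (simp add: infsum_uminus)

lemma uniform_limit_ser:
  assumes "lb a B"
  shows "uniform_limit UNIV (\<lambda>J x. \<Sum>n\<in>J. a n * eix n x) (ser a) (finite_subsets_at_top UNIV)"
  unfolding ser_def[abs_def]
  by (rule Weierstrass_m_test_general[OF _ lb_summable[OF assms]]) (simp add: norm_mult)

lemma continuous_on_ser:
  assumes "lb a B"
  shows "continuous_on A (ser a)"
proof -
  have "continuous_on UNIV (ser a)"
    by (rule uniform_limit_theorem[OF _ uniform_limit_ser[OF assms]])
       (auto intro!: always_eventually continuous_intros)
  then show ?thesis by (rule continuous_on_subset) simp
qed

lemma ser_periodic: "ser a (x + 2 * pi) = ser a x"
  unfolding ser_def eix_periodic ..

lemma fc_ser:
  assumes "lb a B"
  shows "fc (ser a) n = a n"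
proof -
  have "cmod (fc (ser a) n - a n) \<le> \<epsilon>" if "\<epsilon> > 0" for \<epsilon>
  proof -
    have "\<forall>\<^sub>F J in finite_subsets_at_top UNIV. (\<forall>x\<in>UNIV. dist (\<Sum>n\<in>J. a n * eix n x) (ser a x) < \<epsilon>) \<and> finite J \<and> {n} \<subseteq> J"
      by (intro eventually_conj uniform_limitD[OF uniform_limit_ser[OF assms] that])
        (auto simp: eventually_finite_subsets_at_top intro: exI[of _ "{n}"])
    then obtain J where J: "finite J" "n \<in> J" and d: "\<And>x. dist (\<Sum>n\<in>J. a n * eix n x) (ser a x) < \<epsilon>"
      using eventually_happens[OF \<open>eventually _ _\<close>] by auto
    have "fc (\<lambda>x. \<Sum>n\<in>J. a n * eix n x) n = a n"
      using J by (subst fc_trig_sum) auto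
    moreover have "cmod (fc (ser a) n - fc (\<lambda>x. \<Sum>n\<in>J. a n * eix n x) n) \<le> \<epsilon>"
      using d by (intro fc_diff_le continuous_on_ser[OF assms] continuous_intros)
        (auto simp: dist_norm norm_minus_commute intro: less_imp_le)
    ultimately show ?thesis by simp
  qed
  then show ?thesis
    using field_le_epsilon[of "cmod (fc (ser a) n - a n)" 0] by auto
qed

lemma cube_eq: "cube z = z * cnj z * z"
  by (simp add: cube_def complex_norm_square[symmetric] mult_ac)

lemma continuous_on_cube: "continuous_on A f \<Longrightarrow> continuous_on A (\<lambda>x. cube (f x))"
  unfolding cube_def by (intro continuous_intros)

lemma cube_lipschitz:
  assumes "cmod z \<le> R" "cmod w \<le> R"
  shows "cmod (cube z - cube w) \<le> 3 * R\<^sup>2 * cmod (z - w)"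
proof -
  have R: "0 \<le> R" using assms norm_ge_zero order_trans by blast
  have "cube z - cube w = (z - w) * cnj z * z + w * cnj (z - w) * z + w * cnj w * (z - w)"
    by (simp add: cube_eq algebra_simps)
  also have "cmod \<dots> \<le> cmod (z - w) * cmod z * cmod z + cmod w * cmod (z - w) * cmod z + cmod w * cmod w * cmod (z - w)"
    by (intro order_trans[OF norm_triangle_ineq] add_mono) (auto simp: norm_mult simp del: complex_cnj_diff)
  also have "\<dots> = (cmod z * cmod z + cmod w * cmod z + cmod w * cmod w) * cmod (z - w)"
    by (simp add: algebra_simps)
  also have "\<dots> \<le> (R * R + R * R + R * R) * cmod (z - w)"
    using assms R by (intro mult_right_mono add_mono mult_mono) auto
  finally show ?thesis by (simp add: power2_eq_square)
qed

text \<open>The l^1 norm of the coefficients dominates the supremum norm, in which the cube is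
  Lipschitz on balls, and the supremum norm dominates every coefficient.\<close>

theorem Nl_lipschitz:
  assumes "lb a R" "lb b R" "lb (\<lambda>n. a n - b n) d"
  shows "cmod (Nl a n - Nl b n) \<le> 3 * R\<^sup>2 * d"
  unfolding Nl_def
proof (rule fc_diff_le)
  fix x
  have "cmod (cube (ser a x) - cube (ser b x)) \<le> 3 * R\<^sup>2 * cmod (ser a x - ser b x)"
    by (intro cube_lipschitz norm_ser_le assms)
  also have "\<dots> \<le> 3 * R\<^sup>2 * d"
    using norm_ser_le[OF assms(3), of x] ser_diff[OF assms(1,2), of x] by (intro mult_left_mono) auto
  finally show "cmod (cube (ser a x) - cube (ser b x)) \<le> 3 * R\<^sup>2 * d" .
qed (intro continuous_on_cube continuous_on_ser[OF assms(1)] continuous_on_ser[OF assms(2)])+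

lemma ser_finite:
  assumes "finite J" "\<And>n. n \<notin> J \<Longrightarrow> a n = 0"
  shows "ser a x = (\<Sum>n\<in>J. a n * eix n x)"
proof -
  have "ser a x = (\<Sum>\<^sub>\<infinity>n\<in>J. a n * eix n x)"
    unfolding ser_def using assms by (intro infsum_cong_neutral) auto
  then show ?thesis using assms by simp
qed

theorem Nl_finite:
  assumes J: "finite J" and a: "\<And>n. n \<notin> J \<Longrightarrow> a n = 0"
  shows "Nl a n = cub J a n"
proof -
  have "cube (ser a x) = (\<Sum>j\<in>J. \<Sum>k\<in>J. \<Sum>l\<in>J. a j * cnj (a k) * a l * eix (j - k + l) x)" for x
  proof -
    have e: "eix (j - k + l) x = eix j x * cnj (eix k x) * eix l x" for j k l
      unfolding cnj_eix eix_mult by simp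
    have "(\<Sum>j\<in>J. \<Sum>k\<in>J. \<Sum>l\<in>J. a j * cnj (a k) * a l * eix (j - k + l) x)
        = (\<Sum>j\<in>J. \<Sum>k\<in>J. \<Sum>l\<in>J. (a j * eix j x) * cnj (a k * eix k x) * (a l * eix l x))"
      unfolding e by (simp only: complex_cnj_mult mult_ac)
    also have "\<dots> = (\<Sum>j\<in>J. a j * eix j x) * cnj (\<Sum>k\<in>J. a k * eix k x) * (\<Sum>l\<in>J. a l * eix l x)"
      by (simp only: sum_distrib_left[symmetric] sum_distrib_right[symmetric] cnj_sum)
    finally show ?thesis
      using ser_finite[OF J, of a] a by (simp add: cube_eq)
  qed
  then have "Nl a n = fc (\<lambda>x. \<Sum>p\<in>J \<times> J \<times> J. (a (fst p) * cnj (a (fst (snd p))) * a (snd (snd p))) * eix (fst p - fst (snd p) + snd (snd p)) x) n"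
    unfolding Nl_def by (simp add: sum.cartesian_product case_prod_beta)
  also have "\<dots> = (\<Sum>p\<in>J \<times> J \<times> J. if fst p - fst (snd p) + snd (snd p) = n then (a (fst p) * cnj (a (fst (snd p))) * a (snd (snd p))) else 0)"
    using J by (intro fc_trig_sum) auto
  also have "\<dots> = cub J a n"
    unfolding cub_def sum.cartesian_product by (intro sum.cong refl) (auto simp: algebra_simps)
  finally show ?thesis .
qed

section \<open>Fourier coefficients determine a function almost everywhere\<close>

lemma absolutely_integrable_mult_continuous:
  fixes w f :: "real \<Rightarrow> complex"
  assumes "w absolutely_integrable_on {a..b}" "continuous_on {a..b} f"
  shows "(\<lambda>x. w x * f x) absolutely_integrable_on {a..b}"
proof -
  have "(\<lambda>x. f x * w x) absolutely_integrable_on {a..b}"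
  proof (rule absolutely_integrable_bounded_measurable_product[OF bilinear_times _ _ _ assms(1)])
    show "f \<in> borel_measurable (lebesgue_on {a..b})"
      by (rule continuous_imp_measurable_on_sets_lebesgue[OF assms(2)]) simp
    show "bounded (f ` {a..b})"
      by (rule compact_imp_bounded[OF compact_continuous_image[OF assms(2)]]) simp
  qed simp
  then show ?thesis by (simp add: mult.commute)
qed

lemma inL2per_absolutely_integrable:
  assumes "inL2per v"
  shows "v absolutely_integrable_on {-pi..pi}"
proof (rule measurable_bounded_by_integrable_imp_absolutely_integrable)
  show "v \<in> borel_measurable (lebesgue_on {-pi..pi})"
    using assms by (simp add: inL2per_def measurable_on_iff_borel_measurable)
  show "(\<lambda>x. 1 + (cmod (v x))\<^sup>2) integrable_on {-pi..pi}"
    using assms by (intro integrable_add integrable_const_ivl) (auto simp: inL2per_def)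
  show "norm (v x) \<le> 1 + (cmod (v x))\<^sup>2" for x
    using zero_le_power2[of "cmod (v x) - 1"] norm_ge_zero[of "v x"] by (simp add: power2_diff del: zero_le_power2, linarith)
qed simp

lemma inL2per_ser:
  assumes "lb a B"
  shows "inL2per (ser a)"
  unfolding inL2per_def periodic2pi_def
proof (intro conjI allI ser_periodic)
  show "ser a measurable_on {-pi..pi}"
    by (simp add: measurable_on_iff_borel_measurable continuous_imp_measurable_on_sets_lebesgue continuous_on_ser[OF assms])
  show "(\<lambda>x. (cmod (ser a x))\<^sup>2) integrable_on {-pi..pi}"
    by (intro integrable_continuous_interval continuous_intros continuous_on_ser[OF assms])
qed

lemma fc_diff:
  assumes "inL2per u" "inL2per v"
  shows "fc (\<lambda>x. u x - v x) n = fc u n - fc v n"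
proof -
  have "(\<lambda>x. u x * eix (- n) x) integrable_on {-pi..pi}" if "inL2per u" for u
    using absolutely_integrable_mult_continuous[OF inL2per_absolutely_integrable[OF that] continuous_on_eix]
    by (rule set_lebesgue_integral_eq_integral(1))
  note this[OF assms(1)] this[OF assms(2)]
  then show ?thesis
    unfolding fc_eq left_diff_distrib by (subst integral_diff) (auto simp: diff_divide_distrib)
qed

text \<open>Generated by monomials and sums so that closure under products follows by two
  inductions; this is what turns polynomials in the real and imaginary part of
  \<open>eix 1 x\<close> into trigonometric polynomials.\<close>

inductive trig_poly :: "(real \<Rightarrow> complex) \<Rightarrow> bool" where
  mono: "trig_poly (\<lambda>x. c * eix n x)"
| add: "trig_poly f \<Longrightarrow> trig_poly g \<Longrightarrow> trig_poly (\<lambda>x. f x + g x)"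

lemma trig_poly_mult:
  assumes "trig_poly f" "trig_poly g"
  shows "trig_poly (\<lambda>x. f x * g x)"
  using assms(1)
proof induction
  case (mono c n)
  from assms(2) show ?case
  proof induction
    case (mono d m)
    have "(\<lambda>x. c * eix n x * (d * eix m x)) = (\<lambda>x. (c * d) * eix (n + m) x)"
      unfolding eix_mult[symmetric] by (simp add: mult_ac)
    then show ?case by (simp only: trig_poly.mono)
  next
    case (add f g)
    then show ?case unfolding distrib_left by (intro trig_poly.add)
  qed
next
  case (add f g)
  then show ?case unfolding distrib_right by (intro trig_poly.add)
qed

lemma trig_poly_of_real_polynomial:
  fixes p :: "complex \<Rightarrow> real"
  assumes "real_polynomial_function p"
  shows "trig_poly (\<lambda>x. of_real (p (eix 1 x)))"
  using assms
proof induction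
  case (linear f)
  interpret bounded_linear f by fact
  \<comment> \<open>Real linearity gives f (eix 1 x) = cos x f 1 + sin x f i, and the Euler formulas
    rewrite cosine and sine.\<close>
  have "of_real (f (eix 1 x)) = ((of_real (f 1) - \<i> * of_real (f \<i>)) / 2) * eix 1 x + ((of_real (f 1) + \<i> * of_real (f \<i>)) / 2) * eix (- 1) x" for x
  proof -
    have "eix 1 x = cos x *\<^sub>R 1 + sin x *\<^sub>R \<i>" "eix (- 1) x = cos x *\<^sub>R 1 - sin x *\<^sub>R \<i>"
      using cis_conv_exp[of x] cis_conv_exp[of "- x"] by (auto simp: eix_def complex_eq_iff)
    moreover from this have "f (eix 1 x) = cos x * f 1 + sin x * f \<i>"
      by (simp only: add scaleR real_scaleR_def)
    ultimately show ?thesis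
      by (simp add: complex_eq_iff field_simps)
  qed
  then have "(\<lambda>x. of_real (f (eix 1 x))) = (\<lambda>x. ((of_real (f 1) - \<i> * of_real (f \<i>)) / 2) * eix 1 x + ((of_real (f 1) + \<i> * of_real (f \<i>)) / 2) * eix (- 1) x)" by blast
  then show ?case by (simp only: trig_poly.add[OF trig_poly.mono trig_poly.mono])
next
  case (const c)
  show ?case using trig_poly.mono[of "of_real c" 0] by (simp add: eix_def)
qed (auto intro: trig_poly.add trig_poly_mult)

lemma trig_poly_continuous: "trig_poly f \<Longrightarrow> continuous_on A f"
  by (induction rule: trig_poly.induct) (intro continuous_intros; assumption)+

context
  fixes w :: "real \<Rightarrow> complex"
  assumes w: "w absolutely_integrable_on {-pi..pi}"
    and w0: "\<And>n. integral {-pi..pi} (\<lambda>x. w x * eix n x) = 0"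
begin

lemma integral_trig_poly_zero:
  assumes "trig_poly f"
  shows "integral {-pi..pi} (\<lambda>x. w x * f x) = 0"
  using assms
proof induction
  case (mono c n)
  have "integral {-pi..pi} (\<lambda>x. c * (w x * eix n x)) = c * integral {-pi..pi} (\<lambda>x. w x * eix n x)"
    by (rule integral_mult_right)
  then show ?case by (simp add: w0 mult.left_commute)
next
  case (add f g)
  have "(\<lambda>x. w x * f x) integrable_on {-pi..pi}" if "trig_poly f" for f
    using absolutely_integrable_mult_continuous[OF w trig_poly_continuous[OF that]]
    by (rule set_lebesgue_integral_eq_integral(1))
  then show ?case
    using add unfolding distrib_left by (subst integral_add) auto
qed

text \<open>By Stone-Weierstrass \<open>h\<close> is uniformly close on the circle to a polynomial,
  against which \<open>w\<close> integrates to zero; the error is at most \<open>e\<close> times the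
  L^1 norm of \<open>w\<close>.\<close>

lemma integral_circle_function_zero:
  fixes h :: "complex \<Rightarrow> real"
  assumes h: "continuous_on UNIV h"
  shows "integral {-pi..pi} (\<lambda>x. w x * of_real (h (eix 1 x))) = 0"
proof -
  define W where "W = integral {-pi..pi} (\<lambda>x. cmod (w x))"
  have wn: "(\<lambda>x. cmod (w x)) integrable_on {-pi..pi}"
    using w by (simp add: absolutely_integrable_on_def)
  have hc: "continuous_on {-pi..pi} (\<lambda>x. complex_of_real (h (eix 1 x)))"
    by (intro continuous_intros continuous_on_compose2[OF h]) auto
  have "cmod (integral {-pi..pi} (\<lambda>x. w x * of_real (h (eix 1 x)))) \<le> 0 + \<epsilon>" if "0 < \<epsilon>" for \<epsilon>
  proof -
    define e where "e = \<epsilon> / (1 + W)"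
    have W0: "0 \<le> W" unfolding W_def by (intro integral_nonneg wn) auto
    then have e: "0 < e" using that by (simp add: e_def)
    obtain p where p: "real_polynomial_function p" and hp: "\<And>z. z \<in> sphere 0 1 \<Longrightarrow> \<bar>h z - p z\<bar> < e"
      using Stone_Weierstrass_real_polynomial_function[OF compact_sphere continuous_on_subset[OF h] e, of 0 1] by auto
    note tp = trig_poly_of_real_polynomial[OF p]
    have i1: "(\<lambda>x. w x * of_real (h (eix 1 x))) integrable_on {-pi..pi}"
      by (rule set_lebesgue_integral_eq_integral(1)[OF absolutely_integrable_mult_continuous[OF w hc]])
    have i2: "(\<lambda>x. w x * of_real (p (eix 1 x))) integrable_on {-pi..pi}"
      by (rule set_lebesgue_integral_eq_integral(1)[OF absolutely_integrable_mult_continuous[OF w trig_poly_continuous[OF tp]]])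
    have "integral {-pi..pi} (\<lambda>x. w x * of_real (h (eix 1 x)))
        = integral {-pi..pi} (\<lambda>x. w x * of_real (h (eix 1 x)) - w x * of_real (p (eix 1 x)))"
      by (simp only: integral_diff[OF i1 i2] integral_trig_poly_zero[OF tp] diff_0_right)
    also have "cmod \<dots> \<le> integral {-pi..pi} (\<lambda>x. e * cmod (w x))"
    proof (rule integral_norm_bound_integral)
      show "(\<lambda>x. e * cmod (w x)) integrable_on {-pi..pi}" by (intro integrable_on_mult_right wn)
      fix x
      have "cmod (w x * of_real (h (eix 1 x)) - w x * of_real (p (eix 1 x))) = cmod (w x) * \<bar>h (eix 1 x) - p (eix 1 x)\<bar>"
        by (simp only: right_diff_distrib[symmetric] of_real_diff[symmetric] norm_mult norm_of_real)
      also have "\<dots> \<le> cmod (w x) * e"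
        using hp[of "eix 1 x"] by (intro mult_left_mono) auto
      finally show "cmod (w x * of_real (h (eix 1 x)) - w x * of_real (p (eix 1 x))) \<le> e * cmod (w x)"
        by (simp add: mult.commute)
    qed (intro integrable_diff i1 i2)
    also have "\<dots> = e * W" unfolding W_def by (rule integral_mult_right)
    also have "\<dots> \<le> \<epsilon>" using W0 that by (simp add: e_def field_simps)
    finally show ?thesis by simp
  qed
  from field_le_epsilon[OF this] show ?thesis by simp
qed

text \<open>The indicator of the open arc is the limit of min 1 (k times the distance to the
  complementary arc). Measuring the distance in the plane makes these approximations continuous
  functions on the circle, and dominated convergence applies.\<close>

lemma integral_arc_zero:
  assumes cd: "-pi < c" "c < d" "d < pi"
  shows "integral {c..d} w = 0"
proof -
  define C where "C = eix 1 ` ({-pi..c} \<union> {d..pi})"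
  have C: "closed C" "C \<noteq> {}"
    unfolding C_def using cd
    by (auto intro!: compact_imp_closed compact_continuous_image compact_Un continuous_intros)
  have inC: "eix 1 x \<in> C \<longleftrightarrow> x \<notin> {c<..<d}" if x: "x \<in> {-pi..pi}" for x
  proof
    assume "eix 1 x \<in> C"
    then obtain y where y: "y \<in> {-pi..c} \<union> {d..pi}" and "eix 1 x = eix 1 y" unfolding C_def by blast
    then obtain k :: int where "\<i> * of_int 1 * of_real x = \<i> * of_int 1 * of_real y + (of_int (2 * k) * pi) * \<i>"
      unfolding exp_eq eix_def by blast
    then have e: "x = y + 2 * of_int k * pi" by (simp add: complex_eq_iff)
    show "x \<notin> {c<..<d}"
    proof
      assume xx: "x \<in> {c<..<d}"
      have "k = 0"
      proof (rule ccontr)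
        assume "k \<noteq> 0"
        then have "1 \<le> \<bar>real_of_int k\<bar>" by linarith
        then have "2 * pi \<le> \<bar>2 * of_int k * pi\<bar>" by (simp add: abs_mult)
        moreover have "\<bar>x - y\<bar> < 2 * pi" using xx y cd by auto
        ultimately show False using e by simp
      qed
      then show False using e xx y by auto
    qed
  next
    assume "x \<notin> {c<..<d}"
    then show "eix 1 x \<in> C" unfolding C_def using x by (intro imageI) auto
  qed
  define h where "h k z = min 1 (real k * infdist z C)" for k z
  have hc: "continuous_on UNIV (h k)" for k
    unfolding h_def by (intro continuous_intros)
  have h01: "0 \<le> h k z" "h k z \<le> 1" for k z by (auto simp: h_def infdist_nonneg)
  have wn: "(\<lambda>x. cmod (w x)) integrable_on {-pi..pi}"
    using w by (simp add: absolutely_integrable_on_def)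
  have lim: "(\<lambda>k. integral {-pi..pi} (\<lambda>x. w x * of_real (h k (eix 1 x)))) \<longlonglongrightarrow> integral {-pi..pi} (\<lambda>x. if x \<in> {c<..<d} then w x else 0)"
  proof (rule dominated_convergence(2)[OF _ wn])
    fix k
    have "continuous_on {-pi..pi} (\<lambda>x. complex_of_real (h k (eix 1 x)))"
      by (intro continuous_intros continuous_on_compose2[OF hc]) auto
    then show "(\<lambda>x. w x * of_real (h k (eix 1 x))) integrable_on {-pi..pi}"
      by (rule set_lebesgue_integral_eq_integral(1)[OF absolutely_integrable_mult_continuous[OF w]])
  next
    fix k x
    show "cmod (w x * of_real (h k (eix 1 x))) \<le> cmod (w x)"
      using h01[of k "eix 1 x"] by (simp add: norm_mult mult_left_le)
  next
    fix x assume x: "x \<in> {-pi..pi}"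
    show "(\<lambda>k. w x * of_real (h k (eix 1 x))) \<longlonglongrightarrow> (if x \<in> {c<..<d} then w x else 0)"
    proof (cases "x \<in> {c<..<d}")
      case True
      then have "eix 1 x \<notin> C" using inC[OF x] by simp
      then have p: "0 < infdist (eix 1 x) C"
        using C infdist_pos_not_in_closed by blast
      have "\<forall>\<^sub>F k in sequentially. 1 / infdist (eix 1 x) C < real k"
        using filterlim_real_sequentially unfolding filterlim_at_top_dense by blast
      then have "\<forall>\<^sub>F k in sequentially. w x * of_real (h k (eix 1 x)) = w x"
        by eventually_elim (use p in \<open>simp add: h_def field_simps\<close>)
      then show ?thesis using True by (simp add: tendsto_eventually)
    next
      case False
      then have "eix 1 x \<in> C" using inC[OF x] by simp
      then have "h k (eix 1 x) = 0" for k using C by (simp add: h_def)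
      then show ?thesis using False by (simp only: if_False of_real_0 mult_zero_right tendsto_const)
    qed
  qed
  have "integral {-pi..pi} (\<lambda>x. if x \<in> {c<..<d} then w x else 0) = 0"
    using LIMSEQ_unique[OF lim] by (simp add: integral_circle_function_zero[OF hc])
  moreover have "{c<..<d} \<inter> {-pi..pi} = {c<..<d}" using cd by auto
  ultimately show ?thesis
    by (simp only: integral_restrict_Int integral_open_interval_real)
qed

text \<open>At almost every point a function is the limit of its means over shrinking intervals, and
  these means vanish here.\<close>

theorem negligible_nonzero_if_fourier_zero: "negligible {x \<in> {-pi..pi}. w x \<noteq> 0}"
proof -
  define f where "f x = (if x \<in> {-pi..pi} then w x else 0)" for x
  have fi: "f integrable_on cbox a b" for a b
  proof -
    have "w integrable_on {-pi..pi}" using w by (rule set_lebesgue_integral_eq_integral(1))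
    then have "f integrable_on UNIV" unfolding f_def[abs_def] by (simp only: integrable_restrict_UNIV)
    then show ?thesis by (rule integrable_on_subcbox) simp
  qed
  obtain N where N: "negligible N" and d: "\<And>x e. \<lbrakk>x \<notin> N; 0 < e\<rbrakk> \<Longrightarrow> \<exists>d>0. \<forall>h. 0 < h \<and> h < d \<longrightarrow>
       norm (integral (cbox x (x + h *\<^sub>R One)) f /\<^sub>R h ^ DIM(real) - f x) < e"
    using integrable_ccontinuous_explicit[of f, OF fi] by blast
  have "w x = 0" if x: "-pi < x" "x < pi" "x \<notin> N" for x
  proof (rule ccontr)
    assume "w x \<noteq> 0"
    then have "0 < cmod (w x)" by simp
    then obtain d where d: "d > 0" "\<forall>h. 0 < h \<and> h < d \<longrightarrow>
       norm (integral (cbox x (x + h *\<^sub>R One)) f /\<^sub>R h ^ DIM(real) - f x) < cmod (w x)"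
      using d[OF x(3)] by blast
    define h where "h = min (d/2) ((pi - x)/2)"
    have h: "0 < h" "h < d" "x + h < pi" using d x by (auto simp: h_def min_def field_simps)
    have "integral {x..x+h} f = integral {x..x+h} w"
      using x h by (intro integral_cong) (auto simp: f_def)
    also have "\<dots> = 0" using x h by (intro integral_arc_zero) auto
    finally show False using d(2)[rule_format, of h] h x by (simp add: f_def)
  qed
  have "{x \<in> {-pi..pi}. w x \<noteq> 0} \<subseteq> N \<union> {-pi, pi}"
  proof
    fix x assume x: "x \<in> {x \<in> {-pi..pi}. w x \<noteq> 0}"
    show "x \<in> N \<union> {-pi, pi}"
    proof (rule ccontr)
      assume "x \<notin> N \<union> {-pi, pi}"
      then have "-pi < x" "x < pi" "x \<notin> N" using x by auto
      with x \<open>\<And>x. \<lbrakk>- pi < x; x < pi; x \<notin> N\<rbrakk> \<Longrightarrow> w x = 0\<close> show False by simp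
    qed
  qed
  then show ?thesis
    by (rule negligible_subset[rotated]) (simp add: N)
qed

end

text \<open>Absolutely summable coefficients force \<open>v\<close> to agree almost everywhere with
  the continuous sum of its series, and integrals do not see the exceptional set. This links the
  equation, stated for arbitrary representatives, to \<open>Nl\<close>.\<close>

theorem fc_cube:
  assumes v: "inL2per v" and B: "lb (fc v) B"
  shows "fc (\<lambda>x. v x * of_real ((cmod (v x))\<^sup>2)) n = Nl (fc v) n"
proof -
  define g where "g = ser (fc v)"
  have g: "inL2per g" unfolding g_def by (rule inL2per_ser[OF B])
  have w: "(\<lambda>x. v x - g x) absolutely_integrable_on {-pi..pi}"
    by (intro set_integral_diff inL2per_absolutely_integrable v g)
  have "integral {-pi..pi} (\<lambda>x. (v x - g x) * eix n x) = 0" for n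
  proof -
    have "fc (\<lambda>x. v x - g x) (- n) = 0"
      unfolding fc_diff[OF v g] by (simp add: g_def fc_ser[OF B])
    then show ?thesis by (simp add: fc_eq)
  qed
  from negligible_nonzero_if_fourier_zero[OF w this]
  have neg: "negligible {x \<in> {-pi..pi}. v x - g x \<noteq> 0}" .
  have "integral {-pi..pi} (\<lambda>x. v x * of_real ((cmod (v x))\<^sup>2) * eix (- n) x)
      = integral {-pi..pi} (\<lambda>x. cube (g x) * eix (- n) x)"
    by (rule integral_spike[OF neg]) (auto simp: cube_def)
  then show ?thesis unfolding Nl_def fc_eq g_def by simp
qed

section \<open>Truncated systems\<close>

text \<open>The bounded functions on \<open>int\<close> serve as a phase space common to all truncations; the library
  has their completeness only over metric domains.\<close>

instantiation int :: metric_space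
begin

definition dist_int :: "int \<Rightarrow> int \<Rightarrow> real" where
  "dist_int m n = \<bar>real_of_int (m - n)\<bar>"

definition uniformity_int :: "(int \<times> int) filter" where
  "uniformity_int = (INF e\<in>{0 <..}. principal {(x, y). dist x y < e})"

instance
proof
  fix U :: "int set"
  have "\<forall>\<^sub>F (x', y) in uniformity. x' = x \<longrightarrow> y \<in> U" if "x \<in> U" for x
    unfolding uniformity_int_def
  proof (rule eventually_INF1[of 1])
    have "x = y" if "\<bar>real_of_int (x - y)\<bar> < 1" for x y using that by linarith
    then show "\<forall>\<^sub>F (x', y) in principal {(x, y). dist x y < (1::real)}. x' = x \<longrightarrow> y \<in> U"
      using that by (auto simp: eventually_principal dist_int_def simp del: of_int_diff)
  qed simp
  then show "open U = (\<forall>x\<in>U. \<forall>\<^sub>F (x', y) in uniformity. x' = x \<longrightarrow> y \<in> U)"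
    by (simp add: open_discrete)
qed (auto simp: uniformity_int_def dist_int_def)

end

instance bcontfun :: (metric_space, banach) banach ..

section \<open>Global solutions of Lipschitz equations and a Gronwall inequality\<close>

lemma integral_has_vector_derivative_atLeast:
  fixes g :: "real \<Rightarrow> 'a::banach"
  assumes "continuous_on {0..} g" "0 \<le> t"
  shows "((\<lambda>u. integral {0..u} g) has_vector_derivative g t) (at t within {0..})"
proof -
  have "((\<lambda>u. integral {0..u} g) has_vector_derivative g t) (at t within {0..t+1})"
    using assms by (intro integral_has_vector_derivative) (auto intro: continuous_on_subset)
  moreover have "at t within {0..t+1} = at t within {0..}"
    by (rule at_within_nhd[of _ "{..<t+1}"]) auto
  ultimately show ?thesis by simp
qed

lemma integral_exp_scale:
  fixes k t C :: real
  assumes "0 < k" "0 \<le> t"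
  shows "(\<lambda>s. C * exp (k * s)) integrable_on {0..t}"
    "integral {0..t} (\<lambda>s. C * exp (k * s)) = C * (exp (k * t) - 1) / k"
proof -
  have "((\<lambda>s. C * exp (k * s)) has_integral C * exp (k * t) / k - C * exp (k * 0) / k) {0..t}"
    by (rule fundamental_theorem_of_calculus[OF assms(2)])
       (use assms in \<open>auto intro!: derivative_eq_intros simp: has_real_derivative_iff_has_vector_derivative[symmetric]\<close>)
  then show "(\<lambda>s. C * exp (k * s)) integrable_on {0..t}"
    "integral {0..t} (\<lambda>s. C * exp (k * s)) = C * (exp (k * t) - 1) / k"
    using integral_unique[OF \<open>(_ has_integral _) _\<close>] by (auto simp: has_integral_integrable right_diff_distrib diff_divide_distrib)
qed

text \<open>Integration preserves growth at rate \<open>k\<close> and gains 1/k, which becomes the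
  contraction factor of the Picard map.\<close>

lemma norm_integral_le_exp:
  fixes g :: "real \<Rightarrow> 'a::banach"
  assumes "continuous_on {0..} g" "0 < k" "0 \<le> t" "\<And>s. 0 \<le> s \<Longrightarrow> norm (g s) \<le> C * exp (k * s)"
  shows "norm (integral {0..t} g) \<le> C / k * exp (k * t)"
proof -
  have C: "0 \<le> C" using order_trans[OF norm_ge_zero assms(4)[of 0]] by simp
  have "norm (integral {0..t} g) \<le> integral {0..t} (\<lambda>s. C * exp (k * s))"
    using assms by (intro integral_norm_bound_integral integral_exp_scale integrable_continuous_interval)
      (auto intro: continuous_on_subset)
  also have "\<dots> \<le> C / k * exp (k * t)"
    using assms C by (subst integral_exp_scale) (auto simp: field_simps)
  finally show ?thesis .
qed

text \<open>Picard iteration converges globally because it contracts in the norm weighted by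
  \<open>exp (- 2 * K * t)\<close>.\<close>

lemma global_lipschitz_ode:
  fixes F :: "'a::banach \<Rightarrow> 'a"
  assumes lip: "\<And>x y. norm (F x - F y) \<le> K * norm (x - y)" and K: "0 < K"
  obtains x where "x 0 = x0" "\<And>t. 0 \<le> t \<Longrightarrow> (x has_vector_derivative F (x t)) (at t within {0..})"
proof -
  define k where "k = 2 * K"
  have k: "0 < k" using K by (simp add: k_def)
  define g where "g y s = F (exp (k * s) *\<^sub>R apply_bcontfun y s)" for y s
  \<comment> \<open>The unknown \<open>y\<close> is the solution multiplied by exp (-k t), which
    keeps it bounded. Freezing it at negative times through \<open>max 0 t\<close> makes it a
    bounded continuous function on the whole line.\<close>
  define T where "T y t = exp (- k * max 0 t) *\<^sub>R (x0 + integral {0..max 0 t} (g y))" for y t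
  have Fc: "continuous_on UNIV F"
    by (rule lipschitz_on_continuous_on[of K]) (use lip K in \<open>auto simp: lipschitz_on_def dist_norm\<close>)
  have gc: "continuous_on {0..} (g y)" for y
    unfolding g_def by (rule continuous_on_compose2[OF Fc]) (auto intro!: continuous_intros)
  have gb: "norm (g y s) \<le> (norm (F 0) + K * norm y) * exp (k * s)" if "0 \<le> s" for y s
  proof -
    have "norm (g y s) \<le> norm (F 0) + norm (g y s - F 0)"
      using norm_triangle_ineq[of "F 0" "g y s - F 0"] by simp
    moreover have "norm (g y s - F 0) \<le> K * (exp (k * s) * norm (apply_bcontfun y s))"
      unfolding g_def using lip[of "exp (k * s) *\<^sub>R apply_bcontfun y s" 0] by simp
    moreover have "K * (exp (k * s) * norm (apply_bcontfun y s)) \<le> K * (exp (k * s) * norm y)"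
      using K norm_bounded[of y s] by simp
    moreover have "norm (F 0) * 1 \<le> norm (F 0) * exp (k * s)"
      using k that by (intro mult_left_mono) auto
    ultimately have "norm (g y s) \<le> norm (F 0) * exp (k * s) + K * (exp (k * s) * norm y)"
      by linarith
    then show ?thesis by (simp add: algebra_simps)
  qed
  have Tb: "T y \<in> bcontfun" for y
  proof (rule bcontfun_normI)
    have "continuous_on {0..} (\<lambda>t. integral {0..t} (g y))"
      using integral_has_vector_derivative_atLeast[OF gc] by (intro continuous_on_vector_derivative) auto
    then show "continuous_on UNIV (T y)"
      unfolding T_def
      by (intro continuous_on_scaleR continuous_on_add continuous_on_compose2[of "{0..}" "\<lambda>t. integral {0..t} (g y)" _ "max 0"])
         (auto intro!: continuous_intros)
    fix t :: real
    define \<tau> where "\<tau> = max 0 t"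
    have \<tau>: "0 \<le> \<tau>" by (simp add: \<tau>_def)
    have "norm (x0 + integral {0..\<tau>} (g y)) \<le> norm x0 + (norm (F 0) + K * norm y) / k * exp (k * \<tau>)"
      using norm_triangle_ineq[of x0 "integral {0..\<tau>} (g y)"] by (rule order_trans) (intro add_left_mono norm_integral_le_exp[OF gc k \<tau> gb])
    then have "norm (T y t) \<le> exp (- k * \<tau>) * (norm x0 + (norm (F 0) + K * norm y) / k * exp (k * \<tau>))"
      unfolding T_def \<tau>_def[symmetric] norm_scaleR by simp
    also have "\<dots> = exp (- k * \<tau>) * norm x0 + (norm (F 0) + K * norm y) / k"
      by (simp add: algebra_simps exp_minus)
    also have "\<dots> \<le> 1 * norm x0 + (norm (F 0) + K * norm y) / k"
      using k \<tau> by (intro add_mono mult_right_mono) auto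
    finally show "norm (T y t) \<le> norm x0 + (norm (F 0) + K * norm y) / k" by simp
  qed
  have app: "apply_bcontfun (Bcontfun (T y)) = T y" for y
    using Tb by (simp add: Bcontfun_inverse)
  have contr: "dist (Bcontfun (T y)) (Bcontfun (T z)) \<le> 1/2 * dist y z" for y z
  proof (rule dist_bound)
    fix t :: real
    define \<tau> where "\<tau> = max 0 t"
    have \<tau>: "0 \<le> \<tau>" by (simp add: \<tau>_def)
    have "T y t - T z t = exp (- k * \<tau>) *\<^sub>R (integral {0..\<tau>} (g y) - integral {0..\<tau>} (g z))"
      unfolding T_def \<tau>_def[symmetric] by (simp add: algebra_simps)
    also have "integral {0..\<tau>} (g y) - integral {0..\<tau>} (g z) = integral {0..\<tau>} (\<lambda>s. g y s - g z s)"
      by (intro integral_diff[symmetric] integrable_continuous_interval continuous_on_subset[OF gc]) auto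
    finally have e: "norm (T y t - T z t) = exp (- k * \<tau>) * norm (integral {0..\<tau>} (\<lambda>s. g y s - g z s))"
      by simp
    have "norm (integral {0..\<tau>} (\<lambda>s. g y s - g z s)) \<le> (K * dist y z) / k * exp (k * \<tau>)"
    proof (rule norm_integral_le_exp[OF _ k \<tau>])
      show "continuous_on {0..} (\<lambda>s. g y s - g z s)" by (intro continuous_intros gc)
      fix s :: real
      have "norm (g y s - g z s) \<le> K * norm (exp (k * s) *\<^sub>R apply_bcontfun y s - exp (k * s) *\<^sub>R apply_bcontfun z s)"
        unfolding g_def by (rule lip)
      also have "\<dots> = K * (exp (k * s) * dist (apply_bcontfun y s) (apply_bcontfun z s))"
        by (simp add: scaleR_diff_right[symmetric] dist_norm)
      also have "\<dots> \<le> K * (exp (k * s) * dist y z)"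
        using K by (intro mult_left_mono dist_bounded) auto
      finally show "norm (g y s - g z s) \<le> K * dist y z * exp (k * s)" by (simp add: mult_ac)
    qed
    then have "exp (- k * \<tau>) * norm (integral {0..\<tau>} (\<lambda>s. g y s - g z s)) \<le> exp (- k * \<tau>) * ((K * dist y z) / k * exp (k * \<tau>))"
      by (intro mult_left_mono) auto
    also have "\<dots> = 1/2 * dist y z"
      using K by (simp add: exp_minus k_def)
    finally show "dist (apply_bcontfun (Bcontfun (T y)) t) (apply_bcontfun (Bcontfun (T z)) t) \<le> 1/2 * dist y z"
      unfolding app dist_norm e .
  qed
  have "\<exists>!y. Bcontfun (T y) = y"
    by (rule banach_fix_type[of "1/2"]) (use contr in auto)
  then obtain y where "Bcontfun (T y) = y" by blast
  then have fp: "apply_bcontfun y t = T y t" for t using app[of y] by simp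
  define x where "x t = exp (k * t) *\<^sub>R apply_bcontfun y t" for t
  have x: "x t = x0 + integral {0..t} (g y)" if "0 \<le> t" for t
    using that by (simp add: x_def fp T_def exp_minus max_def)
  show ?thesis
  proof
    show "x 0 = x0" by (simp add: x)
    fix t :: real assume t: "0 \<le> t"
    have "((\<lambda>t. x0 + integral {0..t} (g y)) has_vector_derivative 0 + g y t) (at t within {0..})"
      by (intro has_vector_derivative_add integral_has_vector_derivative_atLeast gc t) auto
    then have "(x has_vector_derivative g y t) (at t within {0..})"
      by (intro has_vector_derivative_transform[of t "{0..}" x]) (use t x in auto)
    then show "(x has_vector_derivative F (x t)) (at t within {0..})"
      by (simp add: g_def x_def)
  qed
qed

text \<open>The shift by \<open>e / K\<close> makes the inequality homogeneous. \<open>K\<close> may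
  be negative, which gives decay, and the derivative is needed only at interior times, since
  solutions satisfy the equation for positive times only.\<close>

lemma gronwall:
  fixes \<phi> :: "real \<Rightarrow> real"
  assumes cd: "c \<le> d" and K: "K \<noteq> 0" and cont: "continuous_on {c..d} \<phi>"
    and D: "\<And>t. c < t \<Longrightarrow> t < d \<Longrightarrow> \<exists>D. (\<phi> has_real_derivative D) (at t) \<and> D \<le> K * \<phi> t + e"
  shows "\<phi> d + e / K \<le> exp (K * (d - c)) * (\<phi> c + e / K)"
proof -
  define f where "f t = exp (- K * t) * (\<phi> t + e / K)" for t
  have "f d \<le> f c"
  proof (rule DERIV_nonpos_imp_decreasing_open[OF cd])
    show "continuous_on {c..d} f" unfolding f_def by (intro continuous_intros cont)
    fix t assume "c < t" "t < d"
    then obtain D where D: "(\<phi> has_real_derivative D) (at t)" "D \<le> K * \<phi> t + e" using D by blast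
    have "(f has_real_derivative (exp (- K * t) * (- K)) * (\<phi> t + e / K) + exp (- K * t) * D) (at t)"
      unfolding f_def by (auto intro!: derivative_eq_intros D)
    moreover have "(exp (- K * t) * (- K)) * (\<phi> t + e / K) + exp (- K * t) * D = exp (- K * t) * (D - (K * \<phi> t + e))"
      using K by (simp add: algebra_simps)
    moreover have "\<dots> \<le> 0" using D(2) by (simp add: mult_nonneg_nonpos)
    ultimately show "\<exists>y. (f has_real_derivative y) (at t) \<and> y \<le> 0" by auto
  qed
  then have le: "exp (K * d) * f d \<le> exp (K * d) * f c" by simp
  have e: "exp (K * d) * exp (- K * t) = exp (K * (d - t))" for t
    unfolding exp_add[symmetric] by (simp add: right_diff_distrib)
  show ?thesis
    using le unfolding f_def mult.assoc[symmetric] e by simp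
qed

lemma has_real_derivative_cmod_power2:
  assumes "(f has_vector_derivative f') (at t within A)"
  shows "((\<lambda>t. (cmod (f t))\<^sup>2) has_real_derivative 2 * Re (cnj (f t) * f')) (at t within A)"
proof -
  have "((\<lambda>t. Re (f t)) has_real_derivative Re f') (at t within A)" "((\<lambda>t. Im (f t)) has_real_derivative Im f') (at t within A)"
    using bounded_linear.has_vector_derivative[OF bounded_linear_Re assms]
      bounded_linear.has_vector_derivative[OF bounded_linear_Im assms]
    by (auto simp: has_real_derivative_iff_has_vector_derivative)
  note DERIV_add[OF DERIV_power[OF this(1), of 2] DERIV_power[OF this(2), of 2]]
  then have "((\<lambda>t. (Re (f t))\<^sup>2 + (Im (f t))\<^sup>2) has_real_derivative 2 * Re (cnj (f t) * f')) (at t within A)"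
    by (simp add: algebra_simps)
  then show ?thesis by (simp add: cmod_power2)
qed

section \<open>Energy identity and solvability of the truncated equation\<close>

locale cgl =
  fixes \<omega> :: real and \<beta> :: complex
begin

definition lin :: "real \<Rightarrow> int \<Rightarrow> complex" where
  "lin L n = - (1 + \<i> * of_real L) * of_int (n\<^sup>2) + \<beta>"

abbreviation nu :: complex where
  "nu \<equiv> 1 + \<i> * of_real \<omega>"

lemma cmod_nu: "cmod nu \<le> 1 + \<bar>\<omega>\<bar>"
  using norm_triangle_ineq[of 1 "\<i> * of_real \<omega>"] by (simp add: norm_mult)

text \<open>\<open>L\<close> enters the symbol through its imaginary part alone and is gone from
  here on, which is why no energy bound contains it. The 1 compensates \<open>jw n\<close> being n^2
  + 1.\<close>

lemma Re_lin: "Re (lin L n) = 1 + Re \<beta> - jw n"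
  by (simp add: lin_def jw_def)

text \<open>The forcing \<open>p\<close> is arbitrary so that one identity serves the truncations as
  well as differences of solutions.\<close>

lemma has_real_derivative_en:
  assumes J: "finite J"
    and w: "\<And>n. n \<in> J \<Longrightarrow> ((\<lambda>t. w t n) has_vector_derivative (lin L n * w t n - nu * p n)) (at t within A)"
  shows "((\<lambda>t. en J s (w t)) has_real_derivative
      (- 2 * en J (s + 1) (w t) + (2 + 2 * Re \<beta>) * en J s (w t)
        - 2 * Re (nu * (\<Sum>n\<in>J. of_real (jw n powr s) * cnj (w t n) * p n)))) (at t within A)"
proof -
  have "((\<lambda>t. en J s (w t)) has_real_derivative
      (\<Sum>n\<in>J. jw n powr s * (2 * Re (cnj (w t n) * (lin L n * w t n - nu * p n))))) (at t within A)"
    unfolding en_def by (intro DERIV_sum DERIV_cmult has_real_derivative_cmod_power2 w)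
  moreover have "jw n powr s * (2 * Re (cnj (w t n) * (lin L n * w t n - nu * p n)))
      = - 2 * (jw n powr (s + 1) * (cmod (w t n))\<^sup>2) + (2 + 2 * Re \<beta>) * (jw n powr s * (cmod (w t n))\<^sup>2)
        - 2 * Re (nu * (of_real (jw n powr s) * cnj (w t n) * p n))" for n
  proof -
    have "cnj (w t n) * (lin L n * w t n) = lin L n * of_real ((cmod (w t n))\<^sup>2)"
      by (simp only: complex_norm_square mult_ac)
    then have "Re (cnj (w t n) * (lin L n * w t n)) = Re (lin L n * of_real ((cmod (w t n))\<^sup>2))"
      by (simp only:)
    also have "\<dots> = (1 + Re \<beta> - jw n) * (cmod (w t n))\<^sup>2"
      by (simp only: times_complex.sel Re_complex_of_real Im_complex_of_real Re_lin mult_zero_right diff_0_right)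
    finally have 1: "Re (cnj (w t n) * (lin L n * w t n)) = (1 + Re \<beta> - jw n) * (cmod (w t n))\<^sup>2" .
    have 2: "Re (nu * (of_real (jw n powr s) * cnj (w t n) * p n)) = jw n powr s * Re (cnj (w t n) * (nu * p n))"
      by (simp add: algebra_simps)
    have "Re (cnj (w t n) * (lin L n * w t n - nu * p n)) = (1 + Re \<beta> - jw n) * (cmod (w t n))\<^sup>2 - Re (cnj (w t n) * (nu * p n))"
      using 1 by (simp only: right_diff_distrib minus_complex.sel)
    moreover have "jw n powr (s + 1) = jw n powr s * jw n" by (simp add: powr_add)
    ultimately show ?thesis unfolding 2 by (simp only:) (simp add: algebra_simps)
  qed
  ultimately have "((\<lambda>t. en J s (w t)) has_real_derivative
      (\<Sum>n\<in>J. - 2 * (jw n powr (s + 1) * (cmod (w t n))\<^sup>2) + (2 + 2 * Re \<beta>) * (jw n powr s * (cmod (w t n))\<^sup>2)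
        - 2 * Re (nu * (of_real (jw n powr s) * cnj (w t n) * p n)))) (at t within A)"
    by (simp only:)
  then show ?thesis
    by (simp only: sum_subtractf sum.distrib sum_distrib_left[symmetric] Re_sum[symmetric] en_def)
qed

text \<open>The quartic form is real and at least the square of the energy, so it damps and its
  quadratic growth beats the linear term, whatever \<beta> is. The constant comes from c x \<le> 2
  x^2 + c^2 with c = 2 |\<beta>| + 1.\<close>

lemma en0_derivative_le:
  assumes J: "finite J"
    and w: "\<And>n. n \<in> J \<Longrightarrow> ((\<lambda>t. w t n) has_vector_derivative (lin L n * w t n - nu * cub J (w t) n)) (at t within A)"
  shows "\<exists>D. ((\<lambda>t. en J 0 (w t)) has_real_derivative D) (at t within A)
    \<and> D \<le> - 1 * en J 0 (w t) + (2 * cmod \<beta> + 1)\<^sup>2"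
proof -
  let ?r = "en J 0 (w t)"
  obtain S where S: "?r\<^sup>2 \<le> S" "(\<Sum>n\<in>J. cnj (w t n) * cub J (w t) n) = of_real S"
    using cub_energy_pos[OF J] by blast
  have e: "(\<Sum>n\<in>J. of_real (jw n powr 0) * cnj (w t n) * cub J (w t) n) = of_real S"
    using S(2) by simp
  have 1: "Re (nu * of_real S) = S" by simp
  note D = has_real_derivative_en[OF J w, where s = 0, unfolded e 1]
  have "?r \<le> en J (0 + 1) (w t)" by (rule en_mono) simp
  moreover have "Re \<beta> * ?r \<le> cmod \<beta> * ?r"
    by (intro mult_right_mono complex_Re_le_cmod) simp
  moreover have "(2 * cmod \<beta> + 1) * ?r \<le> 2 * ?r\<^sup>2 + (2 * cmod \<beta> + 1)\<^sup>2"
  proof -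
    have "c * x \<le> 2 * x\<^sup>2 + c\<^sup>2" for c x :: real
      using zero_le_power2[of "x - c / 2"] zero_le_power2[of x] zero_le_power2[of c]
      by (simp add: power2_diff power_divide mult.commute del: zero_le_power2, linarith)
    then show ?thesis .
  qed
  ultimately have "- 2 * en J (0 + 1) (w t) + (2 + 2 * Re \<beta>) * ?r - 2 * S \<le> - 1 * ?r + (2 * cmod \<beta> + 1)\<^sup>2"
    using S(1) by (simp add: algebra_simps)
  then show ?thesis using D by blast
qed

definition gal :: "real \<Rightarrow> int set \<Rightarrow> (real \<Rightarrow> int \<Rightarrow> complex) \<Rightarrow> bool" where
  "gal L J v \<longleftrightarrow> finite J \<and> (\<forall>t n. n \<notin> J \<longrightarrow> v t n = 0) \<and>
    (\<forall>n\<in>J. \<forall>t\<ge>0. ((\<lambda>t. v t n) has_vector_derivative (lin L n * v t n - nu * cub J (v t) n)) (at t within {0..}))"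

definition C0 :: real where "C0 = (2 * cmod \<beta> + 1)\<^sup>2"

lemma C0_pos: "0 < C0"
  unfolding C0_def by (rule zero_less_power) (simp add: add_nonneg_pos)

lemma at_within_atLeast: "0 < (t::real) \<Longrightarrow> at t within {0..} = at t"
  by (rule at_within_interior) (simp add: interior_Ici[of "-1"])

text \<open>Clamping the coordinates makes the vector field globally Lipschitz, and the energy inequality
  keeps the solution where the clamp is the identity.\<close>

lemma gal_exists:
  assumes J: "finite J"
  shows "\<exists>v. gal L J v \<and> (\<forall>n\<in>J. v 0 n = a n)"
proof -
  define r0 where "r0 = en J 0 a"
  \<comment> \<open>The energy will be seen not to exceed \<open>r0 + C0\<close> while the clamp is
    inactive; the additional 1 keeps it strictly away from the clamping radius.\<close>
  define R where "R = sqrt (r0 + C0 + 1)"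
  have r0: "0 \<le> r0" by (simp add: r0_def)
  have R: "0 \<le> R" "R\<^sup>2 = r0 + C0 + 1" using r0 C0_pos by (auto simp: R_def)
  define p where "p = closest_point (cball (0::complex) R)"
  have p_le: "cmod (p z) \<le> R" for z
    using closest_point_in_set[of "cball (0::complex) R" z] R by (auto simp: p_def)
  have p_id: "p z = z" if "cmod z \<le> R" for z
    unfolding p_def using that by (intro closest_point_self) simp
  have p_lip: "cmod (p z - p w) \<le> cmod (z - w)" for z w
    using closest_point_lipschitz[of "cball (0::complex) R" z w] R by (simp add: p_def dist_norm)
  define fv where "fv a n = (if n \<in> J then lin L n * a n - nu * cub J (\<lambda>n. p (a n)) n else 0)" for a n
  have fv_b: "fv a \<in> bcontfun" for a
  proof -
    have "bounded (range (fv a))"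
      by (rule finite_imp_bounded, rule finite_subset[of _ "insert 0 (fv a ` J)"]) (use J in \<open>auto simp: fv_def\<close>)
    then show ?thesis by (simp add: bcontfun_def)
  qed
  define F where "F a = Bcontfun (fv (apply_bcontfun a))" for a :: "int \<Rightarrow>\<^sub>C complex"
  have appF: "apply_bcontfun (F a) = fv (apply_bcontfun a)" for a
    unfolding F_def using fv_b by (simp add: Bcontfun_inverse)
  define c where "c = real (card J)"
  \<comment> \<open>A Lipschitz constant of the clamped field: the three nested sums give the
    factors \<open>c\<close>, and a product of three factors of size at most \<open>R\<close>
    changes at rate 3 R^2. It depends on \<open>L\<close> but serves existence only.\<close>
  define K where "K = (\<Sum>n\<in>J. cmod (lin L n)) + cmod nu * (c * (c * (c * (3 * R\<^sup>2)))) + 1"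
  have K: "0 < K" unfolding K_def c_def by (intro add_nonneg_pos add_nonneg_nonneg mult_nonneg_nonneg sum_nonneg) auto
  have cub_lip: "cmod (cub J (\<lambda>n. p (a n)) n - cub J (\<lambda>n. p (b n)) n) \<le> c * (c * (c * (3 * R\<^sup>2))) * d"
    if d: "\<And>n. cmod (a n - b n) \<le> d" for a b n d
  proof -
    have d0: "0 \<le> d" using d[of 0] norm_ge_zero order_trans by blast
    have t: "cmod (p (a j) * cnj (p (a k)) * p (a l) - p (b j) * cnj (p (b k)) * p (b l)) \<le> 3 * R\<^sup>2 * d" for j k l
    proof -
      have "p (a j) * cnj (p (a k)) * p (a l) - p (b j) * cnj (p (b k)) * p (b l)
        = (p (a j) - p (b j)) * cnj (p (a k)) * p (a l) + p (b j) * cnj (p (a k) - p (b k)) * p (a l) + p (b j) * cnj (p (b k)) * (p (a l) - p (b l))"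
        by (simp add: algebra_simps)
      also have "cmod \<dots> \<le> d * R * R + R * d * R + R * R * d"
        using R d0 p_le order_trans[OF p_lip d]
        by (intro order_trans[OF norm_triangle_ineq] add_mono)
           (auto simp: norm_mult simp del: complex_cnj_diff intro!: mult_mono)
      finally show ?thesis by (simp add: power2_eq_square)
    qed
    have "cmod (cub J (\<lambda>n. p (a n)) n - cub J (\<lambda>n. p (b n)) n)
        \<le> (\<Sum>j\<in>J. \<Sum>k\<in>J. \<Sum>l\<in>J. 3 * R\<^sup>2 * d)"
      unfolding cub_def sum_subtractf[symmetric]
      by (intro order_trans[OF norm_sum] sum_mono) (use t d0 in auto)
    then show ?thesis by (simp add: c_def mult_ac)
  qed
  have Fl: "norm (F a - F b) \<le> K * norm (a - b)" for a b
  proof -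
    let ?d = "dist a b"
    have d: "cmod (apply_bcontfun a n - apply_bcontfun b n) \<le> ?d" for n
      using dist_bounded[of a n b] by (simp add: dist_norm)
    have "dist (F a) (F b) \<le> K * ?d"
    proof (rule dist_bound)
      fix n
      show "dist (apply_bcontfun (F a) n) (apply_bcontfun (F b) n) \<le> K * ?d"
      proof (cases "n \<in> J")
        case True
        have "apply_bcontfun (F a) n - apply_bcontfun (F b) n
            = lin L n * (apply_bcontfun a n - apply_bcontfun b n)
              - nu * (cub J (\<lambda>n. p (apply_bcontfun a n)) n - cub J (\<lambda>n. p (apply_bcontfun b n)) n)"
          using True by (simp only: appF fv_def if_True) (simp add: algebra_simps)
        also have "cmod \<dots> \<le> cmod (lin L n) * ?d + cmod nu * (c * (c * (c * (3 * R\<^sup>2))) * ?d)"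
          by (intro order_trans[OF norm_triangle_ineq4] add_mono)
             (simp_all only: norm_mult mult_left_mono[OF d norm_ge_zero] mult_left_mono[OF cub_lip[OF d] norm_ge_zero])
        also have "\<dots> = (cmod (lin L n) + cmod nu * (c * (c * (c * (3 * R\<^sup>2))))) * ?d"
          by (simp add: algebra_simps)
        also have "\<dots> \<le> K * ?d"
        proof (rule mult_right_mono)
          have "cmod (lin L n) \<le> (\<Sum>n\<in>J. cmod (lin L n))"
            using J True by (intro member_le_sum) auto
          then show "cmod (lin L n) + cmod nu * (c * (c * (c * (3 * R\<^sup>2)))) \<le> K" by (simp add: K_def)
        qed simp
        finally show ?thesis by (simp add: dist_norm)
      qed (use K in \<open>simp add: appF fv_def\<close>)
    qed
    then show ?thesis by (simp add: dist_norm)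
  qed
  obtain x where x0: "x 0 = Bcontfun (\<lambda>n. if n \<in> J then a n else 0)"
    and x: "\<And>t. 0 \<le> t \<Longrightarrow> (x has_vector_derivative F (x t)) (at t within {0..})"
    by (rule global_lipschitz_ode[OF Fl K]) (rule that)
  define v where "v t n = (if n \<in> J then apply_bcontfun (x t) n else 0)" for t n
  have ini: "(\<lambda>n. if n \<in> J then a n else 0) \<in> bcontfun"
  proof -
    have "bounded (range (\<lambda>n. if n \<in> J then a n else 0))"
      by (rule finite_imp_bounded, rule finite_subset[of _ "insert 0 (a ` J)"]) (use J in auto)
    then show ?thesis by (simp add: bcontfun_def)
  qed
  have v0: "v 0 n = a n" if "n \<in> J" for n
    using that ini by (simp add: v_def x0 Bcontfun_inverse)
  have bl: "bounded_linear (\<lambda>y :: int \<Rightarrow>\<^sub>C complex. apply_bcontfun y n)" for n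
    by (rule bounded_linear_intro[of _ 1]) (auto simp: norm_bounded plus_bcontfun.rep_eq scaleR_bcontfun.rep_eq)
  have v: "((\<lambda>t. v t n) has_vector_derivative (lin L n * v t n - nu * cub J (\<lambda>n. p (v t n)) n)) (at t within {0..})"
    if "n \<in> J" "0 \<le> t" for n t
  proof -
    have "cub J (\<lambda>n. p (v t n)) n = cub J (\<lambda>n. p (apply_bcontfun (x t) n)) n"
      unfolding cub_def by (intro sum.cong refl) (auto simp: v_def)
    then show ?thesis
      using bounded_linear.has_vector_derivative[OF bl x[OF that(2)], of n] that
      by (simp add: v_def appF fv_def)
  qed
  have vc: "continuous_on {0..} (\<lambda>t. v t n)" if "n \<in> J" for n
    using v[OF that] by (intro continuous_on_vector_derivative) auto
  have rc: "continuous_on {0..} (\<lambda>t. en J 0 (v t))"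
    unfolding en_def using vc by (intro continuous_intros) auto
  have small: "cmod (v t n) \<le> R" if "en J 0 (v t) \<le> R\<^sup>2" for t n
  proof (cases "n \<in> J")
    case True
    have "(cmod (v t n))\<^sup>2 \<le> en J 0 (v t)"
      unfolding en_def using J True member_le_sum[of n J "\<lambda>n. jw n powr 0 * (cmod (v t n))\<^sup>2"] by simp
    then show ?thesis using that R(1) power2_le_imp_le[of "cmod (v t n)" R] by linarith
  qed (use R in \<open>simp add: v_def\<close>)
  have pv: "(\<lambda>n. p (v t n)) = v t" if "en J 0 (v t) \<le> R\<^sup>2" for t
    using small[OF that] p_id by auto
  have bound: "en J 0 (v t) < R\<^sup>2" if "0 \<le> t" for t
  proof (rule ccontr)
    assume "\<not> en J 0 (v t) < R\<^sup>2"
    \<comment> \<open>The least element of \<open>Z\<close> would be the first exit time. Up to it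
      the clamp is the identity, so the energy inequality holds and bounds the energy there by
      \<open>r0 + C0\<close>.\<close>
    define Z where "Z = {u \<in> {0..t}. R\<^sup>2 \<le> en J 0 (v u)}"
    have "compact Z"
    proof -
      have "closed Z"
        unfolding Z_def using rc
        by (intro continuous_on_closed_Collect_le continuous_on_const continuous_on_subset[OF rc]) auto
      moreover have "Z \<subseteq> {0..t}" by (auto simp: Z_def)
      ultimately show ?thesis using bounded_subset[OF bounded_closed_interval] compact_eq_bounded_closed by blast
    qed
    moreover have "t \<in> Z" using that \<open>\<not> en J 0 (v t) < R\<^sup>2\<close> by (auto simp: Z_def)
    ultimately obtain t1 where t1: "t1 \<in> Z" "\<And>u. u \<in> Z \<Longrightarrow> t1 \<le> u"
      using compact_attains_inf[of Z] by blast
    have lt: "en J 0 (v u) < R\<^sup>2" if "0 \<le> u" "u < t1" for u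
      using t1 that by (force simp: Z_def not_le)
    have "en J 0 (v t1) + C0 / - 1 \<le> exp (- 1 * (t1 - 0)) * (en J 0 (v 0) + C0 / - 1)"
    proof (rule gronwall)
      show "0 \<le> t1" using t1 by (simp add: Z_def)
      show "continuous_on {0..t1} (\<lambda>u. en J 0 (v u))" by (rule continuous_on_subset[OF rc]) auto
      fix u assume u: "0 < u" "u < t1"
      have "\<exists>D. ((\<lambda>t. en J 0 (v t)) has_real_derivative D) (at u within {0..}) \<and> D \<le> - 1 * en J 0 (v u) + (2 * cmod \<beta> + 1)\<^sup>2"
      proof (rule en0_derivative_le[OF J])
        fix n assume "n \<in> J"
        from v[OF this, of u] u lt[of u]
        show "((\<lambda>t. v t n) has_vector_derivative (lin L n * v u n - nu * cub J (v u) n)) (at u within {0..})"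
          by (simp add: pv)
      qed
      then show "\<exists>D. ((\<lambda>u. en J 0 (v u)) has_real_derivative D) (at u) \<and> D \<le> - 1 * en J 0 (v u) + C0"
        using u by (simp add: at_within_atLeast C0_def)
    qed simp
    then have "en J 0 (v t1) \<le> exp (- t1) * en J 0 (v 0) + C0 * (1 - exp (- t1))"
      by (simp add: algebra_simps)
    also have "\<dots> \<le> 1 * en J 0 (v 0) + C0 * 1"
      using t1 C0_pos by (intro add_mono mult_mono) (auto simp: Z_def)
    also have "en J 0 (v 0) = r0" unfolding r0_def en_def by (intro sum.cong refl) (simp add: v0)
    finally show False using t1 R by (auto simp: Z_def)
  qed
  have "gal L J v"
    unfolding gal_def
  proof (intro conjI allI ballI impI J)
    fix n t assume "n \<in> J" "(0::real) \<le> t"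
    from v[OF this] show "((\<lambda>t. v t n) has_vector_derivative (lin L n * v t n - nu * cub J (v t) n)) (at t within {0..})"
      using bound[of t] \<open>0 \<le> t\<close> by (simp add: pv)
  qed (simp add: v_def)
  then show ?thesis using v0 by blast
qed

end

section \<open>Energy estimates\<close>

context cgl
begin

definition A0 :: real where "A0 = 2 + 2 * cmod \<beta>"

definition B0 :: "real \<Rightarrow> real" where "B0 s = 6 * (1 + \<bar>\<omega>\<bar>) * 9 powr (s/2) * zc"

text \<open>With c = \<open>A0 + B0 s * r\<close>, the factor of the H^(s+3/4) term, this is the
  remainder left by interpolation with \<epsilon> = 1/c and \<sigma> = 0, multiplied by c: c times c
  to the power 4 s + 3, times r.\<close>

definition Gs :: "real \<Rightarrow> real \<Rightarrow> real" where
  "Gs s r = (A0 + B0 s * r) powr (4 * s + 4) * r"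

lemma A0_ge: "2 \<le> A0" by (simp add: A0_def)

lemma B0_nonneg: "0 \<le> B0 s" unfolding B0_def using zc_nonneg by simp

lemma Gs_nonneg: "0 \<le> r \<Longrightarrow> 0 \<le> Gs s r"
  by (simp add: Gs_def)

lemma Gs_mono: "0 \<le> r \<Longrightarrow> r \<le> r' \<Longrightarrow> 0 \<le> s \<Longrightarrow> Gs s r \<le> Gs s r'"
  unfolding Gs_def using A0_ge B0_nonneg[of s]
  by (intro mult_mono powr_mono2 add_left_mono mult_left_mono add_nonneg_nonneg mult_nonneg_nonneg) auto

lemma gal_finite: "gal L J v \<Longrightarrow> finite J"
  by (simp add: gal_def)

lemma gal_deriv:
  assumes "gal L J v" "n \<in> J" "0 < t"
  shows "((\<lambda>t. v t n) has_vector_derivative (lin L n * v t n - nu * cub J (v t) n)) (at t)"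
  using assms at_within_atLeast[of t] unfolding gal_def by (metis less_imp_le)

lemma gal_continuous:
  assumes "gal L J v"
  shows "continuous_on {0..} (\<lambda>t. v t n)"
proof (cases "n \<in> J")
  case True
  then show ?thesis
    using assms unfolding gal_def by (intro continuous_on_vector_derivative) auto
next
  case False
  then have "v t n = 0" for t using assms by (simp add: gal_def)
  then show ?thesis by simp
qed

lemma continuous_on_en:
  assumes "\<And>n. n \<in> J \<Longrightarrow> continuous_on A (\<lambda>t. v t n)"
  shows "continuous_on A (\<lambda>t. en J s (v t))"
  unfolding en_def using assms by (intro continuous_intros) auto

lemma gal_en_continuous:
  assumes "gal L J v" "0 \<le> c"
  shows "continuous_on {c..d} (\<lambda>t. en J s (v t))"
  by (rule continuous_on_en, rule continuous_on_subset[OF gal_continuous[OF assms(1)]]) (use assms in auto)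

lemma cmod_Re_nu: "- Re (nu * z) \<le> (1 + \<bar>\<omega>\<bar>) * cmod z"
proof -
  have "- Re (nu * z) \<le> cmod (nu * z)" using abs_Re_le_cmod[of "nu * z"] by linarith
  also have "\<dots> \<le> (1 + \<bar>\<omega>\<bar>) * cmod z"
    unfolding norm_mult by (intro mult_right_mono cmod_nu) simp
  finally show ?thesis .
qed

text \<open>The dissipation comes with a factor 2. One half absorbs the linear and the cubic term
  after interpolation, the other half is kept for decay and for smoothing.\<close>

lemma gal_en_deriv_le:
  assumes v: "gal L J v" and s: "0 \<le> s" and t: "0 < t"
  shows "\<exists>D. ((\<lambda>t. en J s (v t)) has_real_derivative D) (at t)
    \<and> D \<le> - en J (s + 1) (v t) + Gs s (en J 0 (v t))"
proof -
  note J = gal_finite[OF v]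
  let ?r = "en J 0 (v t)" and ?X = "en J (s + 1) (v t)" and ?y = "en J s (v t)" and ?z = "en J (s + 3/4) (v t)"
  let ?N = "\<Sum>n\<in>J. of_real (jw n powr s) * cnj (v t n) * cub J (v t) n"
  note D = has_real_derivative_en[OF J gal_deriv[OF v _ t], where s = s]
  define c where "c = A0 + B0 s * ?r"
  have c: "2 \<le> c" using A0_ge B0_nonneg[of s] by (simp add: c_def add_increasing2)
  have "- 2 * Re (nu * ?N) \<le> 2 * ((1 + \<bar>\<omega>\<bar>) * cmod ?N)"
    using cmod_Re_nu[of ?N] by linarith
  also have "\<dots> \<le> 2 * ((1 + \<bar>\<omega>\<bar>) * (3 * 9 powr (s/2) * zc * ?r * ?z))"
    by (intro mult_left_mono cub_energy_le J s) auto
  also have "\<dots> = B0 s * ?r * ?z" by (simp add: B0_def)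
  finally have 1: "- 2 * Re (nu * ?N) \<le> B0 s * ?r * ?z" .
  have "(2 + 2 * Re \<beta>) * ?y \<le> A0 * ?y"
    unfolding A0_def using complex_Re_le_cmod[of \<beta>] by (intro mult_right_mono) auto
  also have "\<dots> \<le> A0 * ?z"
    using A0_ge by (intro mult_left_mono en_mono) auto
  finally have 2: "(2 + 2 * Re \<beta>) * ?y \<le> A0 * ?z" .
  have "c * ?z \<le> c * ((1/c) * ?X + (1/(1/c)) powr (4 * (s - 0) + 3) * ?r)"
    using c s by (intro mult_left_mono en_interp) auto
  also have "\<dots> = ?X + (c powr 1 * c powr (4 * s + 3)) * ?r"
    using c by (simp add: distrib_left)
  also have "c powr 1 * c powr (4 * s + 3) = c powr (4 * s + 4)"
    by (simp only: powr_add[symmetric]) (simp add: add_ac)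
  finally have "c * ?z \<le> ?X + Gs s ?r" by (simp add: Gs_def c_def)
  with 1 2 have "- 2 * ?X + (2 + 2 * Re \<beta>) * ?y - 2 * Re (nu * ?N) \<le> - ?X + Gs s ?r"
    by (simp add: c_def distrib_right)
  with D show ?thesis by blast
qed

lemma gal_en0_le:
  assumes v: "gal L J v" and t: "0 \<le> t"
  shows "en J 0 (v t) \<le> exp (- t) * en J 0 (v 0) + C0"
proof -
  have "en J 0 (v t) + C0 / - 1 \<le> exp (- 1 * (t - 0)) * (en J 0 (v 0) + C0 / - 1)"
  proof (rule gronwall[OF t _ gal_en_continuous[OF v]])
    fix u :: real assume "0 < u"
    then show "\<exists>D. ((\<lambda>u. en J 0 (v u)) has_real_derivative D) (at u) \<and> D \<le> - 1 * en J 0 (v u) + C0"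
      unfolding C0_def by (intro en0_derivative_le[OF gal_finite[OF v] gal_deriv[OF v]])
  qed auto
  then have "en J 0 (v t) \<le> exp (- t) * en J 0 (v 0) + C0 * (1 - exp (- t))"
    by (simp add: algebra_simps)
  also have "C0 * (1 - exp (- t)) \<le> C0 * 1"
    using C0_pos by (intro mult_left_mono) auto
  finally show ?thesis by simp
qed

lemma gal_en0_bound:
  assumes v: "gal L J v" and t: "0 \<le> t" and x: "en J 0 (v 0) \<le> x"
  shows "en J 0 (v t) \<le> x + C0"
proof -
  have "exp (- t) * en J 0 (v 0) \<le> 1 * x" using t x by (intro mult_mono) auto
  then show ?thesis using gal_en0_le[OF v t] by simp
qed

lemma gal_en_le:
  assumes v: "gal L J v" and s: "0 \<le> s" and t: "0 \<le> c" "c \<le> t" and R: "\<And>u. c < u \<Longrightarrow> en J 0 (v u) \<le> R" and R0: "0 \<le> R"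
  shows "en J s (v t) \<le> exp (- (t - c)) * en J s (v c) + Gs s R"
proof -
  have "en J s (v t) + Gs s R / - 1 \<le> exp (- 1 * (t - c)) * (en J s (v c) + Gs s R / - 1)"
  proof (rule gronwall[OF t(2) _ gal_en_continuous[OF v t(1)]])
    fix u :: real assume u: "c < u"
    then obtain D where D: "((\<lambda>t. en J s (v t)) has_real_derivative D) (at u)" "D \<le> - en J (s + 1) (v u) + Gs s (en J 0 (v u))"
      using gal_en_deriv_le[OF v s, of u] t(1) by auto
    have "en J s (v u) \<le> en J (s + 1) (v u)" by (rule en_mono) simp
    moreover have "Gs s (en J 0 (v u)) \<le> Gs s R" by (intro Gs_mono R u s) auto
    ultimately show "\<exists>D. ((\<lambda>u. en J s (v u)) has_real_derivative D) (at u) \<and> D \<le> - 1 * en J s (v u) + Gs s R"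
      using D by auto
  qed auto
  then have "en J s (v t) \<le> exp (- (t - c)) * en J s (v c) + Gs s R * (1 - exp (- (t - c)))"
    by (simp add: algebra_simps)
  also have "Gs s R * (1 - exp (- (t - c))) \<le> Gs s R * 1"
    using Gs_nonneg[OF R0, of s] by (intro mult_left_mono) auto
  finally show ?thesis by simp
qed

lemma gal_en_bound:
  assumes v: "gal L J v" and s: "0 \<le> s" and t: "0 \<le> t" and x: "en J s (v 0) \<le> x"
  shows "en J s (v t) \<le> x + Gs s (x + C0)"
proof -
  have x0: "en J 0 (v 0) \<le> x" using en_mono[of 0 s] s x by (meson order_trans)
  have "0 \<le> x" using x0 en_nonneg order_trans by blast
  then have "en J s (v t) \<le> exp (- (t - 0)) * en J s (v 0) + Gs s (x + C0)"
    using C0_pos t by (intro gal_en_le[OF v s] gal_en0_bound[OF v _ x0]) auto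
  moreover have "exp (- (t - 0)) * en J s (v 0) \<le> 1 * x" using t x by (intro mult_mono) auto
  ultimately show ?thesis by simp
qed

text \<open>The first factor is the crude bound valid at all times; the factor 1 + x is exp (ln (1 +
  x)), the price of starting the exponential decay only after the waiting time ln (1 + x).\<close>

definition Qd :: "real \<Rightarrow> real \<Rightarrow> real" where
  "Qd s x = (x + Gs s (x + C0)) * (1 + x)"

text \<open>After the time \<open>ln (1 + x)\<close> the \<open>L\<^sup>2\<close> norm is below a bound independent of the data, and then so
  is the source term in the energy inequality.\<close>

lemma gal_dissipative:
  assumes v: "gal L J v" and s: "0 \<le> s" and t: "0 \<le> t" and x: "en J s (v 0) \<le> x"
  shows "en J s (v t) \<le> exp (- t) * Qd s x + Gs s (1 + C0)"
proof -
  have x0: "en J 0 (v 0) \<le> x" using en_mono[of 0 s] s x by (meson order_trans)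
  have xp: "0 \<le> x" using x0 en_nonneg order_trans by blast
  define T where "T = ln (1 + x)"
  have T: "0 \<le> T" "exp T = 1 + x" "exp (- T) = 1 / (1 + x)"
    using xp by (auto simp: T_def exp_minus field_simps)
  define Y where "Y = x + Gs s (x + C0)"
  have Y: "0 \<le> Y" using xp Gs_nonneg[of "x + C0" s] C0_pos by (simp add: Y_def)
  have G: "0 \<le> Gs s (1 + C0)" using C0_pos by (intro Gs_nonneg) auto
  show ?thesis
  proof (cases "t \<le> T")
    case True
    have "1 \<le> exp (- t) * (1 + x)"
      unfolding T(2)[symmetric] exp_add[symmetric] using True by simp
    then have "Y * 1 \<le> Y * (exp (- t) * (1 + x))" using Y by (intro mult_left_mono)
    also have "\<dots> = exp (- t) * Qd s x" by (simp add: Qd_def Y_def)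
    finally show ?thesis using gal_en_bound[OF v s t x] G by (simp add: Y_def)
  next
    case False
    have "en J s (v t) \<le> exp (- (t - T)) * en J s (v T) + Gs s (1 + C0)"
    proof (rule gal_en_le[OF v s T(1)])
      fix u assume u: "T < u"
      have "exp (- u) * en J 0 (v 0) \<le> exp (- T) * x"
        using u x0 by (intro mult_mono) auto
      also have "\<dots> \<le> 1" unfolding T(3) using xp by simp
      finally show "en J 0 (v u) \<le> 1 + C0" using gal_en0_le[OF v, of u] u T(1) by simp
    qed (use False C0_pos in auto)
    also have "exp (- (t - T)) * en J s (v T) \<le> exp (- (t - T)) * Y"
      unfolding Y_def by (intro mult_left_mono gal_en_bound[OF v s T(1) x]) auto
    also have "exp (- (t - T)) * Y = exp (- t) * Qd s x"
      using T(2) by (simp add: exp_diff exp_minus Qd_def Y_def field_simps)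
    finally show ?thesis by simp
  qed
qed

text \<open>Applied to q = u * \<open>jw n\<close> at time u: the term produced by differentiating a
  power of time is dominated by the dissipation for q \<ge> s + 1 and by a constant
  otherwise.\<close>

lemma powr_smoothing_bound:
  fixes q :: real
  assumes "0 \<le> s" "0 < q"
  shows "(s + 1) * q powr s \<le> q powr (s + 1) + (s + 1) powr (s + 1)"
proof (cases "s + 1 \<le> q")
  case True
  then have "(s + 1) * q powr s \<le> q * q powr s" by (intro mult_right_mono) auto
  then show ?thesis using assms by (simp add: powr_add add_increasing2)
next
  case False
  then have "(s + 1) * q powr s \<le> (s + 1) * (s + 1) powr s"
    using assms by (intro mult_left_mono powr_mono2) auto
  also have "\<dots> = (s + 1) powr (s + 1)" using assms by (simp add: powr_add)
  also have "\<dots> \<le> q powr (s + 1) + (s + 1) powr (s + 1)" by simp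
  finally show ?thesis .
qed

definition Sm :: "real \<Rightarrow> real \<Rightarrow> real" where
  "Sm s x = (s + 1) powr (s + 1) * (x + C0) + Gs s (x + C0)"

text \<open>A power of time is traded for derivatives: what its derivative produces is absorbed by
  the dissipation at high frequencies and by the L^2 bound at low ones. The weighted energy then
  grows at most linearly up to time 1; later times restart from time 1, which costs the factor 2.
  Every s is reached in one step.\<close>

lemma gal_smoothing:
  assumes v: "gal L J v" and s: "0 \<le> s" and t: "0 < t" and x: "en J 0 (v 0) \<le> x"
  shows "en J s (v t) \<le> 2 * Sm s x * (1 + t powr (- s))"
proof -
  define R where "R = x + C0"
  have xp: "0 \<le> x" using x en_nonneg order_trans by blast
  have R0: "0 \<le> R" using xp C0_pos by (simp add: R_def)
  have R: "en J 0 (v u) \<le> R" if "0 \<le> u" for u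
    unfolding R_def by (rule gal_en0_bound[OF v that x])
  have G: "0 \<le> Gs s R" by (rule Gs_nonneg[OF R0])
  have H: "0 \<le> Sm s x" "Gs s R \<le> Sm s x" using R0 G by (auto simp: Sm_def R_def[symmetric])
  have small: "en J s (v t) \<le> Sm s x * t powr (- s)" if t: "0 < t" "t \<le> 1" for t
  proof -
    \<comment> \<open>One power of time more than the resulting rate: with \<open>u powr s\<close>
      the low-frequency remainder would be of order 1/u, which is not integrable at 0. It also gives
      \<open>f 0 = 0\<close> when s = 0.\<close>
    define f where "f u = u powr (s + 1) * en J s (v u) - Sm s x * u" for u
    have "f t \<le> f 0"
    proof (rule DERIV_nonpos_imp_decreasing_open[of 0 t f])
      show "continuous_on {0..t} f"
        unfolding f_def using s
        by (intro continuous_intros continuous_on_powr' gal_en_continuous[OF v]) auto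
      fix u assume u: "0 < u" "u < t"
      then obtain D where D: "((\<lambda>t. en J s (v t)) has_real_derivative D) (at u)" "D \<le> - en J (s + 1) (v u) + Gs s (en J 0 (v u))"
        using gal_en_deriv_le[OF v s, of u] by auto
      have "(f has_real_derivative ((s + 1) * u powr s * en J s (v u) + u powr (s + 1) * D - Sm s x)) (at u)"
        unfolding f_def using u s by (auto intro!: derivative_eq_intros D(1))
      moreover have "(s + 1) * u powr s * en J s (v u) \<le> u powr (s + 1) * en J (s + 1) (v u) + (s + 1) powr (s + 1) * en J 0 (v u)"
      proof -
        have "(s + 1) * u powr s * en J s (v u) = (\<Sum>n\<in>J. ((s + 1) * (u * jw n) powr s) * (cmod (v u n))\<^sup>2)"
          using u by (simp add: en_def sum_distrib_left powr_mult mult_ac)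
        also have "\<dots> \<le> (\<Sum>n\<in>J. ((u * jw n) powr (s + 1) + (s + 1) powr (s + 1)) * (cmod (v u n))\<^sup>2)"
          using u by (intro sum_mono mult_right_mono powr_smoothing_bound s) auto
        also have "\<dots> = u powr (s + 1) * en J (s + 1) (v u) + (s + 1) powr (s + 1) * en J 0 (v u)"
          unfolding en_def sum_distrib_left sum.distrib[symmetric]
          using u by (intro sum.cong refl) (simp add: powr_mult algebra_simps)
        finally show ?thesis .
      qed
      moreover have "u powr (s + 1) * D \<le> u powr (s + 1) * (- en J (s + 1) (v u)) + Gs s R"
      proof -
        have "u powr (s + 1) * D \<le> u powr (s + 1) * (- en J (s + 1) (v u) + Gs s R)"
          using D(2) Gs_mono[of "en J 0 (v u)" R s] R[of u] u s by (intro mult_left_mono) auto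
        moreover have "u powr (s + 1) * Gs s R \<le> 1 * Gs s R"
          using u t s G by (intro mult_right_mono powr_le1) auto
        ultimately show ?thesis by (simp add: algebra_simps)
      qed
      moreover have "(s + 1) powr (s + 1) * en J 0 (v u) \<le> (s + 1) powr (s + 1) * R"
        using R[of u] u by (intro mult_left_mono) auto
      ultimately show "\<exists>y. (f has_real_derivative y) (at u) \<and> y \<le> 0"
        by (intro exI[of _ "(s + 1) * u powr s * en J s (v u) + u powr (s + 1) * D - Sm s x"] conjI)
           (auto simp: Sm_def R_def[symmetric])
    qed (use t in simp)
    then have "t powr (s + 1) * en J s (v t) \<le> Sm s x * t" using s by (simp add: f_def)
    then have "t powr s * en J s (v t) \<le> Sm s x" using t by (simp add: powr_add mult.commute[of _ t] mult.left_commute)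
    then show ?thesis using t by (simp add: powr_minus field_simps)
  qed
  have ft: "1 \<le> 1 + t powr (- s)" by simp
  show ?thesis
  proof (cases "t \<le> 1")
    case True
    have "Sm s x * t powr (- s) \<le> Sm s x * (2 * (1 + t powr (- s)))"
      using H by (intro mult_left_mono) auto
    then show ?thesis using small[OF t True] by (simp add: algebra_simps)
  next
    case False
    have "en J s (v t) \<le> exp (- (t - 1)) * en J s (v 1) + Gs s R"
      using False R0 R by (intro gal_en_le[OF v s]) auto
    also have "exp (- (t - 1)) * en J s (v 1) \<le> 1 * Sm s x"
      using False small[of 1] by (intro mult_mono) auto
    finally have "en J s (v t) \<le> 2 * Sm s x" using H by simp
    moreover have "2 * Sm s x * 1 \<le> 2 * Sm s x * (1 + t powr (- s))" using H by (intro mult_left_mono ft) auto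
    ultimately show ?thesis by simp
  qed
qed

text \<open>The fourth power is c * c^3, from interpolation with \<epsilon> = 1/c and \<sigma> = s:
  for a difference the remainder should be a multiple of the very norm to which Gronwall is
  applied.\<close>

definition Kc :: "real \<Rightarrow> real \<Rightarrow> real" where
  "Kc s R = (A0 + B0 s * R) powr 4"

lemma Kc_ge_1: "0 \<le> R \<Longrightarrow> 1 \<le> Kc s R"
  unfolding Kc_def using A0_ge B0_nonneg[of s] by (intro ge_one_powr_ge_zero) (auto simp: add_increasing2)

text \<open>The common source of the Lipschitz estimate (take \<open>u\<close> a solution of the same truncation,
  \<open>e = 0\<close>), of the convergence of the truncations, and of uniqueness.\<close>

lemma comparison:
  assumes v: "gal L J v" and s: "0 \<le> s" and T: "0 \<le> T"
    and uc: "\<And>n. n \<in> J \<Longrightarrow> continuous_on {0..T} (\<lambda>t. u t n)"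
    and ud: "\<And>n t. n \<in> J \<Longrightarrow> 0 < t \<Longrightarrow> t < T \<Longrightarrow>
        ((\<lambda>t. u t n) has_vector_derivative (lin L n * u t n - nu * p t n)) (at t)"
    and e: "\<And>t. 0 < t \<Longrightarrow> t < T \<Longrightarrow>
        (\<Sum>n\<in>J. jw n powr s * cmod (u t n - v t n) * cmod (p t n - cub J (u t) n)) \<le> e"
    and R: "\<And>t. 0 < t \<Longrightarrow> t < T \<Longrightarrow> en J s (u t) \<le> R" "\<And>t. 0 < t \<Longrightarrow> t < T \<Longrightarrow> en J s (v t) \<le> R"
    and nn: "0 \<le> e" "0 \<le> R"
  shows "en J s (\<lambda>n. u T n - v T n) \<le> exp (Kc s R * T) * (en J s (\<lambda>n. u 0 n - v 0 n) + 2 * (1 + \<bar>\<omega>\<bar>) * e)"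
proof -
  note J = gal_finite[OF v]
  define w where "w t n = u t n - v t n" for t n
  define K where "K = Kc s R"
  have K: "1 \<le> K" unfolding K_def by (rule Kc_ge_1[OF nn(2)])
  define c where "c = A0 + B0 s * R"
  have c: "2 \<le> c" using A0_ge B0_nonneg[of s] nn(2) by (simp add: c_def add_increasing2)
  define E where "E = 2 * (1 + \<bar>\<omega>\<bar>) * e"
  have E: "0 \<le> E" using nn by (simp add: E_def)
  have "en J s (w T) + E / K \<le> exp (K * (T - 0)) * (en J s (w 0) + E / K)"
  proof (rule gronwall[OF T])
    show "continuous_on {0..T} (\<lambda>t. en J s (w t))"
      unfolding w_def by (intro continuous_on_en continuous_intros uc continuous_on_subset[OF gal_continuous[OF v]]) auto
    fix t assume t: "0 < t" "t < T"
    let ?X = "en J (s + 1) (w t)" and ?y = "en J s (w t)" and ?z = "en J (s + 3/4) (w t)"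
    define p' where "p' n = p t n - cub J (v t) n" for n
    have "((\<lambda>t. w t n) has_vector_derivative (lin L n * w t n - nu * p' n)) (at t)" if "n \<in> J" for n
      using has_vector_derivative_diff[OF ud[OF that t] gal_deriv[OF v that t(1)]]
      unfolding w_def p'_def by (simp add: algebra_simps)
    note D = has_real_derivative_en[OF J this, where s = s]
    let ?N = "\<Sum>n\<in>J. of_real (jw n powr s) * cnj (w t n) * p' n"
    \<comment> \<open>The first sum is the difference of the same truncated nonlinearity at two
      points; the second is the residual of \<open>u\<close> as a solution of the truncated system,
      bounded by \<open>e\<close>.\<close>
    have "?N = (\<Sum>n\<in>J. of_real (jw n powr s) * cnj (u t n - v t n) * (cub J (u t) n - cub J (v t) n))
        + (\<Sum>n\<in>J. of_real (jw n powr s) * cnj (u t n - v t n) * (p t n - cub J (u t) n))"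
      unfolding sum.distrib[symmetric] by (intro sum.cong refl) (simp add: w_def p'_def algebra_simps)
    also have "cmod \<dots> \<le> 3 * 9 powr (s/2) * zc * R * ?z + e"
    proof (intro order_trans[OF norm_triangle_ineq] add_mono)
      show "cmod (\<Sum>n\<in>J. of_real (jw n powr s) * cnj (u t n - v t n) * (cub J (u t) n - cub J (v t) n))
        \<le> 3 * 9 powr (s/2) * zc * R * ?z"
        unfolding w_def by (rule cub_diff_energy_le[OF J s R(1)[OF t] R(2)[OF t]])
      have "cmod (\<Sum>n\<in>J. of_real (jw n powr s) * cnj (u t n - v t n) * (p t n - cub J (u t) n))
        \<le> (\<Sum>n\<in>J. jw n powr s * cmod (u t n - v t n) * cmod (p t n - cub J (u t) n))"
        by (rule order_trans[OF norm_sum], rule sum_mono) (simp add: norm_mult del: complex_cnj_diff)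
      then show "cmod (\<Sum>n\<in>J. of_real (jw n powr s) * cnj (u t n - v t n) * (p t n - cub J (u t) n)) \<le> e"
        using e[OF t] by simp
    qed
    finally have "(1 + \<bar>\<omega>\<bar>) * cmod ?N \<le> (1 + \<bar>\<omega>\<bar>) * (3 * 9 powr (s/2) * zc * R * ?z + e)"
      by (intro mult_left_mono) auto
    then have 1: "- 2 * Re (nu * ?N) \<le> B0 s * R * ?z + E"
      using cmod_Re_nu[of ?N] by (simp add: B0_def E_def algebra_simps)
    have "(2 + 2 * Re \<beta>) * ?y \<le> A0 * ?y"
      unfolding A0_def using complex_Re_le_cmod[of \<beta>] by (intro mult_right_mono) auto
    also have "\<dots> \<le> A0 * ?z"
      using A0_ge by (intro mult_left_mono en_mono) auto
    finally have 2: "(2 + 2 * Re \<beta>) * ?y \<le> A0 * ?z" .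
    have "c * ?z \<le> c * ((1/c) * ?X + (1/(1/c)) powr (4 * (s - s) + 3) * ?y)"
      using c s by (intro mult_left_mono en_interp) auto
    also have "\<dots> = ?X + (c powr 1 * c powr 3) * ?y"
      using c by (simp add: distrib_left)
    also have "c powr 1 * c powr 3 = K"
      unfolding powr_add[symmetric] by (simp add: K_def Kc_def c_def)
    finally have "c * ?z \<le> ?X + K * ?y" .
    moreover have "0 \<le> ?X" by simp
    ultimately have "- 2 * ?X + (2 + 2 * Re \<beta>) * ?y - 2 * Re (nu * ?N) \<le> K * ?y + E"
      using 1 2 unfolding c_def distrib_right by linarith
    with D show "\<exists>D. ((\<lambda>t. en J s (w t)) has_real_derivative D) (at t) \<and> D \<le> K * ?y + E" by blast
  qed (use K in auto)
  moreover have "0 \<le> E / K" "E / K \<le> E" using E K mult_left_mono[of 1 K E] by (auto simp: divide_le_eq)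
  moreover from this have "exp (K * T) * (en J s (w 0) + E / K) \<le> exp (K * T) * (en J s (w 0) + E)"
    by (intro mult_left_mono) auto
  ultimately have "en J s (w T) \<le> exp (K * T) * (en J s (w 0) + E)"
    unfolding diff_0_right by linarith
  then show ?thesis by (simp add: w_def[abs_def] K_def E_def)
qed

lemma gal_lipschitz:
  assumes u: "gal L J u" and v: "gal L J v" and s: "0 \<le> s" and T: "0 \<le> T"
    and x: "en J s (u 0) \<le> x" "en J s (v 0) \<le> x"
  shows "en J s (\<lambda>n. u T n - v T n) \<le> exp (Kc s (x + Gs s (x + C0)) * T) * en J s (\<lambda>n. u 0 n - v 0 n)"
proof -
  have xp: "0 \<le> x" using x(1) en_nonneg order_trans by blast
  have "en J s (\<lambda>n. u T n - v T n) \<le> exp (Kc s (x + Gs s (x + C0)) * T) * (en J s (\<lambda>n. u 0 n - v 0 n) + 2 * (1 + \<bar>\<omega>\<bar>) * 0)"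
  proof (rule comparison[OF v s T])
    show "0 \<le> x + Gs s (x + C0)" using xp C0_pos by (intro add_nonneg_nonneg Gs_nonneg) auto
  qed (auto intro!: gal_en_bound[OF u s _ x(1)] gal_en_bound[OF v s _ x(2)] gal_deriv[OF u] continuous_on_subset[OF gal_continuous[OF u]])
  then show ?thesis by simp
qed

end

section \<open>The limit of the truncations\<close>

text \<open>Bounds on all finite partial sums of the squared \<open>H\<^sup>s\<close> norm pass to coordinatewise limits
  and subsume summability.\<close>

definition hb :: "real \<Rightarrow> (int \<Rightarrow> complex) \<Rightarrow> real \<Rightarrow> bool" where
  "hb s a B \<longleftrightarrow> (\<forall>J. finite J \<longrightarrow> en J s a \<le> B)"

definition restr :: "int set \<Rightarrow> (int \<Rightarrow> complex) \<Rightarrow> int \<Rightarrow> complex" where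
  "restr J a n = (if n \<in> J then a n else 0)"

definition II :: "nat \<Rightarrow> int set" where "II M = {- int M..int M}"

lemma finite_II [simp]: "finite (II M)" by (simp add: II_def)

lemma II_mono: "M \<le> M' \<Longrightarrow> II M \<subseteq> II M'" by (auto simp: II_def)

lemma hb_en: "hb s a B \<Longrightarrow> finite J \<Longrightarrow> en J s a \<le> B"
  by (simp add: hb_def)

lemma hb_nonneg: "hb s a B \<Longrightarrow> 0 \<le> B"
  using hb_en[of s a B "{}"] by (simp add: en_def)

lemma hb_le: "hb s a B \<Longrightarrow> B \<le> C \<Longrightarrow> hb s a C"
  unfolding hb_def by force

lemma hb_mono: "hb s' a B \<Longrightarrow> s \<le> s' \<Longrightarrow> hb s a B"
  unfolding hb_def by (auto intro: order_trans[OF en_mono])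

lemma hb_pointwise:
  assumes "hb s a B" "0 \<le> s"
  shows "(cmod (a n))\<^sup>2 \<le> B"
proof -
  have "1 * (cmod (a n))\<^sup>2 \<le> jw n powr s * (cmod (a n))\<^sup>2"
    by (intro mult_right_mono jw_powr_ge_1 assms) auto
  then show ?thesis using hb_en[OF assms(1), of "{n}"] by (simp add: en_def)
qed

lemma cmod_add_power2_le: "(cmod (x + y))\<^sup>2 \<le> 2 * (cmod x)\<^sup>2 + 2 * (cmod y)\<^sup>2"
proof -
  have "(cmod (x + y))\<^sup>2 \<le> (cmod x + cmod y)\<^sup>2"
    by (intro power_mono norm_triangle_ineq) auto
  also have "\<dots> \<le> 2 * (cmod x)\<^sup>2 + 2 * (cmod y)\<^sup>2"
    using zero_le_power2[of "cmod x - cmod y"] unfolding power2_sum power2_diff by linarith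
  finally show ?thesis .
qed

lemma en_add_le: "en J s (\<lambda>n. a n + b n) \<le> 2 * en J s a + 2 * en J s b"
proof -
  have "en J s (\<lambda>n. a n + b n) \<le> (\<Sum>n\<in>J. jw n powr s * (2 * (cmod (a n))\<^sup>2 + 2 * (cmod (b n))\<^sup>2))"
    unfolding en_def by (intro sum_mono mult_left_mono cmod_add_power2_le) auto
  also have "\<dots> = 2 * en J s a + 2 * en J s b"
    by (simp add: en_def sum_distrib_left distrib_left sum.distrib mult_ac)
  finally show ?thesis .
qed

lemma hb_add: "hb s a A \<Longrightarrow> hb s b B \<Longrightarrow> hb s (\<lambda>n. a n + b n) (2 * A + 2 * B)"
  unfolding hb_def
proof (intro allI impI)
  fix J :: "int set" assume *: "\<forall>J. finite J \<longrightarrow> en J s a \<le> A" "\<forall>J. finite J \<longrightarrow> en J s b \<le> B" "finite J"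
  then show "en J s (\<lambda>n. a n + b n) \<le> 2 * A + 2 * B"
    using en_add_le[of J s a b] by fastforce
qed

lemma en_uminus: "en J s (\<lambda>n. - a n) = en J s a"
  by (simp add: en_def)

lemma hb_uminus: "hb s a A \<Longrightarrow> hb s (\<lambda>n. - a n) A"
  by (simp add: hb_def en_uminus)

lemma hb_diff: "hb s a A \<Longrightarrow> hb s b B \<Longrightarrow> hb s (\<lambda>n. a n - b n) (2 * A + 2 * B)"
  using hb_add[OF _ hb_uminus, of s a A b B] by simp

lemma hb_commute: "hb s (\<lambda>n. a n - b n) A \<Longrightarrow> hb s (\<lambda>n. b n - a n) A"
  using hb_uminus[of s "\<lambda>n. a n - b n" A] by simp

lemma hb_triangle: "hb s (\<lambda>n. a n - b n) A \<Longrightarrow> hb s (\<lambda>n. b n - c n) B \<Longrightarrow> hb s (\<lambda>n. a n - c n) (2 * A + 2 * B)"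
  using hb_add[of s "\<lambda>n. a n - b n" A "\<lambda>n. b n - c n" B] by simp

lemma hb_limit:
  assumes "\<And>n. (\<lambda>M. a M n) \<longlonglongrightarrow> b n" "\<forall>\<^sub>F M in sequentially. hb s (a M) B"
  shows "hb s b B"
  unfolding hb_def
proof (intro allI impI)
  fix J :: "int set" assume J: "finite J"
  have "(\<lambda>M. en J s (a M)) \<longlonglongrightarrow> en J s b"
    unfolding en_def by (intro tendsto_intros assms)
  moreover have "\<forall>\<^sub>F M in sequentially. en J s (a M) \<le> B"
    using assms(2) by eventually_elim (rule hb_en[OF _ J])
  ultimately show "en J s b \<le> B"
    by (rule tendsto_upperbound) simp
qed

lemma hb_support:
  assumes "finite J" "\<And>n. n \<notin> J \<Longrightarrow> a n = 0" "en J s a \<le> B"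
  shows "hb s a B"
  unfolding hb_def
proof (intro allI impI)
  fix K :: "int set" assume K: "finite K"
  have "en K s a = en (K \<inter> J) s a"
    unfolding en_def using K assms(2) by (intro sum.mono_neutral_right) auto
  also have "\<dots> \<le> en J s a" using assms(1) by (intro en_subset) auto
  finally show "en K s a \<le> B" using assms(3) by simp
qed

lemma hb_restr: "hb s a B \<Longrightarrow> hb s (restr J a) B"
  unfolding hb_def
proof (intro allI impI)
  fix K :: "int set" assume *: "\<forall>K. finite K \<longrightarrow> en K s a \<le> B" "finite K"
  have "en K s (restr J a) \<le> en K s a"
    unfolding en_def by (intro sum_mono mult_left_mono) (auto simp: restr_def)
  then show "en K s (restr J a) \<le> B" using * by force
qed

lemma hb_lb:
  assumes "hb (3/4) a B"
  shows "lb a (sqrt (zc * B))"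
  unfolding lb_def
proof (intro allI impI)
  fix J :: "int set" assume J: "finite J"
  have "(\<Sum>n\<in>J. cmod (a n))\<^sup>2 \<le> zc * en J (3/4) a"
    using l1_le_en[OF J, of 0 a] by simp
  also have "\<dots> \<le> zc * B" using hb_en[OF assms J] zc_nonneg by (rule mult_left_mono)
  finally show "(\<Sum>n\<in>J. cmod (a n)) \<le> sqrt (zc * B)" by (rule real_le_rsqrt)
qed

lemma lb_mono: "lb a B \<Longrightarrow> B \<le> C \<Longrightarrow> lb a C"
  unfolding lb_def by force

lemma hb_tail:
  assumes "hb s' a B" "s \<le> s'"
  shows "hb s (\<lambda>n. a n - restr (II M) a n) (B / ((real M)\<^sup>2 + 1) powr (s' - s))"
  unfolding hb_def
proof (intro allI impI)
  fix J :: "int set" assume J: "finite J"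
  define q where "q = ((real M)\<^sup>2 + 1) powr (s' - s)"
  have M1: "(1::real) \<le> (real M)\<^sup>2 + 1" by simp
  have q: "0 < q" unfolding q_def using M1 by (intro powr_gt_zero[THEN iffD2]) linarith
  have "jw n powr s * (cmod (a n - restr (II M) a n))\<^sup>2 \<le> (jw n powr s' * (cmod (a n))\<^sup>2) / q" for n
  proof (cases "n \<in> II M")
    case False
    then have "\<bar>int M\<bar> \<le> \<bar>n\<bar>" by (auto simp: II_def)
    then have "(int M)\<^sup>2 \<le> n\<^sup>2" by (rule abs_le_square_iff[THEN iffD1])
    then have "real_of_int ((int M)\<^sup>2) \<le> real_of_int (n\<^sup>2)" by (subst of_int_le_iff)
    then have "(real M)\<^sup>2 + 1 \<le> jw n" by (simp add: jw_def)
    then have "q \<le> jw n powr (s' - s)" unfolding q_def using assms(2) M1 by (intro powr_mono2) auto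
    then have "jw n powr s * q \<le> jw n powr s * jw n powr (s' - s)" by (intro mult_left_mono) auto
    also have "\<dots> = jw n powr s'" by (simp add: powr_add[symmetric])
    finally have "jw n powr s \<le> jw n powr s' / q" using q by (simp add: field_simps)
    then have "jw n powr s * (cmod (a n))\<^sup>2 \<le> jw n powr s' / q * (cmod (a n))\<^sup>2" by (intro mult_right_mono) auto
    then show ?thesis using False by (simp add: restr_def)
  qed (use q in \<open>simp add: restr_def\<close>)
  then have "en J s (\<lambda>n. a n - restr (II M) a n) \<le> en J s' a / q"
    unfolding en_def sum_divide_distrib by (intro sum_mono) auto
  also have "\<dots> \<le> B / q" using hb_en[OF assms(1) J] q by (intro divide_right_mono) auto
  finally show "en J s (\<lambda>n. a n - restr (II M) a n) \<le> B / q" .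
qed

text \<open>Without additional regularity there is no rate. A finite set whose partial sum comes
  within \<epsilon> of the supremum leaves at most \<epsilon> for everything outside an interval
  containing it.\<close>

lemma hb_tail_small:
  assumes "hb s a B" "0 < \<epsilon>"
  shows "\<exists>k. hb s (\<lambda>n. a n - restr (II k) a n) \<epsilon>"
proof -
  define S where "S = (SUP J\<in>{J. finite J}. en J s a)"
  have bdd: "bdd_above ((\<lambda>J. en J s a) ` {J. finite J})"
    using hb_en[OF assms(1)] by (intro bdd_aboveI) auto
  have ub: "en J s a \<le> S" if "finite J" for J
    unfolding S_def using that by (intro cSUP_upper bdd) auto
  obtain J0 where J0: "finite J0" "S - \<epsilon> < en J0 s a"
  proof -
    have "S - \<epsilon> < S" using assms(2) by simp
    then show ?thesis using that unfolding S_def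
      by (subst (asm) less_cSUP_iff[OF _ bdd]) auto
  qed
  define k where "k = nat (Max (insert 0 (abs ` J0)))"
  have J0k: "J0 \<subseteq> II k"
  proof
    fix n assume "n \<in> J0"
    then have "\<bar>n\<bar> \<le> Max (insert 0 (abs ` J0))" using J0(1) by (intro Max_ge) auto
    then show "n \<in> II k" by (auto simp: II_def k_def)
  qed
  have "hb s (\<lambda>n. a n - restr (II k) a n) \<epsilon>"
    unfolding hb_def
  proof (intro allI impI)
    fix K :: "int set" assume K: "finite K"
    have "en K s (\<lambda>n. a n - restr (II k) a n) = en (K - II k) s (\<lambda>n. a n - restr (II k) a n)"
      unfolding en_def using K by (intro sum.mono_neutral_right) (auto simp: restr_def)
    also have "\<dots> = en (K - II k) s a"
      unfolding en_def by (intro sum.cong) (auto simp: restr_def)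
    finally have e: "en K s (\<lambda>n. a n - restr (II k) a n) = en (K - II k) s a" .
    have "en J0 s a + en (K - II k) s a = en (J0 \<union> (K - II k)) s a"
      unfolding en_def using J0 K J0k by (intro sum.union_disjoint[symmetric]) auto
    also have "\<dots> \<le> S" using J0 K by (intro ub) auto
    finally show "en K s (\<lambda>n. a n - restr (II k) a n) \<le> \<epsilon>" using J0(2) e by simp
  qed
  then show ?thesis by blast
qed

lemma cub_cong: "(\<And>n. n \<in> J \<Longrightarrow> a n = b n) \<Longrightarrow> cub J a n = cub J b n"
  unfolding cub_def by (intro sum.cong refl) auto

lemma cub_eq_Nl: "finite J \<Longrightarrow> cub J a n = Nl (restr J a) n"
  using Nl_finite[of J "restr J a" n] cub_cong[of J a "restr J a" n] by (simp add: restr_def)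

section \<open>Convergence of the truncations to a flow\<close>

context cgl
begin

lemma gal_Nl: "gal L J v \<Longrightarrow> cub J (v t) n = Nl (v t) n"
  using Nl_finite[of J "v t" n] by (simp add: gal_def)

lemma gal_hb:
  assumes "gal L J v" "en J s (v t) \<le> B"
  shows "hb s (v t) B"
  using assms by (intro hb_support[of J]) (auto simp: gal_def)

text \<open>The first summand is the Gronwall bound with the residual 3 \<rho>^2 d l: \<rho> bounds
  u in l^1, d its tail, and l the weighted difference. The tail gains the power 1/4 on passing from
  H^1 to H^(3/4). The second summand is the H^s tail of u at the final time; the factors 2 come from
  \<open>hb_triangle\<close>.\<close>

definition Psi :: "real \<Rightarrow> real \<Rightarrow> real \<Rightarrow> nat \<Rightarrow> real" where
  "Psi s R T M = 2 * (exp (Kc s R * T) * (2 * (1 + \<bar>\<omega>\<bar>) *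
      (3 * (sqrt (zc * R))\<^sup>2 * sqrt (zc * (R / ((real M)\<^sup>2 + 1) powr (1/4))) * sqrt (zc * (2 * R + 2 * R)))))
    + 2 * (R / ((real M)\<^sup>2 + 1) powr (s + 1))"

lemma Psi_tendsto: "0 \<le> s \<Longrightarrow> Psi s R T \<longlonglongrightarrow> 0"
proof -
  assume s: "0 \<le> s"
  have inf: "filterlim (\<lambda>M. (real M)\<^sup>2 + 1) at_top sequentially"
  proof (rule filterlim_at_top_mono[OF filterlim_real_sequentially], rule always_eventually, rule allI)
    show "real M \<le> (real M)\<^sup>2 + 1" for M
      using zero_le_power2[of "real M - 1"] unfolding power2_diff by simp
  qed
  have q: "(\<lambda>M. R / ((real M)\<^sup>2 + 1) powr p) \<longlonglongrightarrow> 0" if "0 < p" for p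
  proof -
    have "(\<lambda>M. R * ((real M)\<^sup>2 + 1) powr (- p)) \<longlonglongrightarrow> R * 0"
      using that by (intro tendsto_intros tendsto_neg_powr inf) auto
    then show ?thesis by (simp add: powr_minus divide_inverse)
  qed
  have "(\<lambda>M. 2 * (exp (Kc s R * T) * (2 * (1 + \<bar>\<omega>\<bar>) *
      (3 * (sqrt (zc * R))\<^sup>2 * sqrt (zc * (R / ((real M)\<^sup>2 + 1) powr (1/4))) * sqrt (zc * (2 * R + 2 * R)))))
    + 2 * (R / ((real M)\<^sup>2 + 1) powr (s + 1))) \<longlonglongrightarrow>
     2 * (exp (Kc s R * T) * (2 * (1 + \<bar>\<omega>\<bar>) *
      (3 * (sqrt (zc * R))\<^sup>2 * sqrt (zc * 0) * sqrt (zc * (2 * R + 2 * R))))) + 2 * 0"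
    using s by (intro tendsto_intros q) auto
  then show ?thesis unfolding Psi_def[abs_def] by simp
qed

lemma Psi_mono:
  assumes "0 \<le> R" "t \<le> T"
  shows "Psi s R t M \<le> Psi s R T M"
  unfolding Psi_def using assms Kc_ge_1[OF assms(1), of s] zc_nonneg
  by (intro add_right_mono mult_left_mono mult_right_mono) (auto intro!: mult_nonneg_nonneg divide_nonneg_nonneg)

text \<open>The modes of \<open>u\<close> in \<open>II M\<close> solve the truncated system up to
  the effect of the tail on the nonlinearity. In this residual the whole weight
  \<open>jw n powr s\<close> stands at u - v, measured in l^1, which takes regularity 2s + 3/4 and
  explains the H^(2s+1) bounds. It is applied to a larger truncation and to a given
  solution.\<close>

lemma gal_approx:
  assumes v: "gal L (II M) v" and s: "0 \<le> s" and T: "0 \<le> T"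
    and uc: "\<And>n. continuous_on {0..T} (\<lambda>t. u t n)"
    and ud: "\<And>n t. n \<in> II M \<Longrightarrow> 0 < t \<Longrightarrow> t < T \<Longrightarrow>
        ((\<lambda>t. u t n) has_vector_derivative (lin L n * u t n - nu * Nl (u t) n)) (at t)"
    and R: "\<And>t. 0 \<le> t \<Longrightarrow> t \<le> T \<Longrightarrow> hb (2 * s + 1) (u t) R" "\<And>t. 0 \<le> t \<Longrightarrow> t \<le> T \<Longrightarrow> hb (2 * s + 1) (v t) R"
    and ini: "\<And>n. n \<in> II M \<Longrightarrow> u 0 n = v 0 n"
  shows "hb s (\<lambda>n. u T n - v T n) (Psi s R T M)"
proof -
  define \<rho> where "\<rho> = sqrt (zc * R)"
  define d where "d = sqrt (zc * (R / ((real M)\<^sup>2 + 1) powr (1/4)))"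
  define l where "l = sqrt (zc * (2 * R + 2 * R))"
  have R0: "0 \<le> R" using R(1)[of 0] T hb_nonneg by auto
  have nn: "0 \<le> d" "0 \<le> l" using R0 zc_nonneg by (auto simp: d_def l_def)
  have "en (II M) s (\<lambda>n. u T n - v T n) \<le> exp (Kc s R * T) * (en (II M) s (\<lambda>n. u 0 n - v 0 n) + 2 * (1 + \<bar>\<omega>\<bar>) * (3 * \<rho>\<^sup>2 * d * l))"
  proof (rule comparison[OF v s T uc ud])
    fix t assume t: "0 < t" "t < T"
    note h = R(1)[of t] R(2)[of t]
    have u1: "hb 1 (u t) R" using h(1) by (rule hb_mono) (use t s in auto)
    have pt: "cmod (Nl (u t) n - cub (II M) (u t) n) \<le> 3 * \<rho>\<^sup>2 * d" for n
      unfolding cub_eq_Nl[OF finite_II]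
    proof (rule Nl_lipschitz)
      show "lb (u t) \<rho>" unfolding \<rho>_def by (rule hb_lb[OF hb_mono[OF u1]]) simp
      show "lb (restr (II M) (u t)) \<rho>" unfolding \<rho>_def by (rule hb_lb[OF hb_restr[OF hb_mono[OF u1]]]) simp
      show "lb (\<lambda>n. u t n - restr (II M) (u t) n) d"
        unfolding d_def using hb_tail[OF u1, of "3/4" M] by (intro hb_lb) simp
    qed
    have "(\<Sum>n\<in>II M. jw n powr (2 * s / 2) * cmod (u t n - v t n))\<^sup>2 \<le> zc * en (II M) (2 * s + 3/4) (\<lambda>n. u t n - v t n)"
      by (rule l1_le_en) simp
    also have "\<dots> \<le> zc * (2 * R + 2 * R)"
    proof (rule mult_left_mono[OF _ zc_nonneg])
      have "hb (2 * s + 1) (\<lambda>n. u t n - v t n) (2 * R + 2 * R)" using h t by (intro hb_diff) auto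
      then show "en (II M) (2 * s + 3/4) (\<lambda>n. u t n - v t n) \<le> 2 * R + 2 * R"
        by (intro hb_en[OF hb_mono]) auto
    qed
    finally have sm: "(\<Sum>n\<in>II M. jw n powr s * cmod (u t n - v t n)) \<le> l"
      unfolding l_def by (intro real_le_rsqrt) simp
    have "(\<Sum>n\<in>II M. jw n powr s * cmod (u t n - v t n) * cmod (Nl (u t) n - cub (II M) (u t) n))
        \<le> (\<Sum>n\<in>II M. jw n powr s * cmod (u t n - v t n) * (3 * \<rho>\<^sup>2 * d))"
      by (intro sum_mono mult_left_mono pt) auto
    also have "\<dots> = (\<Sum>n\<in>II M. jw n powr s * cmod (u t n - v t n)) * (3 * \<rho>\<^sup>2 * d)"
      by (simp add: sum_distrib_right)
    also have "\<dots> \<le> l * (3 * \<rho>\<^sup>2 * d)" using nn by (intro mult_right_mono sm) auto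
    finally show "(\<Sum>n\<in>II M. jw n powr s * cmod (u t n - v t n) * cmod (Nl (u t) n - cub (II M) (u t) n)) \<le> 3 * \<rho>\<^sup>2 * d * l"
      by (simp add: mult_ac)
    show "en (II M) s (u t) \<le> R" using h(1) t s by (intro hb_en[OF hb_mono]) auto
    show "en (II M) s (v t) \<le> R" using h(2) t s by (intro hb_en[OF hb_mono]) auto
  qed (use nn R0 in auto)
  moreover have "en (II M) s (\<lambda>n. u 0 n - v 0 n) = 0"
    unfolding en_def using ini by (intro sum.neutral) auto
  ultimately have 1: "en (II M) s (\<lambda>n. u T n - v T n) \<le> exp (Kc s R * T) * (2 * (1 + \<bar>\<omega>\<bar>) * (3 * \<rho>\<^sup>2 * d * l))"
    by simp
  have v0: "v T n = 0" if "n \<notin> II M" for n using v that by (simp add: gal_def)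
  have "hb s (\<lambda>n. restr (II M) (u T) n - v T n) (exp (Kc s R * T) * (2 * (1 + \<bar>\<omega>\<bar>) * (3 * \<rho>\<^sup>2 * d * l)))"
  proof (rule hb_support[of "II M"])
    have "en (II M) s (\<lambda>n. restr (II M) (u T) n - v T n) = en (II M) s (\<lambda>n. u T n - v T n)"
      unfolding en_def by (intro sum.cong refl) (simp add: restr_def)
    then show "en (II M) s (\<lambda>n. restr (II M) (u T) n - v T n) \<le> exp (Kc s R * T) * (2 * (1 + \<bar>\<omega>\<bar>) * (3 * \<rho>\<^sup>2 * d * l))"
      using 1 by simp
  qed (auto simp: restr_def v0)
  moreover have "hb s (\<lambda>n. u T n - restr (II M) (u T) n) (R / ((real M)\<^sup>2 + 1) powr (s + 1))"
    using hb_tail[OF R(1)[OF T order_refl], of s M] s by simp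
  ultimately have "hb s (\<lambda>n. u T n - v T n) (2 * (R / ((real M)\<^sup>2 + 1) powr (s + 1)) + 2 * (exp (Kc s R * T) * (2 * (1 + \<bar>\<omega>\<bar>) * (3 * \<rho>\<^sup>2 * d * l))))"
    by (intro hb_triangle)
  then show ?thesis by (simp add: Psi_def \<rho>_def d_def l_def add.commute)
qed

definition gl :: "real \<Rightarrow> (int \<Rightarrow> complex) \<Rightarrow> nat \<Rightarrow> real \<Rightarrow> int \<Rightarrow> complex" where
  "gl L a M = (SOME v. gal L (II M) v \<and> (\<forall>n\<in>II M. v 0 n = a n))"

lemma gl_gal: "gal L (II M) (gl L a M)"
  and gl_0: "n \<in> II M \<Longrightarrow> gl L a M 0 n = a n"
  using someI_ex[OF gal_exists[OF finite_II[of M], of L a]] unfolding gl_def by auto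

lemma gl_support: "n \<notin> II M \<Longrightarrow> gl L a M t n = 0"
  using gl_gal[of L M a] unfolding gal_def by blast

lemma en_gl_0: "en (II M) s (gl L a M 0) = en (II M) s a"
  unfolding en_def by (intro sum.cong refl) (simp add: gl_0)

lemma gl_bound:
  assumes "hb s a x" "0 \<le> s" "0 \<le> t"
  shows "hb s (gl L a M t) (x + Gs s (x + C0))"
  by (rule gal_hb[OF gl_gal], rule gal_en_bound[OF gl_gal assms(2,3)])
     (simp add: en_gl_0 hb_en[OF assms(1)])

lemma gl_lipschitz:
  assumes a: "hb s a x" and b: "hb s b x" and ab: "hb s (\<lambda>n. a n - b n) D" and s: "0 \<le> s" and t: "0 \<le> t"
  shows "hb s (\<lambda>n. gl L a M t n - gl L b M t n) (exp (Kc s (x + Gs s (x + C0)) * t) * D)"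
proof (rule hb_support[of "II M"])
  have "en (II M) s (\<lambda>n. gl L a M t n - gl L b M t n) \<le> exp (Kc s (x + Gs s (x + C0)) * t) * en (II M) s (\<lambda>n. gl L a M 0 n - gl L b M 0 n)"
    by (rule gal_lipschitz[OF gl_gal gl_gal s t]) (simp_all add: en_gl_0 hb_en[OF a] hb_en[OF b])
  also have "en (II M) s (\<lambda>n. gl L a M 0 n - gl L b M 0 n) = en (II M) s (\<lambda>n. a n - b n)"
    unfolding en_def by (intro sum.cong refl) (simp add: gl_0)
  also have "exp (Kc s (x + Gs s (x + C0)) * t) * \<dots> \<le> exp (Kc s (x + Gs s (x + C0)) * t) * D"
    by (intro mult_left_mono hb_en[OF ab]) auto
  finally show "en (II M) s (\<lambda>n. gl L a M t n - gl L b M t n) \<le> exp (Kc s (x + Gs s (x + C0)) * t) * D" .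
qed (simp_all add: gl_support)

text \<open>Finitely many modes lie in H^(2s+1), uniformly bounded along all truncations; the larger
  truncation plays the exact solution.\<close>

lemma gl_cauchy_smooth:
  assumes s: "0 \<le> s" and b: "\<And>n. n \<notin> II k \<Longrightarrow> b n = 0" and \<epsilon>: "0 < \<epsilon>"
  shows "\<exists>M0. \<forall>M\<ge>M0. \<forall>M'\<ge>M. \<forall>t. 0 \<le> t \<and> t \<le> T \<longrightarrow> hb s (\<lambda>n. gl L b M' t n - gl L b M t n) \<epsilon>"
proof -
  define y where "y = en (II k) (2 * s + 1) b"
  define R where "R = y + Gs (2 * s + 1) (y + C0)"
  have hb: "hb (2 * s + 1) b y" unfolding y_def using b by (intro hb_support[of "II k"]) auto
  have R: "hb (2 * s + 1) (gl L b M t) R" if "0 \<le> t" for M t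
    unfolding R_def using s that by (intro gl_bound[OF hb]) auto
  have R0: "0 \<le> R" using hb_nonneg[OF R[of 0]] by simp
  obtain M0 where M0: "\<And>M. M0 \<le> M \<Longrightarrow> \<bar>Psi s R T M\<bar> < \<epsilon>"
    using LIMSEQ_D[OF Psi_tendsto[OF s] \<epsilon>, of R T] by auto
  show ?thesis
  proof (intro exI[of _ M0] allI impI)
    fix M M' t assume M: "M0 \<le> M" "M \<le> M'" and t: "0 \<le> t \<and> t \<le> T"
    have "hb s (\<lambda>n. gl L b M' t n - gl L b M t n) (Psi s R t M)"
    proof (rule gal_approx[OF gl_gal s])
      show "continuous_on {0..t} (\<lambda>t. gl L b M' t n)" for n
        by (rule continuous_on_subset[OF gal_continuous[OF gl_gal]]) auto
      fix n :: int and u :: real assume n: "n \<in> II M" and u: "0 < u"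
      show "((\<lambda>t. gl L b M' t n) has_vector_derivative (lin L n * gl L b M' u n - nu * Nl (gl L b M' u) n)) (at u)"
        using gal_deriv[OF gl_gal, of n M' u L b] n u II_mono[OF M(2)] by (auto simp: gal_Nl[OF gl_gal])
    next
      fix n assume "n \<in> II M"
      then show "gl L b M' 0 n = gl L b M 0 n" using II_mono[OF M(2)] by (auto simp: gl_0)
    qed (use t R in auto)
    moreover have "Psi s R t M \<le> \<epsilon>" using Psi_mono[OF R0, of t T s M] M0[OF M(1)] t by linarith
    ultimately show "hb s (\<lambda>n. gl L b M' t n - gl L b M t n) \<epsilon>" by (rule hb_le)
  qed
qed

text \<open>A density argument: the Lipschitz constant does not depend on the truncation, so
  replacing the data by finitely many of their modes moves all truncations by the same small
  amount.\<close>

lemma gl_cauchy: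
  assumes s: "0 \<le> s" and a: "hb s a x" and \<epsilon>: "0 < \<epsilon>"
  shows "\<exists>M0. \<forall>M\<ge>M0. \<forall>M'\<ge>M. \<forall>t. 0 \<le> t \<and> t \<le> T \<longrightarrow> hb s (\<lambda>n. gl L a M' t n - gl L a M t n) \<epsilon>"
proof -
  define E where "E = exp (Kc s (x + Gs s (x + C0)) * T)"
  have E: "0 < E" by (simp add: E_def)
  have x0: "0 \<le> x + Gs s (x + C0)" using hb_nonneg[OF a] C0_pos by (intro add_nonneg_nonneg Gs_nonneg) auto
  \<comment> \<open>The fractions fit two uses of \<open>hb_triangle\<close>, which doubles: 2/12 +
    2 (2/8 + 2/12) = 1.\<close>
  obtain k where k: "hb s (\<lambda>n. a n - restr (II k) a n) (\<epsilon> / (12 * E))"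
    using hb_tail_small[OF a, of "\<epsilon> / (12 * E)"] \<epsilon> E by auto
  define b where "b = restr (II k) a"
  have "\<And>n. n \<notin> II k \<Longrightarrow> b n = 0" by (simp add: b_def restr_def)
  with gl_cauchy_smooth[OF s, of k b "\<epsilon> / 8" T L]
  obtain M0 where "\<forall>M\<ge>M0. \<forall>M'\<ge>M. \<forall>t. 0 \<le> t \<and> t \<le> T \<longrightarrow> hb s (\<lambda>n. gl L b M' t n - gl L b M t n) (\<epsilon> / 8)"
    using \<epsilon> by auto
  then have M0: "hb s (\<lambda>n. gl L b M' t n - gl L b M t n) (\<epsilon> / 8)" if "M0 \<le> M" "M \<le> M'" "0 \<le> t" "t \<le> T" for M M' t
    using that by blast
  have ab: "hb s (\<lambda>n. gl L a M t n - gl L b M t n) (\<epsilon> / 12)" if t: "0 \<le> t" "t \<le> T" for M t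
  proof (rule hb_le)
    show "hb s (\<lambda>n. gl L a M t n - gl L b M t n) (exp (Kc s (x + Gs s (x + C0)) * t) * (\<epsilon> / (12 * E)))"
      by (rule gl_lipschitz[OF a _ _ s t(1)]) (auto simp: b_def k hb_restr[OF a])
    have "exp (Kc s (x + Gs s (x + C0)) * t) \<le> E"
      unfolding E_def using Kc_ge_1[OF x0, of s] t by (auto intro!: mult_left_mono)
    then have "exp (Kc s (x + Gs s (x + C0)) * t) * (\<epsilon> / (12 * E)) \<le> E * (\<epsilon> / (12 * E))"
      using E \<epsilon> by (intro mult_right_mono) auto
    then show "exp (Kc s (x + Gs s (x + C0)) * t) * (\<epsilon> / (12 * E)) \<le> \<epsilon> / 12" using E by simp
  qed
  show ?thesis
  proof (intro exI[of _ M0] allI impI)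
    fix M M' t assume M: "M0 \<le> M" "M \<le> M'" and t: "0 \<le> t \<and> t \<le> T"
    have ab': "hb s (\<lambda>n. gl L a M t n - gl L b M t n) (\<epsilon> / 12)" for M using t by (intro ab) auto
    have "hb s (\<lambda>n. gl L b M' t n - gl L b M t n) (\<epsilon> / 8)" using t M by (intro M0) auto
    from hb_triangle[OF ab' hb_triangle[OF this hb_commute[OF ab']]]
    show "hb s (\<lambda>n. gl L a M' t n - gl L a M t n) \<epsilon>" by (rule hb_le) simp
  qed
qed

definition flow :: "real \<Rightarrow> (int \<Rightarrow> complex) \<Rightarrow> real \<Rightarrow> int \<Rightarrow> complex" where
  "flow L a t n = lim (\<lambda>M. gl L a M t n)"

lemma flow_tendsto:
  assumes a: "hb 0 a x" and t: "0 \<le> t"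
  shows "(\<lambda>M. gl L a M t n) \<longlonglongrightarrow> flow L a t n"
proof -
  have "Cauchy (\<lambda>M. gl L a M t n)"
  proof (rule CauchyI')
    fix e :: real assume e: "0 < e"
    then have "0 < (e/2)\<^sup>2" by simp
    from gl_cauchy[OF order_refl a this, of t L]
    obtain M0 where "\<forall>M\<ge>M0. \<forall>M'\<ge>M. \<forall>u. 0 \<le> u \<and> u \<le> t \<longrightarrow> hb 0 (\<lambda>n. gl L a M' u n - gl L a M u n) ((e/2)\<^sup>2)"
      by blast
    then have M0: "hb 0 (\<lambda>n. gl L a M' t n - gl L a M t n) ((e/2)\<^sup>2)" if "M0 \<le> M" "M \<le> M'" for M M'
      using that t by blast
    have "dist (gl L a M t n) (gl L a M' t n) < e" if "M0 \<le> M" "M < M'" for M M'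
    proof -
      have "(cmod (gl L a M' t n - gl L a M t n))\<^sup>2 \<le> (e/2)\<^sup>2"
        by (rule hb_pointwise[OF M0]) (use that in auto)
      then have "cmod (gl L a M' t n - gl L a M t n) \<le> e/2" by (rule power2_le_imp_le) (use e in simp)
      then show ?thesis using e by (simp add: dist_norm norm_minus_commute)
    qed
    then show "\<exists>M0. \<forall>M\<ge>M0. \<forall>M'>M. dist (gl L a M t n) (gl L a M' t n) < e"
      by (intro exI[of _ M0] allI impI)
  qed
  then show ?thesis unfolding flow_def by (simp only: Cauchy_convergent_iff convergent_LIMSEQ_iff)
qed

theorem flow_uniform:
  assumes s: "0 \<le> s" and a: "hb s a x" and \<epsilon>: "0 < \<epsilon>"
  shows "\<exists>M0. \<forall>M\<ge>M0. \<forall>t. 0 \<le> t \<and> t \<le> T \<longrightarrow> hb s (\<lambda>n. flow L a t n - gl L a M t n) \<epsilon>"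
proof -
  from gl_cauchy[OF s a \<epsilon>, of T L]
  obtain M0 where "\<forall>M\<ge>M0. \<forall>M'\<ge>M. \<forall>t. 0 \<le> t \<and> t \<le> T \<longrightarrow> hb s (\<lambda>n. gl L a M' t n - gl L a M t n) \<epsilon>"
    by blast
  then have M0: "hb s (\<lambda>n. gl L a M' t n - gl L a M t n) \<epsilon>" if "M0 \<le> M" "M \<le> M'" "0 \<le> t" "t \<le> T" for M M' t
    using that by blast
  show ?thesis
  proof (intro exI[of _ M0] allI impI)
    fix M t assume M: "M0 \<le> M" and t: "0 \<le> t \<and> t \<le> T"
    show "hb s (\<lambda>n. flow L a t n - gl L a M t n) \<epsilon>"
    proof (rule hb_limit)
      show "(\<lambda>M'. gl L a M' t n - gl L a M t n) \<longlonglongrightarrow> flow L a t n - gl L a M t n" for n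
        using t by (intro tendsto_intros flow_tendsto[OF hb_mono[OF a s]]) auto
      show "\<forall>\<^sub>F M' in sequentially. hb s (\<lambda>n. gl L a M' t n - gl L a M t n) \<epsilon>"
        using M t by (intro eventually_sequentiallyI[of M] M0) auto
    qed
  qed
qed

lemma flow_bound_limit:
  assumes "hb 0 a x" "0 \<le> t" "\<And>M. hb s (gl L a M t) B"
  shows "hb s (flow L a t) B"
  by (rule hb_limit[OF flow_tendsto[OF assms(1,2)]]) (simp add: assms(3))

lemma flow_bound:
  assumes "hb s a x" "0 \<le> s" "0 \<le> t"
  shows "hb s (flow L a t) (x + Gs s (x + C0))"
  by (rule flow_bound_limit[OF hb_mono[OF assms(1,2)] assms(3)] gl_bound[OF assms])+

lemma flow_dissipative:
  assumes "hb s a x" "0 \<le> s" "0 \<le> t"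
  shows "hb s (flow L a t) (exp (- t) * Qd s x + Gs s (1 + C0))"
  by (rule flow_bound_limit[OF hb_mono[OF assms(1,2)] assms(3)], rule gal_hb[OF gl_gal], rule gal_dissipative[OF gl_gal assms(2,3)])
     (simp add: en_gl_0 hb_en[OF assms(1)])

lemma gl_smoothing:
  assumes "hb 0 a x" "0 \<le> s" "0 < t"
  shows "hb s (gl L a M t) (2 * Sm s x * (1 + t powr (- s)))"
  by (rule gal_hb[OF gl_gal], rule gal_smoothing[OF gl_gal assms(2,3)])
     (simp add: en_gl_0 hb_en[OF assms(1)])

lemma flow_smoothing:
  assumes "hb 0 a x" "0 \<le> s" "0 < t"
  shows "hb s (flow L a t) (2 * Sm s x * (1 + t powr (- s)))"
  by (rule flow_bound_limit[OF assms(1)]) (use assms gl_smoothing in auto)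

lemma flow_lipschitz:
  assumes a: "hb s a x" and b: "hb s b x" and ab: "hb s (\<lambda>n. a n - b n) D" and s: "0 \<le> s" and t: "0 \<le> t"
  shows "hb s (\<lambda>n. flow L a t n - flow L b t n) (exp (Kc s (x + Gs s (x + C0)) * t) * D)"
proof (rule hb_limit[where a = "\<lambda>M n. gl L a M t n - gl L b M t n"])
  show "(\<lambda>M. gl L a M t n - gl L b M t n) \<longlonglongrightarrow> flow L a t n - flow L b t n" for n
    by (intro tendsto_diff flow_tendsto[OF hb_mono[OF a s] t] flow_tendsto[OF hb_mono[OF b s] t])
qed (intro always_eventually allI gl_lipschitz[OF a b ab s t])

lemma flow_0:
  assumes "hb 0 a x"
  shows "flow L a 0 n = a n"
proof -
  have "\<forall>\<^sub>F M in sequentially. gl L a M 0 n = a n"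
    using eventually_ge_at_top[of "nat \<bar>n\<bar>"] by eventually_elim (auto intro!: gl_0 simp: II_def)
  then have "(\<lambda>M. gl L a M 0 n) \<longlonglongrightarrow> a n" by (rule tendsto_eventually)
  then show ?thesis by (rule LIMSEQ_unique[OF flow_tendsto[OF assms order_refl]])
qed

lemma gl_continuous_hb:
  assumes t: "0 \<le> t" and \<epsilon>: "0 < \<epsilon>"
  shows "\<forall>\<^sub>F \<tau> in at t within {0..}. hb s (\<lambda>n. gl L a M \<tau> n - gl L a M t n) \<epsilon>"
proof -
  have "continuous_on {0..} (\<lambda>\<tau>. en (II M) s (\<lambda>n. gl L a M \<tau> n - gl L a M t n))"
    by (rule continuous_on_en, rule continuous_on_diff, rule gal_continuous[OF gl_gal], rule continuous_on_const)
  then have "((\<lambda>\<tau>. en (II M) s (\<lambda>n. gl L a M \<tau> n - gl L a M t n)) \<longlongrightarrow> en (II M) s (\<lambda>n. gl L a M t n - gl L a M t n)) (at t within {0..})"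
    unfolding continuous_on_def by (rule bspec) (use t in simp)
  moreover have "en (II M) s (\<lambda>n. gl L a M t n - gl L a M t n) = 0" by (simp add: en_def)
  ultimately have "\<forall>\<^sub>F \<tau> in at t within {0..}. en (II M) s (\<lambda>n. gl L a M \<tau> n - gl L a M t n) < \<epsilon>"
    using \<epsilon> by (simp add: order_tendstoD(2))
  then show ?thesis
    by eventually_elim (rule hb_support[of "II M"], simp_all add: gl_support)
qed

theorem flow_continuous:
  assumes s: "0 \<le> s" and a: "hb s a x" and t: "0 \<le> t" and \<epsilon>: "0 < \<epsilon>"
  shows "\<forall>\<^sub>F \<tau> in at t within {0..}. hb s (\<lambda>n. flow L a \<tau> n - flow L a t n) \<epsilon>"
proof -
  from flow_uniform[OF s a, of "\<epsilon>/12" "t + 1" L]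
  obtain M where "\<forall>\<tau>. 0 \<le> \<tau> \<and> \<tau> \<le> t + 1 \<longrightarrow> hb s (\<lambda>n. flow L a \<tau> n - gl L a M \<tau> n) (\<epsilon>/12)"
    using \<epsilon> by auto
  then have M: "hb s (\<lambda>n. flow L a \<tau> n - gl L a M \<tau> n) (\<epsilon>/12)" if "0 \<le> \<tau>" "\<tau> \<le> t + 1" for \<tau>
    using that by blast
  have "\<forall>\<^sub>F \<tau> in at t within {0..}. \<tau> < t + 1"
    by (rule order_tendstoD(2)[OF tendsto_ident_at]) simp
  moreover have "\<forall>\<^sub>F \<tau> in at t within {0..}. 0 \<le> \<tau>"
    by (simp add: eventually_at_filter)
  moreover have "\<forall>\<^sub>F \<tau> in at t within {0..}. hb s (\<lambda>n. gl L a M \<tau> n - gl L a M t n) (\<epsilon>/12)"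
    using \<epsilon> by (intro gl_continuous_hb t) auto
  ultimately show ?thesis
  proof eventually_elim
    case (elim \<tau>)
    have "hb s (\<lambda>n. flow L a \<tau> n - gl L a M \<tau> n) (\<epsilon>/12)" "hb s (\<lambda>n. flow L a t n - gl L a M t n) (\<epsilon>/12)"
      using elim t by (auto intro!: M)
    from hb_triangle[OF this(1) hb_triangle[OF elim(3) hb_commute[OF this(2)]]]
    show ?case by (rule hb_le) (use \<epsilon> in simp)
  qed
qed

end

section \<open>Uniqueness\<close>

lemma hb_interp:
  assumes "hb 1 w A" "hb 0 w B" "0 < \<epsilon>"
  shows "hb (3/4) w (\<epsilon> * A + (1/\<epsilon>) powr 3 * B)"
  unfolding hb_def
proof (intro allI impI)
  fix J :: "int set" assume J: "finite J"
  have "en J (3/4) w \<le> \<epsilon> * en J 1 w + (1/\<epsilon>) powr 3 * en J 0 w"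
    using en_interp[of \<epsilon> 0 0 J w] assms(3) by simp
  also have "\<dots> \<le> \<epsilon> * A + (1/\<epsilon>) powr 3 * B"
    using hb_en[OF assms(1) J] hb_en[OF assms(2) J] assms(3) by (intro add_mono mult_left_mono) auto
  finally show "en J (3/4) w \<le> \<epsilon> * A + (1/\<epsilon>) powr 3 * B" .
qed

text \<open>\<epsilon> is taken so small that the H^1 bound contributes at most half of \<eta>; then
  \<delta> is adapted to the large factor this puts in front of the L^2 term.\<close>

lemma hb_interp_small:
  assumes "0 \<le> A" "0 < \<eta>"
  obtains \<delta> where "0 < \<delta>" "\<And>w. hb 1 w A \<Longrightarrow> hb 0 w \<delta> \<Longrightarrow> hb (3/4) w \<eta>"
proof
  define \<epsilon> where "\<epsilon> = \<eta> / (2 * (A + 1))"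
  have e: "0 < \<epsilon>" using assms by (simp add: \<epsilon>_def)
  define p where "p = (1/\<epsilon>) powr 3"
  have p: "0 < p" using e by (simp add: p_def)
  show "0 < \<eta> / (2 * p)" using assms p by simp
  fix w assume "hb 1 w A" "hb 0 w (\<eta> / (2 * p))"
  then have "hb (3/4) w (\<epsilon> * A + (1/\<epsilon>) powr 3 * (\<eta> / (2 * p)))" using e by (intro hb_interp)
  then show "hb (3/4) w \<eta>"
  proof (rule hb_le)
    have "\<epsilon> * A \<le> \<eta> / 2" using assms by (simp add: \<epsilon>_def field_simps)
    moreover have "(1/\<epsilon>) powr 3 * (\<eta> / (2 * p)) = \<eta> / 2" using p by (simp add: p_def[symmetric])
    ultimately show "\<epsilon> * A + (1/\<epsilon>) powr 3 * (\<eta> / (2 * p)) \<le> \<eta>" by linarith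
  qed
qed

text \<open>Closeness is asked in L^2 only, because for L^2 data the truncations converge uniformly
  in L^2 and are merely bounded in H^1 away from time 0. Interpolation upgrades this to H^(3/4),
  hence to l^1.\<close>

lemma Nl_uniformly_continuous:
  assumes "0 \<le> R" "0 < \<eta>"
  obtains \<delta> where "0 < \<delta>" "\<And>a b. hb 1 a R \<Longrightarrow> hb 1 b R \<Longrightarrow> hb 0 (\<lambda>n. a n - b n) \<delta> \<Longrightarrow> cmod (Nl a n - Nl b n) \<le> \<eta>"
proof -
  define \<rho> where "\<rho> = sqrt (zc * R)"
  define q where "q = \<eta> / (3 * \<rho>\<^sup>2 + 1)"
  have c: "0 < 3 * \<rho>\<^sup>2 + 1" by (simp add: add_nonneg_pos)
  have q: "0 < q" using assms c by (simp add: q_def)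
  have z: "0 < zc + 1" using zc_nonneg by simp
  obtain \<delta> where \<delta>: "0 < \<delta>" "\<And>w. hb 1 w (2 * R + 2 * R) \<Longrightarrow> hb 0 w \<delta> \<Longrightarrow> hb (3/4) w (q\<^sup>2 / (zc + 1))"
    using hb_interp_small[of "2 * R + 2 * R" "q\<^sup>2 / (zc + 1)"] assms q z by auto
  show ?thesis
  proof (rule that[OF \<delta>(1)])
    fix a b assume a: "hb 1 a R" and b: "hb 1 b R" and ab: "hb 0 (\<lambda>n. a n - b n) \<delta>"
    have "hb (3/4) (\<lambda>n. a n - b n) (q\<^sup>2 / (zc + 1))"
      by (rule \<delta>(2)[OF hb_diff[OF a b] ab])
    then have "lb (\<lambda>n. a n - b n) (sqrt (zc * (q\<^sup>2 / (zc + 1))))" by (rule hb_lb)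
    moreover have "sqrt (zc * (q\<^sup>2 / (zc + 1))) \<le> q"
    proof (rule real_le_lsqrt)
      have "zc * q\<^sup>2 \<le> (zc + 1) * q\<^sup>2" by (intro mult_right_mono) auto
      then show "zc * (q\<^sup>2 / (zc + 1)) \<le> q\<^sup>2" using z by (simp add: field_simps)
    qed (use q z zc_nonneg in auto)
    ultimately have l: "lb (\<lambda>n. a n - b n) q" by (rule lb_mono)
    have "cmod (Nl a n - Nl b n) \<le> 3 * \<rho>\<^sup>2 * q"
    proof (rule Nl_lipschitz[OF _ _ l])
      show "lb a \<rho>" unfolding \<rho>_def by (rule hb_lb[OF hb_mono[OF a]]) simp
      show "lb b \<rho>" unfolding \<rho>_def by (rule hb_lb[OF hb_mono[OF b]]) simp
    qed
    also have "\<dots> \<le> (3 * \<rho>\<^sup>2 + 1) * q" using q by (intro mult_right_mono) auto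
    also have "\<dots> = \<eta>" using c by (simp add: q_def)
    finally show "cmod (Nl a n - Nl b n) \<le> \<eta>" .
  qed
qed

context cgl
begin

text \<open>Termwise differentiation of the limit on a window around t that stays away from 0:
  smoothing bounds all truncations there in H^1, so the right-hand sides converge uniformly.\<close>

theorem flow_deriv:
  assumes a: "hb 0 a x" and t: "0 < t"
  shows "((\<lambda>\<tau>. flow L a \<tau> n) has_vector_derivative (lin L n * flow L a t n - nu * Nl (flow L a t) n)) (at t)"
proof -
  define S where "S = {t/2<..<2*t}"
  \<comment> \<open>Shifting the truncation index by |n| ensures that mode n belongs to every
    truncation of the sequence.\<close>
  define m where "m = nat \<bar>n\<bar>"
  \<comment> \<open>The smoothing bound for s = 1 at its worst on \<open>S\<close>, where times
    exceed t/2.\<close>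
  define R where "R = 2 * Sm 1 x * (1 + 2 / t)"
  have Sp: "0 < \<tau>" "0 \<le> \<tau>" "\<tau> \<le> 2 * t" if "\<tau> \<in> S" for \<tau> using that t by (auto simp: S_def)
  have Sm: "0 \<le> Sm 1 x"
    unfolding Sm_def using hb_nonneg[OF a] C0_pos by (intro add_nonneg_nonneg mult_nonneg_nonneg Gs_nonneg) auto
  have R0: "0 \<le> R" using Sm t by (simp add: R_def)
  have RS: "2 * Sm 1 x * (1 + \<tau> powr (- 1)) \<le> R" if "\<tau> \<in> S" for \<tau>
  proof -
    have "\<tau> powr (- 1) = 1 / \<tau>" using Sp[OF that] by (simp add: powr_minus_divide)
    also have "\<dots> \<le> 2 / t" using that t by (auto simp: S_def field_simps)
    finally show ?thesis unfolding R_def using Sm by (intro mult_left_mono add_left_mono) auto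
  qed
  have fb: "hb 1 (flow L a \<tau>) R" if "\<tau> \<in> S" for \<tau>
    using hb_le[OF flow_smoothing[OF a _ Sp(1)[OF that]] RS[OF that]] by simp
  have gb: "hb 1 (gl L a M \<tau>) R" if "\<tau> \<in> S" for \<tau> M
    using hb_le[OF gl_smoothing[OF a _ Sp(1)[OF that]] RS[OF that]] by simp
  define f where "f k \<tau> = gl L a (k + m) \<tau> n" for k \<tau>
  define D where "D k \<tau> = lin L n * gl L a (k + m) \<tau> n - nu * Nl (gl L a (k + m) \<tau>) n" for k \<tau>
  define g' where "g' \<tau> = lin L n * flow L a \<tau> n - nu * Nl (flow L a \<tau>) n" for \<tau>
  have nI: "n \<in> II (k + m)" for k by (auto simp: II_def m_def)
  have "\<exists>g. \<forall>\<tau>\<in>S. (\<lambda>k. f k \<tau>) \<longlonglongrightarrow> g \<tau> \<and> (g has_derivative (\<lambda>h. h *\<^sub>R g' \<tau>)) (at \<tau> within S)"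
  proof (rule has_derivative_sequence)
    show "convex S" by (simp add: S_def)
    show "t \<in> S" using t by (simp add: S_def)
    show "(\<lambda>k. f k t) \<longlonglongrightarrow> flow L a t n"
      unfolding f_def using flow_tendsto[OF a less_imp_le[OF t]] by (rule LIMSEQ_ignore_initial_segment)
    fix k \<tau> assume \<tau>: "\<tau> \<in> S"
    have "(f k has_vector_derivative D k \<tau>) (at \<tau>)"
      using gal_deriv[OF gl_gal nI Sp(1)[OF \<tau>], of L a k] unfolding f_def D_def gal_Nl[OF gl_gal] .
    then show "(f k has_derivative (\<lambda>h. h *\<^sub>R D k \<tau>)) (at \<tau> within S)"
      unfolding has_vector_derivative_def by (rule has_derivative_at_withinI)
  next
    fix e :: real assume e: "0 < e"
    define c where "c = cmod (lin L n) + cmod nu + 1"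
    have c: "0 < c" by (simp add: c_def add_nonneg_pos)
    define e' where "e' = e / c"
    have e': "0 < e'" using e c by (simp add: e'_def)
    obtain \<delta> where \<delta>: "0 < \<delta>" "\<And>a b. hb 1 a R \<Longrightarrow> hb 1 b R \<Longrightarrow> hb 0 (\<lambda>n. a n - b n) \<delta> \<Longrightarrow> cmod (Nl a n - Nl b n) \<le> e'"
      by (rule Nl_uniformly_continuous[OF R0 e', of n]) (rule that)
    define \<delta>' where "\<delta>' = min \<delta> (e'\<^sup>2)"
    have \<delta>': "0 < \<delta>'" using \<delta> e' by (simp add: \<delta>'_def)
    from flow_uniform[OF order_refl a \<delta>', of "2 * t" L]
    obtain M0 where M0: "\<forall>M\<ge>M0. \<forall>\<tau>. 0 \<le> \<tau> \<and> \<tau> \<le> 2 * t \<longrightarrow> hb 0 (\<lambda>n. flow L a \<tau> n - gl L a M \<tau> n) \<delta>'" by blast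
    show "\<forall>\<^sub>F k in sequentially. \<forall>\<tau>\<in>S. \<forall>h. norm (h *\<^sub>R D k \<tau> - h *\<^sub>R g' \<tau>) \<le> e * norm h"
      using eventually_ge_at_top[of M0]
    proof eventually_elim
      case (elim k)
      show ?case
      proof (intro ballI allI)
        fix \<tau> h assume \<tau>: "\<tau> \<in> S"
        have "k + m \<ge> M0" using elim by simp
        then have "hb 0 (\<lambda>n. flow L a \<tau> n - gl L a (k + m) \<tau> n) \<delta>'" using M0 Sp[OF \<tau>] by blast
        then have h: "hb 0 (\<lambda>n. gl L a (k + m) \<tau> n - flow L a \<tau> n) \<delta>'" by (rule hb_commute)
        have N: "cmod (Nl (gl L a (k + m) \<tau>) n - Nl (flow L a \<tau>) n) \<le> e'"
          by (rule \<delta>(2)[OF gb[OF \<tau>] fb[OF \<tau>] hb_le[OF h]]) (simp add: \<delta>'_def)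
        have "(cmod (gl L a (k + m) \<tau> n - flow L a \<tau> n))\<^sup>2 \<le> \<delta>'"
          by (rule hb_pointwise[OF h]) simp
        also have "\<dots> \<le> e'\<^sup>2" by (simp add: \<delta>'_def)
        finally have P: "cmod (gl L a (k + m) \<tau> n - flow L a \<tau> n) \<le> e'"
          by (rule power2_le_imp_le) (use e' in simp)
        have "D k \<tau> - g' \<tau> = lin L n * (gl L a (k + m) \<tau> n - flow L a \<tau> n) - nu * (Nl (gl L a (k + m) \<tau>) n - Nl (flow L a \<tau>) n)"
          unfolding D_def g'_def by (simp add: algebra_simps)
        also have "cmod \<dots> \<le> cmod (lin L n) * e' + cmod nu * e'"
        proof (rule order_trans[OF norm_triangle_ineq4], rule add_mono)
          show "cmod (lin L n * (gl L a (k + m) \<tau> n - flow L a \<tau> n)) \<le> cmod (lin L n) * e'"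
            unfolding norm_mult by (rule mult_left_mono[OF P]) simp
          show "cmod (nu * (Nl (gl L a (k + m) \<tau>) n - Nl (flow L a \<tau>) n)) \<le> cmod nu * e'"
            unfolding norm_mult by (rule mult_left_mono[OF N]) simp
        qed
        also have "\<dots> \<le> c * e'" using e' by (simp add: c_def distrib_right)
        also have "\<dots> = e" using c by (simp add: e'_def)
        finally have "cmod (D k \<tau> - g' \<tau>) \<le> e" .
        then have "\<bar>h\<bar> * cmod (D k \<tau> - g' \<tau>) \<le> \<bar>h\<bar> * e" by (intro mult_left_mono) auto
        then show "norm (h *\<^sub>R D k \<tau> - h *\<^sub>R g' \<tau>) \<le> e * norm h"
          unfolding scaleR_diff_right[symmetric] norm_scaleR by (simp add: mult.commute)
      qed
    qed
  qed
  then obtain g where g: "\<And>\<tau>. \<tau> \<in> S \<Longrightarrow> (\<lambda>k. f k \<tau>) \<longlonglongrightarrow> g \<tau>"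
      "\<And>\<tau>. \<tau> \<in> S \<Longrightarrow> (g has_derivative (\<lambda>h. h *\<^sub>R g' \<tau>)) (at \<tau> within S)" by blast
  have gf: "g \<tau> = flow L a \<tau> n" if "\<tau> \<in> S" for \<tau>
  proof (rule LIMSEQ_unique[OF g(1)[OF that]])
    show "(\<lambda>k. f k \<tau>) \<longlonglongrightarrow> flow L a \<tau> n"
      unfolding f_def using flow_tendsto[OF a Sp(2)[OF that]] by (rule LIMSEQ_ignore_initial_segment)
  qed
  have tS: "t \<in> S" "open S" using t by (auto simp: S_def)
  have "(g has_vector_derivative g' t) (at t)"
    using g(2)[OF tS(1)] unfolding has_vector_derivative_def at_within_open[OF tS] .
  then have "((\<lambda>\<tau>. flow L a \<tau> n) has_vector_derivative g' t) (at t)"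
    by (rule has_vector_derivative_transform_within_open[OF _ tS(2,1) gf])
  then show ?thesis by (simp add: g'_def)
qed

text \<open>A solution at the lowest regularity, seen on coefficients. Every
  \<open>cgl_solution\<close> with s \<ge> 0 yields one, so uniqueness is proved once for all
  s.\<close>

definition wsol :: "real \<Rightarrow> (real \<Rightarrow> int \<Rightarrow> complex) \<Rightarrow> bool" where
  "wsol L a \<longleftrightarrow> (\<forall>t\<ge>0. \<exists>B. hb 0 (a t) B) \<and>
    (\<forall>t\<ge>0. \<forall>\<epsilon>>0. \<forall>\<^sub>F \<tau> in at t within {0..}. hb 0 (\<lambda>n. a \<tau> n - a t n) \<epsilon>) \<and>
    (\<forall>t>0. \<exists>B. hb 1 (a t) B) \<and>
    (\<forall>n. \<forall>t>0. ((\<lambda>\<tau>. a \<tau> n) has_vector_derivative (lin L n * a t n - nu * Nl (a t) n)) (at t))"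

lemma wsol_deriv:
  assumes "wsol L a" "0 < t"
  shows "((\<lambda>\<tau>. a \<tau> n) has_vector_derivative (lin L n * a t n - nu * Nl (a t) n)) (at t)"
  using assms by (simp add: wsol_def)

text \<open>Comparison with the truncations started from \<open>a c\<close>; at s = 0 it asks for
  H^1 bounds only. Starting at a positive time lets the equation hold up to the initial
  instant.\<close>

lemma wsol_eq_flow_if_bounded:
  assumes w: "wsol L a" and c: "0 < c" "c \<le> d" and R: "\<And>t. c \<le> t \<Longrightarrow> t \<le> d \<Longrightarrow> hb 1 (a t) R"
  shows "a d n = flow L (a c) (d - c) n"
proof -
  define R1 where "R1 = R + Gs 1 (R + C0)"
  have ac: "hb 1 (a c) R" using R c by simp
  have R0: "0 \<le> R" by (rule hb_nonneg[OF ac])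
  have RR: "R \<le> R1" using R0 C0_pos Gs_nonneg[of "R + C0" 1] by (simp add: R1_def)
  have ac0: "hb 0 (a c) R" by (rule hb_mono[OF ac]) simp
  have der': "((\<lambda>\<tau>. a (c + \<tau>) n) has_vector_derivative (lin L n * a (c + t) n - nu * Nl (a (c + t)) n)) (at t)" if "0 \<le> t" for n t
  proof -
    have 1: "((\<lambda>\<tau>. c + \<tau>) has_vector_derivative (0 + 1)) (at t)"
      by (intro has_vector_derivative_add has_vector_derivative_const has_vector_derivative_id)
    have 2: "((\<lambda>\<tau>. a \<tau> n) has_vector_derivative (lin L n * a (c + t) n - nu * Nl (a (c + t)) n)) (at (c + t))"
      using that c by (intro wsol_deriv[OF w]) auto
    show ?thesis using vector_diff_chain_at[OF 1 2] by (simp add: o_def)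
  qed
  have "hb 0 (\<lambda>n. a (c + (d - c)) n - gl L (a c) M (d - c) n) (Psi 0 R1 (d - c) M)" for M
  proof (rule gal_approx[OF gl_gal, where u = "\<lambda>t. a (c + t)"])
    show "continuous_on {0..d - c} (\<lambda>t. a (c + t) n)" for n
      by (rule continuous_on_vector_derivative[OF has_vector_derivative_at_within[OF der']]) simp
    show "hb (2 * 0 + 1) (a (c + t)) R1" if "0 \<le> t" "t \<le> d - c" for t
      using hb_le[OF R RR, of "c + t"] that by simp
    show "hb (2 * 0 + 1) (gl L (a c) M t) R1" if "0 \<le> t" for t
      using gl_bound[OF ac, of t L M] that by (simp add: R1_def)
    show "((\<lambda>t. a (c + t) n) has_vector_derivative (lin L n * a (c + t) n - nu * Nl (a (c + t)) n)) (at t)" if "0 < t" for n t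
      using that by (intro der') simp
    show "a (c + 0) n = gl L (a c) M 0 n" if "n \<in> II M" for n
      by (simp add: gl_0[OF that])
  qed (use c in auto)
  then have "hb 0 (\<lambda>n. a d n - gl L (a c) M (d - c) n) (Psi 0 R1 (d - c) M)" for M by simp
  from hb_pointwise[OF this order_refl]
  have p: "(cmod (a d n - gl L (a c) M (d - c) n))\<^sup>2 \<le> Psi 0 R1 (d - c) M" for M .
  have "(\<lambda>M. (cmod (a d n - gl L (a c) M (d - c) n))\<^sup>2) \<longlonglongrightarrow> 0"
    by (rule tendsto_sandwich[OF _ _ tendsto_const Psi_tendsto[OF order_refl, of R1 "d - c"]])
       (rule always_eventually, simp, rule always_eventually, rule allI, rule p)
  moreover have "(\<lambda>M. (cmod (a d n - gl L (a c) M (d - c) n))\<^sup>2) \<longlonglongrightarrow> (cmod (a d n - flow L (a c) (d - c) n))\<^sup>2"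
    using c by (intro tendsto_intros flow_tendsto[OF ac0]) auto
  ultimately have "0 = (cmod (a d n - flow L (a c) (d - c) n))\<^sup>2" by (rule LIMSEQ_unique)
  then show ?thesis by simp
qed

section \<open>Times near which the H^1 norm is bounded\<close>

definition locb :: "(real \<Rightarrow> int \<Rightarrow> complex) \<Rightarrow> real set" where
  "locb a = {t. 0 < t \<and> (\<exists>\<delta>>0. \<exists>R. \<forall>\<tau>. \<bar>\<tau> - t\<bar> < \<delta> \<and> 0 < \<tau> \<longrightarrow> hb 1 (a \<tau>) R)}"

lemma open_locb: "open (locb a)"
  unfolding open_dist
proof
  fix t assume "t \<in> locb a"
  then obtain \<delta> R where t: "0 < t" "0 < \<delta>" "\<forall>\<tau>. \<bar>\<tau> - t\<bar> < \<delta> \<and> 0 < \<tau> \<longrightarrow> hb 1 (a \<tau>) R"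
    unfolding locb_def by blast
  show "\<exists>e>0. \<forall>y. dist y t < e \<longrightarrow> y \<in> locb a"
  proof (intro exI[of _ "min t (\<delta>/2)"] conjI allI impI)
    show "0 < min t (\<delta>/2)" using t by simp
    fix y assume y: "dist y t < min t (\<delta>/2)"
    have "\<forall>\<tau>. \<bar>\<tau> - y\<bar> < \<delta>/2 \<and> 0 < \<tau> \<longrightarrow> hb 1 (a \<tau>) R"
    proof (intro allI impI)
      fix \<tau> assume "\<bar>\<tau> - y\<bar> < \<delta>/2 \<and> 0 < \<tau>"
      moreover have "\<bar>y - t\<bar> < \<delta>/2" using y by (simp add: dist_real_def)
      ultimately have "\<bar>\<tau> - t\<bar> < \<delta> \<and> 0 < \<tau>" by linarith
      then show "hb 1 (a \<tau>) R" using t(3) by blast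
    qed
    moreover have "0 < y" using y by (auto simp: dist_real_def)
    moreover have "0 < \<delta>/2" using t(2) by simp
    ultimately show "y \<in> locb a" unfolding locb_def by blast
  qed
qed

text \<open>Compactness by bisection: boundedness passes to the union of adjacent intervals and
  holds on every short interval around a point.\<close>

lemma bounded_on_compact_if_locb:
  assumes "c \<le> d" "{c..d} \<subseteq> locb a"
  shows "\<exists>R. \<forall>\<tau>. c \<le> \<tau> \<and> \<tau> \<le> d \<and> 0 < \<tau> \<longrightarrow> hb 1 (a \<tau>) R"
proof (rule Bolzano[OF assms(1), where P = "\<lambda>c d. \<exists>R. \<forall>\<tau>. c \<le> \<tau> \<and> \<tau> \<le> d \<and> 0 < \<tau> \<longrightarrow> hb 1 (a \<tau>) R"])
  fix x y z
  assume "\<exists>R. \<forall>\<tau>. x \<le> \<tau> \<and> \<tau> \<le> y \<and> 0 < \<tau> \<longrightarrow> hb 1 (a \<tau>) R" "\<exists>R. \<forall>\<tau>. y \<le> \<tau> \<and> \<tau> \<le> z \<and> 0 < \<tau> \<longrightarrow> hb 1 (a \<tau>) R"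
  then obtain R R' where R: "\<forall>\<tau>. x \<le> \<tau> \<and> \<tau> \<le> y \<and> 0 < \<tau> \<longrightarrow> hb 1 (a \<tau>) R" "\<forall>\<tau>. y \<le> \<tau> \<and> \<tau> \<le> z \<and> 0 < \<tau> \<longrightarrow> hb 1 (a \<tau>) R'"
    by blast
  have "hb 1 (a \<tau>) (max R R')" if "x \<le> \<tau>" "\<tau> \<le> z" "0 < \<tau>" for \<tau>
  proof (cases "\<tau> \<le> y")
    case True then show ?thesis using R(1) that hb_le[of 1 "a \<tau>" R "max R R'"] by simp
  next
    case False then show ?thesis using R(2) that hb_le[of 1 "a \<tau>" R' "max R R'"] by simp
  qed
  then show "\<exists>R. \<forall>\<tau>. x \<le> \<tau> \<and> \<tau> \<le> z \<and> 0 < \<tau> \<longrightarrow> hb 1 (a \<tau>) R" by blast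
next
  fix x assume "c \<le> x" "x \<le> d"
  then have "x \<in> locb a" using assms(2) by auto
  then obtain \<delta> R where R: "0 < \<delta>" "\<forall>\<tau>. \<bar>\<tau> - x\<bar> < \<delta> \<and> 0 < \<tau> \<longrightarrow> hb 1 (a \<tau>) R"
    unfolding locb_def by blast
  show "\<exists>\<delta>>0. \<forall>p q. p \<le> x \<and> x \<le> q \<and> q - p < \<delta> \<longrightarrow> (\<exists>R. \<forall>\<tau>. p \<le> \<tau> \<and> \<tau> \<le> q \<and> 0 < \<tau> \<longrightarrow> hb 1 (a \<tau>) R)"
  proof (rule exI[of _ \<delta>], intro conjI allI impI R(1))
    fix p q assume pq: "p \<le> x \<and> x \<le> q \<and> q - p < \<delta>"
    show "\<exists>R. \<forall>\<tau>. p \<le> \<tau> \<and> \<tau> \<le> q \<and> 0 < \<tau> \<longrightarrow> hb 1 (a \<tau>) R"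
    proof (intro exI[of _ R] allI impI)
      fix \<tau> assume "p \<le> \<tau> \<and> \<tau> \<le> q \<and> 0 < \<tau>"
      then have "\<bar>\<tau> - x\<bar> < \<delta> \<and> 0 < \<tau>" using pq by auto
      then show "hb 1 (a \<tau>) R" using R(2) by blast
    qed
  qed
qed

text \<open>The starting time may itself be bad, or 0. The identity is used from slightly later
  times \<tau>, and \<tau> tends to \<open>c\<close>: the solution is continuous in L^2 at
  \<open>c\<close>, and the flow is Lipschitz in the data and continuous in time.\<close>

lemma wsol_eq_flow_if_locb:
  assumes w: "wsol L a" and c: "0 \<le> c" "c < d" and lo: "{c<..d} \<subseteq> locb a"
  shows "a d n = flow L (a c) (d - c) n"
proof -
  obtain B where B: "hb 0 (a c) B" using w c unfolding wsol_def by blast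
  \<comment> \<open>Since \<eta> \<le> 1 below, this bounds \<open>a \<tau>\<close> for \<tau> near
    \<open>c\<close> as well as \<open>a c\<close>, so the Lipschitz constant is fixed before \<tau>
    varies.\<close>
  define x where "x = 2 * 1 + 2 * B"
  have B0: "0 \<le> B" by (rule hb_nonneg[OF B])
  have Bx: "hb 0 (a c) x" by (rule hb_le[OF B]) (use B0 in \<open>simp add: x_def\<close>)
  define K where "K = Kc 0 (x + Gs 0 (x + C0))"
  have K: "0 \<le> K"
    unfolding K_def using B0 C0_pos by (intro order_trans[OF zero_le_one Kc_ge_1] add_nonneg_nonneg Gs_nonneg) (auto simp: x_def)
  define E where "E = exp (K * (d - c))"
  have E: "0 < E" by (simp add: E_def)
  have "(cmod (a d n - flow L (a c) (d - c) n))\<^sup>2 \<le> 0 + \<epsilon>" if \<epsilon>: "0 < \<epsilon>" for \<epsilon>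
  proof -
    define \<eta> where "\<eta> = min 1 (\<epsilon> / (4 * E))"
    have \<eta>: "0 < \<eta>" "\<eta> \<le> 1" "E * \<eta> \<le> \<epsilon> / 4"
      using \<epsilon> E by (auto simp: \<eta>_def min_def field_simps)
    have r1: "\<forall>\<^sub>F \<tau> in at_right c. hb 0 (\<lambda>n. a \<tau> n - a c n) \<eta>"
    proof (rule filter_leD)
      show "at_right c \<le> at c within {0..}" using c by (intro at_le) auto
      show "\<forall>\<^sub>F \<tau> in at c within {0..}. hb 0 (\<lambda>n. a \<tau> n - a c n) \<eta>" using w c \<eta> unfolding wsol_def by blast
    qed
    have r2: "\<forall>\<^sub>F \<tau> in at_right c. hb 0 (\<lambda>n. flow L (a c) (d - \<tau>) n - flow L (a c) (d - c) n) (\<epsilon> / 4)"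
    proof -
      have ev: "\<forall>\<^sub>F \<tau> in at (d - c) within {0..}. hb 0 (\<lambda>n. flow L (a c) \<tau> n - flow L (a c) (d - c) n) (\<epsilon> / 4)"
        using c \<epsilon> by (intro flow_continuous[OF order_refl B]) auto
      have "filterlim (\<lambda>\<tau>. d - \<tau>) (at (d - c) within {0..}) (at_right c)"
        unfolding filterlim_at
      proof
        show "\<forall>\<^sub>F \<tau> in at_right c. d - \<tau> \<in> {0..} \<and> d - \<tau> \<noteq> d - c"
          using eventually_at_right_less[of c] eventually_at_right_real[OF c(2)] by eventually_elim auto
        show "((\<lambda>\<tau>. d - \<tau>) \<longlongrightarrow> d - c) (at_right c)" by (intro tendsto_intros)
      qed
      from filterlim_iff[THEN iffD1, OF this, rule_format, OF ev] show ?thesis .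
    qed
    have "\<forall>\<^sub>F \<tau> in at_right c. (cmod (a d n - flow L (a c) (d - c) n))\<^sup>2 \<le> \<epsilon>"
      using r1 r2 eventually_at_right_real[OF c(2)]
    proof eventually_elim
      case (elim \<tau>)
      have \<tau>: "c < \<tau>" "\<tau> < d" "0 < \<tau>" using elim c by auto
      have "{\<tau>..d} \<subseteq> locb a" using lo \<tau> by auto
      from bounded_on_compact_if_locb[OF less_imp_le[OF \<tau>(2)] this]
      obtain R where R: "\<forall>t. \<tau> \<le> t \<and> t \<le> d \<and> 0 < t \<longrightarrow> hb 1 (a t) R" by blast
      have ad: "a d n = flow L (a \<tau>) (d - \<tau>) n" for n
        by (rule wsol_eq_flow_if_bounded[OF w \<tau>(3) less_imp_le[OF \<tau>(2)]]) (use R \<tau> in auto)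
      have "hb 0 (\<lambda>n. (a \<tau> n - a c n) + a c n) (2 * \<eta> + 2 * B)" by (rule hb_add[OF elim(1) B])
      then have "hb 0 (a \<tau>) (2 * \<eta> + 2 * B)" by simp
      then have "hb 0 (a \<tau>) x" by (rule hb_le) (use \<eta> in \<open>simp add: x_def\<close>)
      from flow_lipschitz[OF this Bx elim(1) order_refl, of "d - \<tau>" L]
      have "hb 0 (\<lambda>n. flow L (a \<tau>) (d - \<tau>) n - flow L (a c) (d - \<tau>) n) (exp (K * (d - \<tau>)) * \<eta>)"
        using \<tau> by (simp add: K_def)
      moreover have "exp (K * (d - \<tau>)) * \<eta> \<le> \<epsilon> / 4"
      proof -
        have "exp (K * (d - \<tau>)) \<le> E" unfolding E_def using K \<tau> by (auto intro!: mult_left_mono)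
        then have "exp (K * (d - \<tau>)) * \<eta> \<le> E * \<eta>" using \<eta> by (intro mult_right_mono) auto
        then show ?thesis using \<eta>(3) by linarith
      qed
      ultimately have "hb 0 (\<lambda>n. a d n - flow L (a c) (d - \<tau>) n) (\<epsilon> / 4)"
        unfolding ad by (rule hb_le)
      from hb_pointwise[OF hb_triangle[OF this elim(2)], of n] show ?case by simp
    qed
    then show ?thesis using eventually_happens[of _ "at_right c"] by (simp add: trivial_limit_at_right_real)
  qed
  from field_le_epsilon[OF this] show ?thesis by simp
qed

text \<open>Membership of \<open>H\<^sup>1\<close> is only assumed pointwise in time. By Baire's theorem the \<open>H\<^sup>1\<close> norm is
  bounded on a relatively open part of the closed set of bad times. The gaps inside that part carry
  flow solutions starting from times with controlled \<open>H\<^sup>1\<close> norm, so these times are not bad.\<close>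

lemma wsol_locb:
  assumes w: "wsol L a"
  shows "{0<..} \<subseteq> locb a"
proof (rule ccontr)
  assume "\<not> {0<..} \<subseteq> locb a"
  then obtain t0 where t0: "0 < t0" "t0 \<notin> locb a" by auto
  \<comment> \<open>Logarithmic time spreads the positive half line over all reals, so that the set
    of bad times becomes a closed subset of the line, to which \<open>Baire\<close> applies.\<close>
  define F where "F = {\<tau>::real. exp \<tau> \<notin> locb a}"
  define E where "E m = {\<tau>::real. hb 1 (a (exp \<tau>)) (real m)}" for m
  have ac: "continuous_on UNIV (\<lambda>\<tau>. a (exp \<tau>) n)" for n
  proof -
    have "((\<lambda>\<tau>. a \<tau> n) has_vector_derivative (lin L n * a t n - nu * Nl (a t) n)) (at t within {0<..})" if "t \<in> {0<..}" for t
      by (rule has_vector_derivative_at_within, rule wsol_deriv[OF w]) (use that in simp)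
    then have "continuous_on {0<..} (\<lambda>t. a t n)" by (rule continuous_on_vector_derivative)
    moreover have "continuous_on UNIV (exp :: real \<Rightarrow> real)" by (rule continuous_on_exp[OF continuous_on_id])
    ultimately show ?thesis by (rule continuous_on_compose2) auto
  qed
  have F: "closed F"
  proof -
    have "open (exp -` locb a :: real set)" by (intro open_vimage open_locb continuous_intros)
    moreover have "F = - (exp -` locb a)" by (auto simp: F_def)
    ultimately show ?thesis by (simp add: closed_Compl)
  qed
  \<comment> \<open>The H^1 norm is not known to be continuous in time, but every finite partial sum
    is, so its sublevel sets are intersections of closed sets.\<close>
  have E: "closed (E m)" for m
  proof -
    have "E m = (\<Inter>J\<in>{J. finite J}. {\<tau>. en J 1 (a (exp \<tau>)) \<le> real m})"
      by (auto simp: E_def hb_def)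
    moreover have "closed {\<tau>. en J 1 (a (exp \<tau>)) \<le> real m}" for J
      by (intro closed_Collect_le continuous_on_en ac continuous_on_const)
    ultimately show ?thesis by auto
  qed
  have EU: "\<exists>m. \<tau> \<in> E m" for \<tau>
  proof -
    obtain B where "hb 1 (a (exp \<tau>)) B" using w exp_gt_zero[of \<tau>] unfolding wsol_def by blast
    moreover obtain m where "B \<le> real m" using real_arch_simple by blast
    ultimately show ?thesis unfolding E_def using hb_le by blast
  qed
  \<comment> \<open>Otherwise all \<open>F - E m\<close> would be relatively open and dense in
    \<open>F\<close>, although they have no common point.\<close>
  have "\<exists>m. \<not> F \<subseteq> closure (F - E m)"
  proof (rule ccontr)
    assume "\<not> ?thesis"
    then have d: "F \<subseteq> closure (F - E m)" for m by blast
    have "F \<subseteq> closure (\<Inter>(range (\<lambda>m. F - E m)))"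
    proof (rule Baire[OF F])
      fix T assume "T \<in> range (\<lambda>m. F - E m)"
      then obtain m where T: "T = F - E m" by blast
      have "openin (top_of_set F) (F \<inter> (- E m))" using E[of m] by (intro openin_open_Int open_Compl)
      then have "openin (top_of_set F) (F - E m)" by (simp only: Diff_eq)
      then show "openin (top_of_set F) T \<and> F \<subseteq> closure T" using d T by simp
    qed simp
    moreover have "\<Inter>(range (\<lambda>m. F - E m)) = {}" using EU by auto
    ultimately have "F \<subseteq> closure {}" by (simp only:)
    then have "F = {}" by simp
    moreover have "ln t0 \<in> F" using t0 by (simp add: F_def)
    ultimately show False by simp
  qed
  then obtain m \<tau>0 where \<tau>0: "\<tau>0 \<in> F" "\<tau>0 \<notin> closure (F - E m)" by blast
  from \<tau>0(2) have "\<exists>r>0. \<forall>y\<in>F - E m. \<not> dist y \<tau>0 < r" unfolding closure_approachable by blast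
  then obtain r where r: "0 < r" "\<forall>y\<in>F - E m. \<not> dist y \<tau>0 < r" by blast
  have good: "hb 1 (a t) (real m)" if "exp (\<tau>0 - r) < t" "t < exp (\<tau>0 + r)" "t \<notin> locb a" for t
  proof -
    have t: "0 < t" using that(1) exp_gt_zero[of "\<tau>0 - r"] by linarith
    have "ln t < \<tau>0 + r" "\<tau>0 - r < ln t"
      using that exp_less_cancel_iff[of "ln t" "\<tau>0 + r"] exp_less_cancel_iff[of "\<tau>0 - r" "ln t"] exp_ln[OF t] by simp_all
    then have "dist (ln t) \<tau>0 < r" by (auto simp: dist_real_def)
    moreover have "ln t \<in> F" using that t by (simp add: F_def)
    ultimately have "ln t \<in> E m" using r(2) by blast
    then show ?thesis using t by (simp add: E_def)
  qed
  \<comment> \<open>Half the radius keeps \<open>p\<close> and \<open>q\<close> strictly inside the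
    interval on which bad times have a uniform bound. As \<open>p\<close> need not be bad, its own
    bound \<open>B\<close> is added to \<open>R\<close>.\<close>
  define p where "p = exp (\<tau>0 - r/2)"
  define q where "q = exp (\<tau>0 + r/2)"
  have pq: "0 < p" "p < exp \<tau>0" "exp \<tau>0 < q" "exp (\<tau>0 - r) < p" "q < exp (\<tau>0 + r)"
    using r(1) by (auto simp: p_def q_def)
  obtain B where B: "hb 1 (a p) B" using w pq(1) unfolding wsol_def by blast
  define R where "R = max B (real m)"
  define R1 where "R1 = R + Gs 1 (R + C0)"
  have R0: "0 \<le> R" by (simp add: R_def)
  have RR: "R \<le> R1" using R0 C0_pos Gs_nonneg[of "R + C0" 1] by (simp add: R1_def)
  have bd: "hb 1 (a t) R1" if t: "p \<le> t" "t \<le> q" for t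
  proof -
    \<comment> \<open>Its maximum is the last bad time up to t, or \<open>p\<close> if there is
      none. Its H^1 norm is controlled in either case, and from there to t the solution follows the
      flow.\<close>
    define Z where "Z = insert p ({p..t} - locb a)"
    have "compact Z" unfolding Z_def by (intro compact_insert compact_diff open_locb) auto
    moreover have "Z \<noteq> {}" by (simp add: Z_def)
    ultimately obtain c where c: "c \<in> Z" "\<And>z. z \<in> Z \<Longrightarrow> z \<le> c" using compact_attains_sup[of Z] by blast
    have cpt: "p \<le> c" "c \<le> t" using c t by (auto simp: Z_def)
    have cR: "hb 1 (a c) R"
    proof (cases "c = p")
      case True then show ?thesis using hb_le[OF B, of R] by (simp add: R_def)
    next
      case False
      then have "c \<notin> locb a" using c by (auto simp: Z_def)
      then have "hb 1 (a c) (real m)" using cpt t pq by (intro good) auto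
      then show ?thesis by (rule hb_le) (simp add: R_def)
    qed
    show ?thesis
    proof (cases "c = t")
      case True then show ?thesis using hb_le[OF cR RR] by simp
    next
      case False
      have "{c<..t} \<subseteq> locb a"
      proof
        fix z assume z: "z \<in> {c<..t}"
        show "z \<in> locb a"
        proof (rule ccontr)
          assume "z \<notin> locb a"
          then have "z \<in> Z" using z cpt by (auto simp: Z_def)
          then show False using c(2)[of z] z by simp
        qed
      qed
      then have "a t = flow L (a c) (t - c)"
        using wsol_eq_flow_if_locb[OF w, of c t] cpt pq False by (intro ext) auto
      then show ?thesis using flow_bound[OF cR, of "t - c" L] cpt by (simp add: R1_def)
    qed
  qed
  define \<delta> where "\<delta> = min (exp \<tau>0 - p) (q - exp \<tau>0)"
  have "0 < \<delta>" using pq by (simp add: \<delta>_def)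
  moreover have "\<forall>\<tau>. \<bar>\<tau> - exp \<tau>0\<bar> < \<delta> \<and> 0 < \<tau> \<longrightarrow> hb 1 (a \<tau>) R1"
  proof (intro allI impI)
    fix \<tau> assume "\<bar>\<tau> - exp \<tau>0\<bar> < \<delta> \<and> 0 < \<tau>"
    then show "hb 1 (a \<tau>) R1" by (intro bd) (auto simp: \<delta>_def)
  qed
  ultimately have "exp \<tau>0 \<in> locb a" unfolding locb_def using exp_gt_zero[of \<tau>0] by blast
  then show False using \<tau>0(1) by (simp add: F_def)
qed

theorem wsol_unique:
  assumes w: "wsol L a" and t: "0 \<le> t"
  shows "a t n = flow L (a 0) t n"
proof (cases "t = 0")
  case True
  obtain B where "hb 0 (a 0) B" using w unfolding wsol_def by blast
  then show ?thesis using True by (simp add: flow_0)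
next
  case False
  have "{0<..t} \<subseteq> locb a" using wsol_locb[OF w] by auto
  then show ?thesis
    using wsol_eq_flow_if_locb[OF w order_refl, of t n] t False by simp
qed

end

section \<open>From coefficients to functions\<close>

lemma hs_sum_eq_en: "(\<Sum>n\<in>J. (real_of_int (n\<^sup>2) + 1) powr s * (cmod (a n))\<^sup>2) = en J s a"
  by (simp add: en_def jw_def)

lemma summable_on_if_hb:
  assumes "hb s a B"
  shows "(\<lambda>n. (real_of_int (n\<^sup>2) + 1) powr s * (cmod (a n))\<^sup>2) summable_on UNIV"
  using hb_en[OF assms] by (intro nonneg_bdd_above_summable_on bdd_aboveI[of _ B]) (auto simp only: hs_sum_eq_en, auto)

lemma hs_norm_le:
  assumes "hb s (fc v) B"
  shows "hs_norm s v \<le> sqrt B"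
proof -
  have "(\<Sum>\<^sub>\<infinity>n. (real_of_int (n\<^sup>2) + 1) powr s * (cmod (fc v n))\<^sup>2) \<le> B"
    by (rule infsum_le_finite_sums[OF summable_on_if_hb[OF assms]]) (simp only: hs_sum_eq_en hb_en[OF assms])
  then show ?thesis unfolding hs_norm_def by (rule real_sqrt_le_mono)
qed

lemma hs_norm_nonneg: "0 \<le> hs_norm s v"
  unfolding hs_norm_def by (intro real_sqrt_ge_zero infsum_nonneg) auto

lemma hb_hs_norm_if_summable:
  assumes "(\<lambda>n. (real_of_int (n\<^sup>2) + 1) powr s * (cmod (fc v n))\<^sup>2) summable_on UNIV"
  shows "hb s (fc v) ((hs_norm s v)\<^sup>2)"
  unfolding hb_def
proof (intro allI impI)
  fix J :: "int set" assume J: "finite J"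
  have "en J s (fc v) \<le> (\<Sum>\<^sub>\<infinity>n. (real_of_int (n\<^sup>2) + 1) powr s * (cmod (fc v n))\<^sup>2)"
    unfolding hs_sum_eq_en[symmetric] by (intro finite_sum_le_infsum assms J) auto
  also have "\<dots> = (hs_norm s v)\<^sup>2"
    unfolding hs_norm_def by (intro real_sqrt_pow2[symmetric] infsum_nonneg) auto
  finally show "en J s (fc v) \<le> (hs_norm s v)\<^sup>2" .
qed

lemma hb_hs_norm: "hb s (fc v) B \<Longrightarrow> hb s (fc v) ((hs_norm s v)\<^sup>2)"
  by (rule hb_hs_norm_if_summable[OF summable_on_if_hb])

lemma Hs_iff: "v \<in> Hs s \<longleftrightarrow> inL2per v \<and> (\<exists>B. hb s (fc v) B)"
  unfolding Hs_def using hb_hs_norm_if_summable[of s v] summable_on_if_hb[of s "fc v"] by blast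

lemma Hs_hb: "v \<in> Hs s \<Longrightarrow> hb s (fc v) ((hs_norm s v)\<^sup>2)"
  unfolding Hs_iff by (auto intro: hb_hs_norm)

lemma Hs_inL2per: "v \<in> Hs s \<Longrightarrow> inL2per v"
  by (simp add: Hs_def)

lemma Hs_fc_diff: "u \<in> Hs s \<Longrightarrow> v \<in> Hs s' \<Longrightarrow> fc (\<lambda>x. u x - v x) = (\<lambda>n. fc u n - fc v n)"
  by (rule ext, rule fc_diff) (auto dest: Hs_inL2per)

lemma Hs_diff_hb:
  assumes "u \<in> Hs s" "v \<in> Hs s"
  shows "hb s (\<lambda>n. fc u n - fc v n) ((hs_norm s (\<lambda>x. u x - v x))\<^sup>2)"
  using hb_hs_norm[of s "\<lambda>x. u x - v x"] hb_diff[OF Hs_hb[OF assms(1)] Hs_hb[OF assms(2)]]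
  unfolding Hs_fc_diff[OF assms] by blast

context cgl
begin

lemma cgl_solution_wsol:
  assumes u: "cgl_solution L \<omega> \<beta> s u0 u" and s: "0 \<le> s"
  shows "wsol L (\<lambda>t. fc (u t))"
proof -
  have uH: "u t \<in> Hs s" if "0 \<le> t" for t using u that by (simp add: cgl_solution_def)
  have u1: "u t \<in> Hs 1" if "0 < t" for t using u that by (simp add: cgl_solution_def)
  have uc: "((\<lambda>\<tau>. hs_norm s (\<lambda>x. u \<tau> x - u t x)) \<longlongrightarrow> 0) (at t within {0..})" if "0 \<le> t" for t
    using u that by (simp add: cgl_solution_def)
  have ud: "((\<lambda>\<tau>. fc (u \<tau>) n) has_vector_derivative
        (- (1 + \<i> * of_real L) * of_int (n\<^sup>2) * fc (u t) n + \<beta> * fc (u t) n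
         - (1 + \<i> * of_real \<omega>) * fc (\<lambda>x. u t x * of_real ((cmod (u t x))\<^sup>2)) n)) (at t)" if "0 < t" for n t
    using u that unfolding cgl_solution_def by blast
  show ?thesis
    unfolding wsol_def
  proof (intro conjI allI impI)
    show "\<exists>B. hb 0 (fc (u t)) B" if "0 \<le> t" for t
      using hb_mono[OF Hs_hb[OF uH[OF that]] s] by blast
    show "\<exists>B. hb 1 (fc (u t)) B" if "0 < t" for t
      using Hs_hb[OF u1[OF that]] by blast
    show "\<forall>\<^sub>F \<tau> in at t within {0..}. hb 0 (\<lambda>n. fc (u \<tau>) n - fc (u t) n) \<epsilon>" if t: "0 \<le> t" and \<epsilon>: "0 < \<epsilon>" for t \<epsilon>
    proof -
      have "\<forall>\<^sub>F \<tau> in at t within {0..}. hs_norm s (\<lambda>x. u \<tau> x - u t x) < sqrt \<epsilon>"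
        by (rule order_tendstoD(2)[OF uc[OF t]]) (use \<epsilon> in simp)
      moreover have "\<forall>\<^sub>F \<tau> in at t within {0..}. 0 \<le> \<tau>" by (simp add: eventually_at_filter)
      ultimately show ?thesis
      proof eventually_elim
        case (elim \<tau>)
        have "(hs_norm s (\<lambda>x. u \<tau> x - u t x))\<^sup>2 \<le> (sqrt \<epsilon>)\<^sup>2"
          using elim(1) hs_norm_nonneg by (intro power_mono) auto
        then have "(hs_norm s (\<lambda>x. u \<tau> x - u t x))\<^sup>2 \<le> \<epsilon>" using \<epsilon> by simp
        then show ?case by (rule hb_le[OF hb_mono[OF Hs_diff_hb[OF uH[OF elim(2)] uH[OF t]] s]])
      qed
    qed
    show "((\<lambda>\<tau>. fc (u \<tau>) n) has_vector_derivative (lin L n * fc (u t) n - nu * Nl (fc (u t)) n)) (at t)" if t: "0 < t" for n t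
    proof -
      \<comment> \<open>Membership of H^1 puts the coefficients in l^1, so the cubic term of the
        representative is determined by them.\<close>
      have "hb (3/4) (fc (u t)) ((hs_norm 1 (u t))\<^sup>2)" by (rule hb_mono[OF Hs_hb[OF u1[OF t]]]) simp
      from fc_cube[OF Hs_inL2per[OF u1[OF t]] hb_lb[OF this]]
      have "fc (\<lambda>x. u t x * of_real ((cmod (u t x))\<^sup>2)) n = Nl (fc (u t)) n" .
      with ud[OF t, of n] show ?thesis by (simp only: lin_def distrib_right)
    qed
  qed
qed

lemma cgl_solution_fc:
  assumes "cgl_solution L \<omega> \<beta> s u0 u" "0 \<le> s" "0 \<le> t"
  shows "fc (u t) = flow L (fc u0) t"
proof -
  have "fc (u 0) = fc u0" using assms(1) by (auto simp: cgl_solution_def)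
  then show ?thesis using wsol_unique[OF cgl_solution_wsol[OF assms(1,2)] assms(3)] by auto
qed

lemma cgl_solution_exists:
  assumes s: "0 \<le> s" and u0: "u0 \<in> Hs s"
  shows "\<exists>u. cgl_solution L \<omega> \<beta> s u0 u"
proof -
  define a where "a = fc u0"
  \<comment> \<open>At positive times smoothing makes the coefficients absolutely summable and the
    series a representative. At time 0 they may be only square summable, so \<open>u0\<close> itself
    is kept.\<close>
  define u where "u t = (if t = 0 then u0 else ser (flow L a t))" for t :: real
  define x where "x = (hs_norm s u0)\<^sup>2"
  have as: "hb s a x" unfolding a_def x_def by (rule Hs_hb[OF u0])
  have a0: "hb 0 a x" by (rule hb_mono[OF as s])
  have lbf: "\<exists>B. lb (flow L a t) B" if "0 < t" for t
  proof -
    have "hb (3/4) (flow L a t) (2 * Sm (3/4) x * (1 + t powr (- (3/4))))"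
      by (rule flow_smoothing[OF a0 _ that]) simp
    then show ?thesis using hb_lb by blast
  qed
  have fu: "fc (u t) = flow L a t" if t: "0 \<le> t" for t
  proof (cases "t = 0")
    case True then show ?thesis using flow_0[OF a0] by (auto simp: u_def a_def)
  next
    case False
    then obtain B where "lb (flow L a t) B" using lbf[of t] t by auto
    then show ?thesis using False fc_ser by (auto simp: u_def)
  qed
  have iu: "inL2per (u t)" if t: "0 \<le> t" for t
  proof (cases "t = 0")
    case True then show ?thesis using Hs_inL2per[OF u0] by (simp add: u_def)
  next
    case False
    then obtain B where "lb (flow L a t) B" using lbf[of t] t by auto
    then show ?thesis using False inL2per_ser by (simp add: u_def)
  qed
  have uH: "u t \<in> Hs s" if t: "0 \<le> t" for t
    unfolding Hs_iff fu[OF t] using iu[OF t] flow_bound[OF as s t] by blast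
  have u1: "u t \<in> Hs 1" if t: "0 < t" for t
  proof -
    have "hb 1 (flow L a t) (2 * Sm 1 x * (1 + t powr (- 1)))" by (rule flow_smoothing[OF a0 _ t]) simp
    then show ?thesis unfolding Hs_iff fu[OF less_imp_le[OF t]] using iu t by auto
  qed
  have "cgl_solution L \<omega> \<beta> s u0 u"
    unfolding cgl_solution_def
  proof (intro conjI allI impI)
    show "u t \<in> Hs s" if "0 \<le> t" for t by (rule uH[OF that])
    show "u t \<in> Hs 1" if "0 < t" for t by (rule u1[OF that])
    show "fc (u 0) n = fc u0 n" for n by (simp add: u_def)
    show "((\<lambda>\<tau>. hs_norm s (\<lambda>x. u \<tau> x - u t x)) \<longlongrightarrow> 0) (at t within {0..})" if t: "0 \<le> t" for t
    proof (rule tendstoI)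
      fix e :: real assume e: "0 < e"
      have "\<forall>\<^sub>F \<tau> in at t within {0..}. hb s (\<lambda>n. flow L a \<tau> n - flow L a t n) ((e/2)\<^sup>2)"
        by (rule flow_continuous[OF s as t]) (use e in simp)
      moreover have "\<forall>\<^sub>F \<tau> in at t within {0..}. 0 \<le> \<tau>" by (simp add: eventually_at_filter)
      ultimately show "\<forall>\<^sub>F \<tau> in at t within {0..}. dist (hs_norm s (\<lambda>x. u \<tau> x - u t x)) 0 < e"
      proof eventually_elim
        case (elim \<tau>)
        have "fc (\<lambda>x. u \<tau> x - u t x) = (\<lambda>n. flow L a \<tau> n - flow L a t n)"
          unfolding Hs_fc_diff[OF uH[OF elim(2)] uH[OF t]] fu[OF elim(2)] fu[OF t] ..
        then have "hs_norm s (\<lambda>x. u \<tau> x - u t x) \<le> sqrt ((e/2)\<^sup>2)"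
          using elim(1) by (intro hs_norm_le) simp
        also have "sqrt ((e/2)\<^sup>2) = e/2" using e by (intro real_sqrt_unique) auto
        finally show ?case using e hs_norm_nonneg[of s "\<lambda>x. u \<tau> x - u t x"] by simp
      qed
    qed
    fix n :: int and t :: real assume t: "0 < t"
    have fct: "fc (u t) = flow L a t" using t by (intro fu) simp
    have "((\<lambda>\<tau>. fc (u \<tau>) n) has_vector_derivative (lin L n * flow L a t n - nu * Nl (flow L a t) n)) (at t)"
      by (rule has_vector_derivative_transform_within_open[OF flow_deriv[OF a0 t], of "{0<..}"])
         (use t in \<open>auto simp: fu\<close>)
    moreover have "fc (\<lambda>x. u t x * of_real ((cmod (u t x))\<^sup>2)) n = Nl (flow L a t) n"
    proof -
      obtain B where "lb (fc (u t)) B" using lbf[OF t] fct by auto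
      from fc_cube[OF iu[OF less_imp_le[OF t]] this] show ?thesis by (simp only: fct)
    qed
    ultimately show "((\<lambda>\<tau>. fc (u \<tau>) n) has_vector_derivative
        (- (1 + \<i> * of_real L) * of_int (n\<^sup>2) * fc (u t) n + \<beta> * fc (u t) n
         - (1 + \<i> * of_real \<omega>) * fc (\<lambda>x. u t x * of_real ((cmod (u t x))\<^sup>2)) n)) (at t)"
      by (simp only: fct lin_def distrib_right)
  qed
  then show ?thesis by blast
qed

section \<open>Stability and the uniform estimates for solutions\<close>

lemma cgl_solution_Hs: "cgl_solution L \<omega> \<beta> s u0 u \<Longrightarrow> 0 \<le> t \<Longrightarrow> u t \<in> Hs s"
  by (simp add: cgl_solution_def)

text \<open>Both solutions follow the flow, whose Lipschitz estimate concerns squared norms; the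
  square root halves the rate.\<close>

lemma cgl_solution_diff_le:
  assumes s: "0 \<le> s" and u: "cgl_solution L \<omega> \<beta> s u0 u" and v: "cgl_solution L \<omega> \<beta> s v0 v"
    and u0: "u0 \<in> Hs s" and v0: "v0 \<in> Hs s" and t: "0 \<le> t"
    and x: "hb s (fc u0) x" "hb s (fc v0) x"
  shows "hs_norm s (\<lambda>x. u t x - v t x)
    \<le> exp (Kc s (x + Gs s (x + C0)) / 2 * t) * hs_norm s (\<lambda>x. u0 x - v0 x)"
proof -
  let ?K = "Kc s (x + Gs s (x + C0))"
  have "hb s (\<lambda>n. flow L (fc u0) t n - flow L (fc v0) t n) (exp (?K * t) * (hs_norm s (\<lambda>x. u0 x - v0 x))\<^sup>2)"
    by (rule flow_lipschitz[OF x Hs_diff_hb[OF u0 v0] s t])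
  then have "hs_norm s (\<lambda>x. u t x - v t x) \<le> sqrt (exp (?K * t) * (hs_norm s (\<lambda>x. u0 x - v0 x))\<^sup>2)"
    by (intro hs_norm_le)
       (simp only: Hs_fc_diff[OF cgl_solution_Hs[OF u t] cgl_solution_Hs[OF v t]] cgl_solution_fc[OF u s t] cgl_solution_fc[OF v s t])
  also have "exp (?K * t) * (hs_norm s (\<lambda>x. u0 x - v0 x))\<^sup>2 = (exp (?K / 2 * t) * hs_norm s (\<lambda>x. u0 x - v0 x))\<^sup>2"
    by (simp add: power_mult_distrib exp_double[symmetric])
  also have "sqrt \<dots> = exp (?K / 2 * t) * hs_norm s (\<lambda>x. u0 x - v0 x)"
    using hs_norm_nonneg by (intro real_sqrt_unique) auto
  finally show ?thesis .
qed

lemma cgl_continuous_dependence: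
  assumes s: "0 \<le> s" and u: "cgl_solution L \<omega> \<beta> s u0 u" and u0: "u0 \<in> Hs s" and \<epsilon>: "0 < \<epsilon>"
  shows "\<exists>\<delta>>0. \<forall>v0 v. v0 \<in> Hs s \<and> cgl_solution L \<omega> \<beta> s v0 v \<and>
                   hs_norm s (\<lambda>x. v0 x - u0 x) < \<delta> \<longrightarrow>
                   (\<forall>t\<in>{0..T}. hs_norm s (\<lambda>x. v t x - u t x) < \<epsilon>)"
proof -
  define y where "y = (hs_norm s u0)\<^sup>2"
  \<comment> \<open>\<delta> \<le> 1 below keeps \<open>v0\<close> within distance 1 of
    \<open>u0\<close>, so that this bounds the squared norms of both.\<close>
  define x where "x = 2 * 1 + 2 * y"
  have y: "hb s (fc u0) y" unfolding y_def by (rule Hs_hb[OF u0])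
  have y0: "0 \<le> y" by (simp add: y_def)
  have xu: "hb s (fc u0) x" by (rule hb_le[OF y]) (use y0 in \<open>simp add: x_def\<close>)
  define K where "K = Kc s (x + Gs s (x + C0)) / 2"
  have "1 \<le> Kc s (x + Gs s (x + C0))"
    using y0 C0_pos by (intro Kc_ge_1 add_nonneg_nonneg Gs_nonneg) (auto simp: x_def)
  then have K: "0 \<le> K" by (simp add: K_def)
  define \<delta> where "\<delta> = min 1 (\<epsilon> / exp (K * T))"
  have \<delta>: "0 < \<delta>" using \<epsilon> by (simp add: \<delta>_def)
  show ?thesis
  proof (intro exI[of _ \<delta>] conjI \<delta> allI impI ballI)
    fix v0 v t
    assume "v0 \<in> Hs s \<and> cgl_solution L \<omega> \<beta> s v0 v \<and> hs_norm s (\<lambda>x. v0 x - u0 x) < \<delta>"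
    then have v0: "v0 \<in> Hs s" and v: "cgl_solution L \<omega> \<beta> s v0 v" and D: "hs_norm s (\<lambda>x. v0 x - u0 x) < \<delta>" by auto
    assume t: "t \<in> {0..T}"
    have D1: "(hs_norm s (\<lambda>x. v0 x - u0 x))\<^sup>2 \<le> 1"
      using D hs_norm_nonneg by (intro power_le_one) (auto simp: \<delta>_def)
    have "hb s (\<lambda>n. (fc v0 n - fc u0 n) + fc u0 n) (2 * (hs_norm s (\<lambda>x. v0 x - u0 x))\<^sup>2 + 2 * y)"
      by (rule hb_add[OF Hs_diff_hb[OF v0 u0] y])
    then have "hb s (fc v0) (2 * (hs_norm s (\<lambda>x. v0 x - u0 x))\<^sup>2 + 2 * y)" by simp
    then have xv: "hb s (fc v0) x" by (rule hb_le) (use D1 in \<open>simp add: x_def\<close>)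
    have "hs_norm s (\<lambda>x. v t x - u t x) \<le> exp (K * t) * hs_norm s (\<lambda>x. v0 x - u0 x)"
      unfolding K_def using t by (intro cgl_solution_diff_le[OF s v u v0 u0 _ xv xu]) auto
    also have "\<dots> \<le> exp (K * T) * hs_norm s (\<lambda>x. v0 x - u0 x)"
      using t K hs_norm_nonneg by (intro mult_right_mono) (auto intro!: mult_left_mono)
    also have "\<dots> < exp (K * T) * \<delta>" using D by simp
    also have "\<dots> \<le> exp (K * T) * (\<epsilon> / exp (K * T))" by (intro mult_left_mono) (auto simp: \<delta>_def)
    also have "\<dots> = \<epsilon>" by simp
    finally show "hs_norm s (\<lambda>x. v t x - u t x) < \<epsilon>" .
  qed
qed

lemma Qd_mono:
  assumes "0 \<le> x" "x \<le> y" "0 \<le> s"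
  shows "Qd s x \<le> Qd s y"
  unfolding Qd_def using assms C0_pos
  by (intro mult_mono add_mono Gs_mono add_nonneg_nonneg Gs_nonneg) auto

lemma Sm_mono:
  assumes "0 \<le> x" "x \<le> y" "0 \<le> s"
  shows "Sm s x \<le> Sm s y"
  unfolding Sm_def using assms C0_pos
  by (intro mult_left_mono add_mono Gs_mono) auto

text \<open>\<open>mono\<close> concerns the whole real line, whereas the bounds increase only for
  nonnegative arguments; cutting off at 0 changes nothing on norms. The square and the root
  translate from squared norms.\<close>

lemma mono_sqrt_max:
  fixes f :: "real \<Rightarrow> real"
  assumes "\<And>x y. 0 \<le> x \<Longrightarrow> x \<le> y \<Longrightarrow> f x \<le> f y"
  shows "mono (\<lambda>y. sqrt (f ((max 0 y)\<^sup>2)))"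
  by (intro monoI real_sqrt_le_mono assms power_mono) auto

lemma cgl_dissipative:
  assumes s: "0 \<le> s"
  shows "\<exists>Q \<kappa> C L0. mono (Q :: real \<Rightarrow> real) \<and> \<kappa> > 0 \<and> C > 0 \<and>
        (\<forall>L\<ge>L0. \<forall>u0 u. u0 \<in> Hs s \<and> cgl_solution L \<omega> \<beta> s u0 u \<longrightarrow>
           (\<forall>t\<ge>0. hs_norm s (u t) \<le> Q (hs_norm s u0) * exp (- \<kappa> * t) + C))"
proof -
  define Q where "Q y = sqrt (Qd s ((max 0 y)\<^sup>2))" for y
  \<comment> \<open>The 1 guarantees positivity.\<close>
  define C where "C = sqrt (Gs s (1 + C0)) + 1"
  have Q: "mono Q" unfolding Q_def by (rule mono_sqrt_max) (rule Qd_mono[OF _ _ s])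
  have G: "0 \<le> Gs s (1 + C0)" using C0_pos by (intro Gs_nonneg) simp
  have C: "0 < C" using G by (simp add: C_def add_nonneg_pos)
  have "hs_norm s (u t) \<le> Q (hs_norm s u0) * exp (- (1/2) * t) + C"
    if u0: "u0 \<in> Hs s" and u: "cgl_solution L \<omega> \<beta> s u0 u" and t: "0 \<le> t" for L u0 u t
  proof -
    let ?x = "(hs_norm s u0)\<^sup>2"
    have Q0: "0 \<le> Qd s ?x"
      unfolding Qd_def using C0_pos by (intro mult_nonneg_nonneg add_nonneg_nonneg Gs_nonneg) auto
    have "hb s (fc (u t)) (exp (- t) * Qd s ?x + Gs s (1 + C0))"
      unfolding cgl_solution_fc[OF u s t] by (rule flow_dissipative[OF Hs_hb[OF u0] s t])
    then have "hs_norm s (u t) \<le> sqrt (exp (- t) * Qd s ?x + Gs s (1 + C0))" by (rule hs_norm_le)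
    also have "\<dots> \<le> sqrt (exp (- t) * Qd s ?x) + sqrt (Gs s (1 + C0))"
      using Q0 G by (intro sqrt_add_le_add_sqrt) auto
    also have "sqrt (exp (- t) * Qd s ?x) = Q (hs_norm s u0) * exp (- (1/2) * t)"
    proof -
      have "sqrt (exp (- t)) = exp (- (1/2) * t)"
        by (intro real_sqrt_unique) (auto simp: exp_double[symmetric])
      then show ?thesis using hs_norm_nonneg[of s u0] by (simp add: real_sqrt_mult Q_def max_def mult.commute)
    qed
    finally show ?thesis by (simp add: C_def)
  qed
  \<comment> \<open>The bounds hold for every real \<open>L\<close>, so the threshold 0 is
    arbitrary. The rate 1/2 is half the decay rate of the squared norm.\<close>
  then show ?thesis
    using Q C by (intro exI[of _ Q] exI[of _ "1/2"] exI[of _ C] exI[of _ 0]) auto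
qed

lemma cgl_smoothing:
  assumes s: "0 \<le> s"
  shows "\<exists>Q N L0. mono (Q :: real \<Rightarrow> real) \<and>
        (\<forall>L\<ge>L0. \<forall>u0 u. u0 \<in> Hs 0 \<and> cgl_solution L \<omega> \<beta> 0 u0 u \<longrightarrow>
           (\<forall>t>0. u t \<in> Hs s \<and> hs_norm s (u t) \<le> (1 + t powr (- N)) * Q (hs_norm 0 u0)))"
proof -
  define Q where "Q y = sqrt (2 * Sm s ((max 0 y)\<^sup>2))" for y
  have Q: "mono Q" unfolding Q_def by (rule mono_sqrt_max) (simp add: Sm_mono[OF _ _ s])
  have "u t \<in> Hs s \<and> hs_norm s (u t) \<le> (1 + t powr (- s)) * Q (hs_norm 0 u0)"
    if u0: "u0 \<in> Hs 0" and u: "cgl_solution L \<omega> \<beta> 0 u0 u" and t: "0 < t" for L u0 u t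
  proof
    let ?x = "(hs_norm 0 u0)\<^sup>2"
    have hb: "hb s (fc (u t)) (2 * Sm s ?x * (1 + t powr (- s)))"
      unfolding cgl_solution_fc[OF u order_refl less_imp_le[OF t]] by (rule flow_smoothing[OF Hs_hb[OF u0] s t])
    then show "u t \<in> Hs s"
      unfolding Hs_iff using Hs_inL2per[OF cgl_solution_Hs[OF u less_imp_le[OF t]]] by blast
    have S0: "0 \<le> Sm s ?x"
      unfolding Sm_def using C0_pos s by (intro mult_nonneg_nonneg add_nonneg_nonneg Gs_nonneg) auto
    have "hs_norm s (u t) \<le> sqrt (2 * Sm s ?x * (1 + t powr (- s)))" using hb by (rule hs_norm_le)
    also have "\<dots> = sqrt (1 + t powr (- s)) * Q (hs_norm 0 u0)"
      using hs_norm_nonneg[of 0 u0] by (simp only: Q_def max_absorb2 real_sqrt_mult mult.commute)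
    \<comment> \<open>Keeping the root would give the exponent s/2; any exponent independent of
      \<open>L\<close> will do.\<close>
    also have "\<dots> \<le> (1 + t powr (- s)) * Q (hs_norm 0 u0)"
    proof (rule mult_right_mono)
      show "sqrt (1 + t powr (- s)) \<le> 1 + t powr (- s)"
        using self_le_power[of "1 + t powr (- s)" 2] by (intro real_le_lsqrt) auto
      show "0 \<le> Q (hs_norm 0 u0)"
        unfolding Q_def using S0 hs_norm_nonneg[of 0 u0] by (simp add: max_absorb2)
    qed
    finally show "hs_norm s (u t) \<le> (1 + t powr (- s)) * Q (hs_norm 0 u0)" .
  qed
  then show ?thesis
    using Q by (intro exI[of _ Q] exI[of _ s] exI[of _ 0]) auto
qed

lemma cgl_lipschitz:
  "\<exists>K :: real \<Rightarrow> real \<Rightarrow> real. \<exists>L0. \<forall>L\<ge>L0. \<forall>u0 v0 u v.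
        u0 \<in> Hs 0 \<and> v0 \<in> Hs 0 \<and> cgl_solution L \<omega> \<beta> 0 u0 u \<and> cgl_solution L \<omega> \<beta> 0 v0 v \<longrightarrow>
        (\<forall>t\<ge>0. hs_norm 0 (\<lambda>x. u t x - v t x)
                 \<le> exp (K (hs_norm 0 u0) (hs_norm 0 v0) * t) * hs_norm 0 (\<lambda>x. u0 x - v0 x))"
proof -
  \<comment> \<open>The sum of the squares bounds both squared norms at once.\<close>
  define K where "K y z = Kc 0 ((y\<^sup>2 + z\<^sup>2) + Gs 0 ((y\<^sup>2 + z\<^sup>2) + C0)) / 2" for y z
  have "hs_norm 0 (\<lambda>x. u t x - v t x) \<le> exp (K (hs_norm 0 u0) (hs_norm 0 v0) * t) * hs_norm 0 (\<lambda>x. u0 x - v0 x)"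
    if "u0 \<in> Hs 0" "v0 \<in> Hs 0" "cgl_solution L \<omega> \<beta> 0 u0 u" "cgl_solution L \<omega> \<beta> 0 v0 v" "0 \<le> t" for L u0 v0 u v t
  proof -
    have "hb 0 (fc u0) ((hs_norm 0 u0)\<^sup>2 + (hs_norm 0 v0)\<^sup>2)" by (rule hb_le[OF Hs_hb[OF that(1)]]) simp
    moreover have "hb 0 (fc v0) ((hs_norm 0 u0)\<^sup>2 + (hs_norm 0 v0)\<^sup>2)" by (rule hb_le[OF Hs_hb[OF that(2)]]) simp
    ultimately show ?thesis
      unfolding K_def by (rule cgl_solution_diff_le[OF order_refl that(3,4,1,2,5)])
  qed
  then show ?thesis by blast
qed

end

theorem theorem3p2:
  fixes \<omega> :: real and \<beta> :: complex
  shows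
   "(\<forall>L s u0. 0 \<le> s \<and> u0 \<in> Hs s \<longrightarrow>
        (\<exists>u. cgl_solution L \<omega> \<beta> s u0 u) \<and>
        (\<forall>u v. cgl_solution L \<omega> \<beta> s u0 u \<and> cgl_solution L \<omega> \<beta> s u0 v \<longrightarrow>
            (\<forall>t\<ge>0. \<forall>n. fc (u t) n = fc (v t) n)) \<and>
        (\<forall>u T \<epsilon>. cgl_solution L \<omega> \<beta> s u0 u \<and> \<epsilon> > 0 \<longrightarrow>
            (\<exists>\<delta>>0. \<forall>v0 v. v0 \<in> Hs s \<and> cgl_solution L \<omega> \<beta> s v0 v \<and>
                   hs_norm s (\<lambda>x. v0 x - u0 x) < \<delta> \<longrightarrow>
                   (\<forall>t\<in>{0..T}. hs_norm s (\<lambda>x. v t x - u t x) < \<epsilon>))))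
    \<and>
    (\<forall>s\<ge>0. \<exists>Q \<kappa> C L0. mono (Q :: real \<Rightarrow> real) \<and> \<kappa> > 0 \<and> C > 0 \<and>
        (\<forall>L\<ge>L0. \<forall>u0 u. u0 \<in> Hs s \<and> cgl_solution L \<omega> \<beta> s u0 u \<longrightarrow>
           (\<forall>t\<ge>0. hs_norm s (u t) \<le> Q (hs_norm s u0) * exp (- \<kappa> * t) + C)))
    \<and>
    (\<forall>s\<ge>0. \<exists>Q N L0. mono (Q :: real \<Rightarrow> real) \<and>
        (\<forall>L\<ge>L0. \<forall>u0 u. u0 \<in> Hs 0 \<and> cgl_solution L \<omega> \<beta> 0 u0 u \<longrightarrow>
           (\<forall>t>0. u t \<in> Hs s \<and> hs_norm s (u t) \<le> (1 + t powr (- N)) * Q (hs_norm 0 u0))))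
    \<and>
    (\<exists>K :: real \<Rightarrow> real \<Rightarrow> real. \<exists>L0. \<forall>L\<ge>L0. \<forall>u0 v0 u v.
        u0 \<in> Hs 0 \<and> v0 \<in> Hs 0 \<and> cgl_solution L \<omega> \<beta> 0 u0 u \<and> cgl_solution L \<omega> \<beta> 0 v0 v \<longrightarrow>
        (\<forall>t\<ge>0. hs_norm 0 (\<lambda>x. u t x - v t x)
                 \<le> exp (K (hs_norm 0 u0) (hs_norm 0 v0) * t) * hs_norm 0 (\<lambda>x. u0 x - v0 x)))"
proof -
  interpret cgl \<omega> \<beta> .
  show ?thesis
  proof (intro conjI allI impI)
    fix L s u0 assume "0 \<le> s \<and> u0 \<in> Hs s"
    then have s: "0 \<le> s" and u0: "u0 \<in> Hs s" by auto
    show "\<exists>u. cgl_solution L \<omega> \<beta> s u0 u" by (rule cgl_solution_exists[OF s u0])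
    show "fc (u t) n = fc (v t) n"
      if "cgl_solution L \<omega> \<beta> s u0 u \<and> cgl_solution L \<omega> \<beta> s u0 v" "0 \<le> t" for u v t n
      using cgl_solution_fc[OF conjunct1[OF that(1)] s that(2)]
        cgl_solution_fc[OF conjunct2[OF that(1)] s that(2)] by simp
    show "\<exists>\<delta>>0. \<forall>v0 v. v0 \<in> Hs s \<and> cgl_solution L \<omega> \<beta> s v0 v \<and>
                   hs_norm s (\<lambda>x. v0 x - u0 x) < \<delta> \<longrightarrow>
                   (\<forall>t\<in>{0..T}. hs_norm s (\<lambda>x. v t x - u t x) < \<epsilon>)"
      if "cgl_solution L \<omega> \<beta> s u0 u \<and> \<epsilon> > 0" for u T \<epsilon>
      using that by (intro cgl_continuous_dependence[OF s _ u0]) auto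
  qed (rule cgl_dissipative cgl_smoothing cgl_lipschitz; assumption?)+
qed

end
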